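(* Let $J$ be a random potential satisfying the standing stochastic assumption (given in the context). Let $(\ell_n)\subset\mathbb R$ be a sequence with $\ell_n\to\mathbb E[\delta]$, and with $\ell_n>\mathbb E[\delta]$ and $\ell_n>\frac1n\sum_{k=0}^{n-1}\delta(\tau_k\omega)$ for every $n\in\mathbb N$, such that $$\gamma_n:=\frac{\ell_n-\sum_{k=0}^{n-1}\lambda_n\delta(\tau_k\omega)}{\sqrt{\lambda_n}}\longrightarrow\gamma\qquad (n\to\infty),\qquad \lambda_n=\tfrac1n ,$$ for some $\gamma\in\mathbb R$ (so that $\gamma\ge0$ and $\gamma_n>0$ for all $n$); here $\omega\in\Omega$. Let $(v_n)$ be a sequence of functions such that $$\sup_n E_n^{\gamma_n}(\omega,v_n)<+\infty\qquad\text{for every }\omega\in\Omega .$$ Then there exist a subsequence $(v_{n_k})$ and a function $v\in SBV^{\gamma}(0,1)$ such that $v_{n_k}\to v$ in $L^1(0,1)$ and $$v'\in L^2(0,1),\qquad \#S_v<+\infty,\qquad [v]\ge 0\ \text{ in } [0,1].$$ Moreover, there exists a finite set $S\subset[0,1]$ such that $v_{n_k}\rightharpoonup v$ locally weakly in $H^1((0,1)\setminus S)$.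
   Context: **Class of Lennard-Jones type potentials.** Fix $\alpha\in(0,1]$, $b>0$, $c>0$, $d\in(1,+\infty)$, $\eta>0$ and a convex function $\Psi:\mathbb R\to[0,+\infty]$ with $\lim_{z\to0^+}\Psi(z)=+\infty$. (The constant $\alpha$ does not appear in the conditions below.) $\mathcal J=\mathcal J(\alpha,b,c,d,\Psi,\eta)$ is the class of functions $J:\mathbb R\to\mathbb R\cup\{+\infty\}$ such that: - (LJ1) $J$ is $C^3$ on its domain, $\lim_{z\to0^+}J(z)=\infty$, and $J(z)=\infty$ for $z\le0$. - (LJ2) $J$ has a unique minimizer $\delta$, with $\delta\in(\frac1d,d)$ and $J(\delta)<0$, and $J$ is strictly convex on $(0,\delta)$. Moreover $\|J\|_{L^\infty(\delta,\infty)}<b$ and $\frac1d\Psi(z)-d\le J(z)\le d\max\{\Psi(z),|z|\}$ for all $z\in(0,+\infty)$. - (LJ3) $\lim_{z\to\infty}J(z)=0$. - (LJ4) For $|z-\delta|<\eta$: $J(z)-J(\delta)\ge\frac1c(z-\delta)^2$. **Stochastic setting (standing stochastic assumption).** $(\Omega,\mathcal F,\mathbb P)$ is a probability space and $(\tau_i)_{i\in\mathbb Z}$ is a family of measurable maps $\tau_i:\Omega\to\Omega$ which is an additive group action ($\tau_0\omega=\omega$ for all $\omega$, $\tau_{i_1+i_2}=\tau_{i_1}\tau_{i_2}$), stationary ($\mathbb P(\tau_iB)=\mathbb P(B)$ for all $B\in\mathcal F$, $i\in\mathbb Z$) and ergodic (if $B\in\mathcal F$ and $\tau_i(B)=B$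 for all $i\in\mathbb Z$, then $\mathbb P(B)=0$ or $\mathbb P(B)=1$). $J:\Omega\to\mathcal J(\alpha,b,c,d,\Psi,\eta)$, $\omega\mapsto J(\omega,\cdot)$, is measurable. Write $\delta(\omega)$ for the unique minimizer of $J(\omega,\cdot)$, $\mathbb E[\delta]$ for its expectation, and for $0<\kappa<\frac1d$ set $C^\kappa(\omega):=\sup\{|\frac{\partial^3J}{\partial z^3}(\omega,z)|: z\in[\delta(\omega)-\kappa,\delta(\omega)+\kappa]\}$. It is assumed that - (R1) there exists $0<\kappa^*<\frac1d$ with $\mathbb E[C^{\kappa^*}]<\infty$; - (R2) $\lim_{z\to\infty}\max_{\omega\in\Omega}|J(\omega,z)|=0$. **Energy.** Let $\lambda_n=\frac1n$ and let $\mathcal A_n$ be the set of $v\in C([0,1])$ that are affine on each interval $(i,i+1)\lambda_n$, $i=0,\dots,n-1$; write $v^i=v(i\lambda_n)$. The functional $E_n^{\gamma_n}:\Omega\times L^1(0,1)\to(-\infty,+\infty]$ is $$E_n^{\gamma_n}(\omega,v):=\sum_{i=0}^{n-1}\Big(J\big(\tau_i\omega,\tfrac{v^{i+1}-v^i}{\sqrt{\lambda_n}}+\delta(\tau_i\omega)\big)-J\big(\tau_i\omega,\delta(\tau_i\omega)\big)\Big)$$ if $v\in\mathcal A_n$ with $v(0)=0$, $v(1)=\gamma_n$, and $E_n^{\gamma_n}(\omega,v):=+\infty$ otherwise. **SBV notation.** $SBV^\gamma(0,1)$ is the space of special functions of bounded variation on $(0,1)$ with the additional boundary constraint $v(0-)=0$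 and $v(1+)=\gamma$. For such $v$, $v(x+)$ (for $x\in[0,1)$) and $v(x-)$ (for $x\in(0,1]$) are the right and left essential limits, $[v](x):=v(x+)-v(x-)$ for $x\in[0,1]$ (using the constraint at $0-$ and $1+$, so jumps at the boundary points $0$ and $1$ are counted), and $S_v:=\{x\in[0,1]:[v](x)\ne0\}$. $v'$ denotes the density of the absolutely continuous part of the derivative of $v$. *)

theory Defs
  imports "HOL-Probability.Probability"
begin

section \<open>Lennard-Jones type potentials\<close>

definition dom_fin :: "(real \<Rightarrow> ereal) \<Rightarrow> real set" where
  "dom_fin J = {z. J z \<noteq> \<infinity>}"

text \<open>Derivatives are taken within the domain of finiteness, so that they are one-sided at
  an end point of the domain, should it belong to the domain.\<close>

primrec nth_deriv_within :: "real set \<Rightarrow> nat \<Rightarrow> (real \<Rightarrow> real) \<Rightarrow> real \<Rightarrow> real" where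
  "nth_deriv_within D 0 f = f"
| "nth_deriv_within D (Suc k) f =
     (\<lambda>z. vector_derivative (nth_deriv_within D k f) (at z within D))"

definition C_k_on :: "nat \<Rightarrow> real set \<Rightarrow> (real \<Rightarrow> real) \<Rightarrow> bool" where
  "C_k_on k D f \<longleftrightarrow>
     (\<forall>j<k. \<forall>z\<in>D. nth_deriv_within D j f differentiable (at z within D)) \<and>
     continuous_on D (nth_deriv_within D k f)"

definition third_deriv :: "(real \<Rightarrow> ereal) \<Rightarrow> real \<Rightarrow> real" where
  "third_deriv J = nth_deriv_within (dom_fin J) 3 (\<lambda>z. real_of_ereal (J z))"

definition convex_ext :: "(real \<Rightarrow> ereal) \<Rightarrow> bool" where
  "convex_ext f \<longleftrightarrow>
     (\<forall>x y t. 0 < t \<and> t < 1 \<longrightarrow>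
        f ((1 - t) * x + t * y) \<le> ereal (1 - t) * f x + ereal t * f y)"

text \<open>As usual for extended-valued functions, the strict inequality is required at points
  where the function is finite.\<close>

definition strictly_convex_ext_on :: "real set \<Rightarrow> (real \<Rightarrow> ereal) \<Rightarrow> bool" where
  "strictly_convex_ext_on A f \<longleftrightarrow>
     (\<forall>x\<in>A. \<forall>y\<in>A. \<forall>t. x \<noteq> y \<and> 0 < t \<and> t < 1 \<and> f x \<noteq> \<infinity> \<and> f y \<noteq> \<infinity> \<longrightarrow>
        f ((1 - t) * x + t * y) < ereal (1 - t) * f x + ereal t * f y)"

definition minimizer :: "(real \<Rightarrow> ereal) \<Rightarrow> real" where
  "minimizer J = arg_min J (\<lambda>_. True)"

text \<open>The parameter \<open>\<alpha>\<close> does not occur in the conditions defining the class.\<close>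

definition LJ_class ::
  "real \<Rightarrow> real \<Rightarrow> real \<Rightarrow> real \<Rightarrow> (real \<Rightarrow> ereal) \<Rightarrow> real \<Rightarrow> (real \<Rightarrow> ereal) set" where
  "LJ_class \<alpha> b c d \<Psi> \<eta> =
    {J. (\<forall>z. J z \<noteq> -\<infinity>) \<and>
        \<comment> \<open>LJ1\<close>
        C_k_on 3 (dom_fin J) (\<lambda>z. real_of_ereal (J z)) \<and>
        (J \<longlongrightarrow> \<infinity>) (at_right 0) \<and>
        (\<forall>z\<le>0. J z = \<infinity>) \<and>
        \<comment> \<open>LJ2\<close>
        (\<exists>!z. is_arg_min J (\<lambda>_. True) z) \<and>
        minimizer J \<in> {1/d<..<d} \<and>
        J (minimizer J) < 0 \<and>
        strictly_convex_ext_on {0<..<minimizer J} J \<and>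
        esssup (restrict_space lborel {minimizer J<..}) (\<lambda>z. \<bar>J z\<bar>) < ereal b \<and>
        (\<forall>z>0. ereal (1/d) * \<Psi> z - ereal d \<le> J z \<and>
               J z \<le> ereal d * max (\<Psi> z) (ereal \<bar>z\<bar>)) \<and>
        \<comment> \<open>LJ3\<close>
        (J \<longlongrightarrow> 0) at_top \<and>
        \<comment> \<open>LJ4\<close>
        (\<forall>z. \<bar>z - minimizer J\<bar> < \<eta> \<longrightarrow>
             J z - J (minimizer J) \<ge> ereal (1/c * (z - minimizer J)\<^sup>2))}"

text \<open>The supremum \<open>C\<^sup>\<kappa>\<close>, taken over those points of the interval at which the
  potential is finite (elsewhere there is no derivative to speak of).\<close>

definition third_deriv_sup :: "(real \<Rightarrow> ereal) \<Rightarrow> real \<Rightarrow> ennreal" where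
  "third_deriv_sup J \<kappa> =
     (SUP z \<in> {minimizer J - \<kappa> .. minimizer J + \<kappa>} \<inter> dom_fin J. ennreal \<bar>third_deriv J z\<bar>)"

section \<open>Stochastic setting\<close>

locale ergodic_action = prob_space M for M :: "'w measure" +
  fixes \<tau> :: "int \<Rightarrow> 'w \<Rightarrow> 'w"
  assumes action_measurable: "\<And>i. \<tau> i \<in> M \<rightarrow>\<^sub>M M"
    and action_zero: "\<And>\<omega>. \<omega> \<in> space M \<Longrightarrow> \<tau> 0 \<omega> = \<omega>"
    and action_add: "\<And>i j \<omega>. \<omega> \<in> space M \<Longrightarrow> \<tau> (i + j) \<omega> = \<tau> i (\<tau> j \<omega>)"
    and stationary: "\<And>B i. B \<in> sets M \<Longrightarrow> prob (\<tau> i ` B) = prob B"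
    and ergodic: "\<And>B. B \<in> sets M \<Longrightarrow> (\<And>i. \<tau> i ` B = B) \<Longrightarrow> prob B = 0 \<or> prob B = 1"

text \<open>The class of potentials carries the \<open>\<sigma>\<close>-algebra generated by the evaluations
  \<open>J \<mapsto> J z\<close>.\<close>

locale random_LJ_potential = ergodic_action M \<tau>
  for M :: "'w measure" and \<tau> :: "int \<Rightarrow> 'w \<Rightarrow> 'w" +
  fixes \<alpha> b c d :: real and \<Psi> :: "real \<Rightarrow> ereal" and \<eta> :: real
    and J :: "'w \<Rightarrow> real \<Rightarrow> ereal"
  assumes \<alpha>_range: "0 < \<alpha>" "\<alpha> \<le> 1"
    and b_pos: "0 < b" and c_pos: "0 < c" and d_gt_1: "1 < d" and \<eta>_pos: "0 < \<eta>"
    and \<Psi>_nonneg: "\<And>z. 0 \<le> \<Psi> z"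
    and \<Psi>_convex: "convex_ext \<Psi>"
    and \<Psi>_at_0: "(\<Psi> \<longlongrightarrow> \<infinity>) (at_right 0)"
    and J_class: "\<And>\<omega>. \<omega> \<in> space M \<Longrightarrow> J \<omega> \<in> LJ_class \<alpha> b c d \<Psi> \<eta>"
    and J_measurable: "\<And>z. (\<lambda>\<omega>. J \<omega> z) \<in> borel_measurable M"
    and R1: "\<exists>\<kappa>. 0 < \<kappa> \<and> \<kappa> < 1/d \<and> (\<integral>\<^sup>+ \<omega>. third_deriv_sup (J \<omega>) \<kappa> \<partial>M) < \<infinity>"
    and R2: "((\<lambda>z. SUP \<omega>\<in>space M. \<bar>J \<omega> z\<bar>) \<longlongrightarrow> 0) at_top"

section \<open>Energy\<close>

definition lam :: "nat \<Rightarrow> real" where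
  "lam n = 1 / real n"

definition affine_chains :: "nat \<Rightarrow> (real \<Rightarrow> real) set" where
  "affine_chains n =
    {v. continuous_on {0..1} v \<and>
        (\<forall>i<n. \<exists>p q. \<forall>x\<in>{real i * lam n<..<real (i + 1) * lam n}. v x = p + q * x)}"

definition energy ::
  "(int \<Rightarrow> 'w \<Rightarrow> 'w) \<Rightarrow> ('w \<Rightarrow> real \<Rightarrow> ereal) \<Rightarrow> nat \<Rightarrow> real \<Rightarrow> 'w \<Rightarrow> (real \<Rightarrow> real) \<Rightarrow> ereal" where
  "energy \<tau> J n g \<omega> v =
    (if v \<in> affine_chains n \<and> v 0 = 0 \<and> v 1 = g then
       \<Sum>i<n. J (\<tau> (int i) \<omega>)
                ((v (real (i + 1) * lam n) - v (real i * lam n)) / sqrt (lam n)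
                   + minimizer (J (\<tau> (int i) \<omega>)))
             - J (\<tau> (int i) \<omega>) (minimizer (J (\<tau> (int i) \<omega>)))
     else \<infinity>)"

section \<open>One-dimensional function spaces\<close>

definition test_functions :: "real set \<Rightarrow> (real \<Rightarrow> real) set" where
  "test_functions U =
    {\<phi>. \<phi> C1_differentiable_on UNIV \<and>
        (\<exists>K. compact K \<and> K \<subseteq> U \<and> (\<forall>x. x \<notin> K \<longrightarrow> \<phi> x = 0))}"

definition L2_on :: "real set \<Rightarrow> (real \<Rightarrow> real) set" where
  "L2_on U = {f. set_borel_measurable lborel U f \<and> set_integrable lborel U (\<lambda>x. (f x)\<^sup>2)}"

subsection \<open>Special functions of bounded variation\<close>

definition ess_right_lim :: "(real \<Rightarrow> real) \<Rightarrow> real \<Rightarrow> real" where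
  "ess_right_lim v x = Lim (inf (at_right x) (ae_filter lborel)) v"

definition ess_left_lim :: "(real \<Rightarrow> real) \<Rightarrow> real \<Rightarrow> real" where
  "ess_left_lim v x = Lim (inf (at_left x) (ae_filter lborel)) v"

definition jump :: "(real \<Rightarrow> real) \<Rightarrow> real \<Rightarrow> real" where
  "jump v x = ess_right_lim v x - ess_left_lim v x"

definition jump_set :: "(real \<Rightarrow> real) \<Rightarrow> real set" where
  "jump_set v = {x\<in>{0..1}. jump v x \<noteq> 0}"

text \<open>The distributional derivative of \<open>v\<close> on \<open>(0,1)\<close> is the finite measure
  \<open>g dx + (\<Sum>x. [v](x) \<delta>\<^sub>x)\<close>, that is, it has no Cantor part, and \<open>g\<close> is the density of its
  absolutely continuous part. (The left hand side being a finite measure, \<open>v\<close> is of bounded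
  variation, and so all the one-sided essential limits in \<^term>\<open>jump v\<close> exist.)\<close>

definition has_SBV_density :: "(real \<Rightarrow> real) \<Rightarrow> (real \<Rightarrow> real) \<Rightarrow> bool" where
  "has_SBV_density v g \<longleftrightarrow>
     set_integrable lborel {0<..<1} v \<and>
     set_integrable lborel {0<..<1} g \<and>
     (\<lambda>x. \<bar>jump v x\<bar>) summable_on {0<..<1} \<and>
     (\<forall>\<phi>\<in>test_functions {0<..<1}.
        (LINT x:{0<..<1}|lborel. v x * deriv \<phi> x) =
        - ((LINT x:{0<..<1}|lborel. g x * \<phi> x) + (\<Sum>\<^sub>\<infinity>x\<in>{0<..<1}. jump v x * \<phi> x)))"

definition ac_density :: "(real \<Rightarrow> real) \<Rightarrow> real \<Rightarrow> real" where
  "ac_density v = (SOME g. has_SBV_density v g)"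

text \<open>Elements of \<open>SBV\<^sup>\<gamma>(0,1)\<close> are functions on the whole line which are prolonged by \<open>0\<close> to the
  left of \<open>0\<close> and by \<open>\<gamma>\<close> to the right of \<open>1\<close>: this is the constraint
  \<open>v(0-) = 0\<close>, \<open>v(1+) = \<gamma>\<close>, and it makes \<^const>\<open>jump\<close> count the jumps at \<open>0\<close> and \<open>1\<close>.\<close>

definition SBV :: "real \<Rightarrow> (real \<Rightarrow> real) set" where
  "SBV \<gamma> = {v. (\<exists>g. has_SBV_density v g) \<and> (\<forall>x<0. v x = 0) \<and> (\<forall>x>1. v x = \<gamma>)}"

subsection \<open>Local weak convergence in \<open>H\<^sup>1\<close>\<close>

definition has_weak_deriv_L2 :: "real set \<Rightarrow> (real \<Rightarrow> real) \<Rightarrow> (real \<Rightarrow> real) \<Rightarrow> bool" where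
  "has_weak_deriv_L2 U f g \<longleftrightarrow>
     g \<in> L2_on U \<and>
     (\<forall>\<phi>\<in>test_functions U.
        (LINT x:U|lborel. f x * deriv \<phi> x) = - (LINT x:U|lborel. g x * \<phi> x))"

definition H1 :: "real set \<Rightarrow> (real \<Rightarrow> real) set" where
  "H1 U = {f \<in> L2_on U. \<exists>g. has_weak_deriv_L2 U f g}"

definition weak_deriv :: "real set \<Rightarrow> (real \<Rightarrow> real) \<Rightarrow> real \<Rightarrow> real" where
  "weak_deriv U f = (SOME g. has_weak_deriv_L2 U f g)"

definition H1_inner :: "real set \<Rightarrow> (real \<Rightarrow> real) \<Rightarrow> (real \<Rightarrow> real) \<Rightarrow> real" where
  "H1_inner U f g =
     (LINT x:U|lborel. f x * g x) + (LINT x:U|lborel. weak_deriv U f x * weak_deriv U g x)"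

text \<open>Weak convergence in the Hilbert space \<open>H\<^sup>1(U)\<close>.\<close>

definition weakly_converges_H1 ::
  "real set \<Rightarrow> (nat \<Rightarrow> real \<Rightarrow> real) \<Rightarrow> (real \<Rightarrow> real) \<Rightarrow> bool" where
  "weakly_converges_H1 U f l \<longleftrightarrow>
     (\<forall>k. f k \<in> H1 U) \<and> l \<in> H1 U \<and>
     (\<forall>g\<in>H1 U. (\<lambda>k. H1_inner U (f k) g) \<longlonglongrightarrow> H1_inner U l g)"

definition locally_weakly_converges_H1 ::
  "real set \<Rightarrow> (nat \<Rightarrow> real \<Rightarrow> real) \<Rightarrow> (real \<Rightarrow> real) \<Rightarrow> bool" where
  "locally_weakly_converges_H1 G f l \<longleftrightarrow>
     (\<forall>U. open U \<and> compact (closure U) \<and> closure U \<subseteq> G \<longrightarrow> weakly_converges_H1 U f l)"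

definition converges_L1 :: "real set \<Rightarrow> (nat \<Rightarrow> real \<Rightarrow> real) \<Rightarrow> (real \<Rightarrow> real) \<Rightarrow> bool" where
  "converges_L1 U f l \<longleftrightarrow>
     (\<forall>k. set_integrable lborel U (f k)) \<and> set_integrable lborel U l \<and>
     (\<lambda>k. LINT x:U|lborel. \<bar>f k x - l x\<bar>) \<longlonglongrightarrow> 0"

end

theory Submission
  imports Defs "HOL-Complex_Analysis.Great_Picard"
begin

text \<open>An energy bound controls the bonds in three ways: bonds of deviation less than \<open>\<eta>\<close> have
  bounded square sum, compressed bonds have bounded sum (the potential grows linearly there, by
  convexity), and the number of long bonds is bounded. Hence \<open>v\<^sub>n\<close> is the sum of a part that is
  bounded in \<open>H\<^sup>1\<close> and of a bounded number of steep ramps of bounded height. Along a subsequence the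
  first part converges weakly in \<open>H\<^sup>1\<close>, and the ramps become jumps, which are nonnegative because the
  total compression is of order \<open>\<surd>\<lambda>\<^sub>n\<close>; away from the finitely many limit positions of the ramps
  the convergence is weak in \<open>H\<^sup>1\<close>.\<close>

section \<open>Weak compactness in \<open>L\<^sup>2\<close>\<close>

text \<open>The obstacle is the number of long bonds. Right of the minimizer a potential of the
  class is only known to have no second minimizer, so the cost of a long bond has no common positive
  lower bound, and the energy bound at a single \<omega> need not limit their number. The chains
  \<open>v n\<close>, however, are the same for all \<omega>. Some fixed depth \<open>e\<close> is
  available on an event of positive probability; by stationarity every bond meets this event with
  the same probability, so averaging over \<omega> turns the bounds at individual \<omega> into one
  deterministic bound on the count. The scale \<open>1 / sqrt (lam n)\<close> is the one at which
  the squares of small deviations add up to the squared L2 norm of the slope. Slopes of the regular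
  part have uniformly Hoelder continuous primitives; the limit of these primitives determines the
  weak limit of the slopes, so weak convergence follows without a further extraction.\<close>

definition square_integrable :: "'a measure \<Rightarrow> ('a \<Rightarrow> real) \<Rightarrow> bool" where
  "square_integrable M f \<longleftrightarrow> f \<in> borel_measurable M \<and> integrable M (\<lambda>x. (f x)\<^sup>2)"

lemma square_integrable_measurable [measurable_dest]:
  "square_integrable M f \<Longrightarrow> f \<in> borel_measurable M"
  by (simp add: square_integrable_def)

lemma square_integrable_sq: "square_integrable M f \<Longrightarrow> integrable M (\<lambda>x. (f x)\<^sup>2)"
  by (simp add: square_integrable_def)

lemma square_integrable_mult:
  assumes f: "square_integrable M f" and g: "square_integrable M g"
  shows "integrable M (\<lambda>x. f x * g x)"
proof (rule Bochner_Integration.integrable_bound)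
  show "integrable M (\<lambda>x. (f x)\<^sup>2 + (g x)\<^sup>2)"
    using f g by (intro Bochner_Integration.integrable_add square_integrable_sq)
  show "(\<lambda>x. f x * g x) \<in> borel_measurable M"
    using f g by (intro borel_measurable_times square_integrable_measurable)
  have "\<bar>a * b\<bar> \<le> a\<^sup>2 + b\<^sup>2" for a b :: real
  proof -
    have "2 * \<bar>a * b\<bar> \<le> a\<^sup>2 + b\<^sup>2"
      using sum_squares_bound[of "\<bar>a\<bar>" "\<bar>b\<bar>"] by (simp add: abs_mult)
    then show ?thesis by linarith
  qed
  then show "AE x in M. norm (f x * g x) \<le> norm ((f x)\<^sup>2 + (g x)\<^sup>2)"
    by simp
qed

lemma square_integrable_add:
  assumes f: "square_integrable M f" and g: "square_integrable M g"
  shows "square_integrable M (\<lambda>x. f x + g x)"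
proof -
  have "integrable M (\<lambda>x. (f x)\<^sup>2 + (g x)\<^sup>2 + 2 * (f x * g x))"
    using f g by (intro Bochner_Integration.integrable_add square_integrable_sq
        integrable_mult_right square_integrable_mult)
  then have "integrable M (\<lambda>x. (f x + g x)\<^sup>2)"
    by (simp add: power2_sum mult.assoc)
  moreover have "(\<lambda>x. f x + g x) \<in> borel_measurable M"
    using f g by (intro borel_measurable_add square_integrable_measurable)
  ultimately show ?thesis
    by (simp add: square_integrable_def)
qed

lemma square_integrable_scale:
  "square_integrable M f \<Longrightarrow> square_integrable M (\<lambda>x. t * f x)"
  by (auto simp: square_integrable_def power_mult_distrib)

lemma square_integrable_diff:
  assumes "square_integrable M f" "square_integrable M g"
  shows "square_integrable M (\<lambda>x. f x - g x)"
  using square_integrable_add[OF assms(1) square_integrable_scale[OF assms(2), where t="-1"]] by simp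

lemma square_integrable_bounded_mult:
  assumes f: "square_integrable M f" and [measurable]: "g \<in> borel_measurable M"
    and "\<And>x. \<bar>g x\<bar> \<le> 1"
  shows "square_integrable M (\<lambda>x. g x * f x)"
  unfolding square_integrable_def
proof
  show "(\<lambda>x. g x * f x) \<in> borel_measurable M"
    using square_integrable_measurable[OF f] by simp
  show "integrable M (\<lambda>x. (g x * f x)\<^sup>2)"
  proof (rule Bochner_Integration.integrable_bound[OF square_integrable_sq[OF f]])
    show "(\<lambda>x. (g x * f x)\<^sup>2) \<in> borel_measurable M"
      using square_integrable_measurable[OF f] by simp
    have "(g x)\<^sup>2 \<le> 1" for x
      using assms(3)[of x] by (simp add: abs_square_le_1)
    then have "(g x * f x)\<^sup>2 \<le> (f x)\<^sup>2" for x
      by (metis mult_left_le mult.commute power_mult_distrib zero_le_power2)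
    then show "AE x in M. norm ((g x * f x)\<^sup>2) \<le> norm ((f x)\<^sup>2)"
      by simp
  qed
qed

lemma square_integral_diff_scale:
  assumes f: "square_integrable M f" and g: "square_integrable M g"
  shows "(\<integral>x. (f x - t * g x)\<^sup>2 \<partial>M) =
    (\<integral>x. (f x)\<^sup>2 \<partial>M) - 2 * t * (\<integral>x. f x * g x \<partial>M) + t\<^sup>2 * (\<integral>x. (g x)\<^sup>2 \<partial>M)"
proof -
  have "(\<integral>x. (f x - t * g x)\<^sup>2 \<partial>M) =
      (\<integral>x. (f x)\<^sup>2 - 2 * t * (f x * g x) + t\<^sup>2 * (g x)\<^sup>2 \<partial>M)"
    by (simp add: power2_diff power_mult_distrib algebra_simps)
  also have "\<dots> = (\<integral>x. (f x)\<^sup>2 \<partial>M) - 2 * t * (\<integral>x. f x * g x \<partial>M) + t\<^sup>2 * (\<integral>x. (g x)\<^sup>2 \<partial>M)"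
    using f g by (simp add: square_integrable_sq square_integrable_mult)
  finally show ?thesis .
qed

text \<open>The integral of the square of \<open>f - t * g\<close> is a nonnegative polynomial in
  \<open>t\<close> of degree at most two. Its value at the minimum point \<open>B / C\<close> gives
  the claim; for \<open>C = 0\<close> it is affine, hence constant.\<close>

lemma integral_Cauchy_Schwarz:
  assumes f: "square_integrable M f" and g: "square_integrable M g"
  shows "(\<integral>x. f x * g x \<partial>M)\<^sup>2 \<le> (\<integral>x. (f x)\<^sup>2 \<partial>M) * (\<integral>x. (g x)\<^sup>2 \<partial>M)"
proof -
  define A where "A = (\<integral>x. (f x)\<^sup>2 \<partial>M)"
  define B where "B = (\<integral>x. f x * g x \<partial>M)"
  define C where "C = (\<integral>x. (g x)\<^sup>2 \<partial>M)"
  have pos: "0 \<le> A - 2 * t * B + t\<^sup>2 * C" for t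
    unfolding A_def B_def C_def square_integral_diff_scale[OF f g, symmetric] by simp
  have C: "0 \<le> C" by (simp add: C_def)
  show ?thesis unfolding A_def[symmetric] B_def[symmetric] C_def[symmetric]
  proof (cases "C = 0")
    case True
    have "B = 0"
    proof (rule ccontr)
      assume "B \<noteq> 0"
      \<comment> \<open>At this \<open>t\<close> the affine polynomial has the value -1.\<close>
      with pos[of "(A + 1) / (2 * B)"] True show False by simp
    qed
    with True show "B\<^sup>2 \<le> A * C" by simp
  next
    case False
    with C have "0 < C" by simp
    have "A - 2 * (B / C) * B + (B / C)\<^sup>2 * C = A - B\<^sup>2 / C"
      using \<open>0 < C\<close> by (simp add: field_simps power2_eq_square)
    with pos[of "B / C"] have "B\<^sup>2 / C \<le> A" by simp
    with \<open>0 < C\<close> show "B\<^sup>2 \<le> A * C" by (simp add: field_simps)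
  qed
qed

lemma integral_mult_tendsto_0:
  assumes f: "\<And>k. square_integrable M (f k)" and g: "square_integrable M g"
    and lim: "(\<lambda>k. \<integral>x. (f k x)\<^sup>2 \<partial>M) \<longlonglongrightarrow> 0"
  shows "(\<lambda>k. \<integral>x. f k x * g x \<partial>M) \<longlonglongrightarrow> 0"
proof -
  have "(\<lambda>k. (\<integral>x. f k x * g x \<partial>M)\<^sup>2) \<longlonglongrightarrow> 0"
  proof (rule tendsto_sandwich[OF _ _ tendsto_const])
    show "(\<lambda>k. (\<integral>x. (f k x)\<^sup>2 \<partial>M) * (\<integral>x. (g x)\<^sup>2 \<partial>M)) \<longlonglongrightarrow> 0"
      using tendsto_mult_left_zero[OF lim] by simp
  qed (use integral_Cauchy_Schwarz[OF f g] in auto)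
  then show ?thesis by simp
qed

lemma le_suminf: "c k \<le> (\<Sum>k. c k)" for c :: "nat \<Rightarrow> ennreal"
  using sum_le_suminf[of c "{k}"] by simp

text \<open>Riesz-Fischer for a fast Cauchy sequence. The weights \<open>2^k\<close> still leave a
  finite integral, so almost everywhere the increments are bounded by a multiple of
  \<open>sqrt (1/2) ^ k\<close> and the sequence converges pointwise; Fatou's lemma carries the rate
  over to the limit.\<close>

lemma L2_complete:
  fixes f :: "nat \<Rightarrow> 'a \<Rightarrow> real"
  assumes f: "\<And>k. square_integrable M (f k)"
    and cauchy: "\<And>j k. k \<le> j \<Longrightarrow> (\<integral>x. (f j x - f k x)\<^sup>2 \<partial>M) \<le> (1/4)^k"
  obtains g where "square_integrable M g" "\<And>k. (\<integral>x. (g x - f k x)\<^sup>2 \<partial>M) \<le> (1/4)^k"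
proof -
  have fm[measurable]: "\<And>k. f k \<in> borel_measurable M"
    using f by (rule square_integrable_measurable)
  have nn: "(\<integral>\<^sup>+x. ennreal ((f j x - f k x)\<^sup>2) \<partial>M) \<le> ennreal ((1/4)^k)" if "k \<le> j" for j k
    using cauchy[OF that] square_integrable_sq[OF square_integrable_diff[OF f[of j] f[of k]]]
    by (subst nn_integral_eq_integral) (auto intro: ennreal_leI)
  have "(\<integral>\<^sup>+x. (\<Sum>k. ennreal (2^k * (f (Suc k) x - f k x)\<^sup>2)) \<partial>M) =
      (\<Sum>k. \<integral>\<^sup>+x. ennreal (2^k * (f (Suc k) x - f k x)\<^sup>2) \<partial>M)"
    by (intro nn_integral_suminf) measurable
  also have "\<dots> \<le> (\<Sum>k. ennreal ((1/2)^k))"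
  proof (rule suminf_le)
    fix k
    have "(\<integral>\<^sup>+x. ennreal (2^k * (f (Suc k) x - f k x)\<^sup>2) \<partial>M) =
        ennreal (2^k) * (\<integral>\<^sup>+x. ennreal ((f (Suc k) x - f k x)\<^sup>2) \<partial>M)"
      by (subst nn_integral_cmult[symmetric]) (auto simp: ennreal_mult)
    also have "\<dots> \<le> ennreal (2^k) * ennreal ((1/4)^k)"
      using nn[of k "Suc k"] by (intro mult_left_mono) auto
    also have "\<dots> = ennreal ((1/2)^k)"
      by (simp add: ennreal_mult[symmetric] power_mult_distrib[symmetric])
    finally show "(\<integral>\<^sup>+x. ennreal (2^k * (f (Suc k) x - f k x)\<^sup>2) \<partial>M) \<le> ennreal ((1/2)^k)" .
  qed auto
  also have "\<dots> < \<infinity>"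
    by (subst suminf_ennreal2) (auto intro!: summable_geometric)
  finally have "AE x in M. (\<Sum>k. ennreal (2^k * (f (Suc k) x - f k x)\<^sup>2)) \<noteq> \<infinity>"
    by (intro nn_integral_noteq_infinite) auto
  then have conv: "AE x in M. convergent (\<lambda>k. f k x)"
  proof eventually_elim
    case (elim x)
    define S where "S = enn2real (\<Sum>k. ennreal (2^k * (f (Suc k) x - f k x)\<^sup>2))"
    have S: "ennreal S = (\<Sum>k. ennreal (2^k * (f (Suc k) x - f k x)\<^sup>2))"
      using elim unfolding S_def by (simp add: top.not_eq_extremum)
    have "0 \<le> S" by (simp add: S_def)
    have bound: "\<bar>f (Suc k) x - f k x\<bar> \<le> sqrt S * (sqrt (1/2))^k" for k
    proof -
      have "ennreal (2^k * (f (Suc k) x - f k x)\<^sup>2) \<le> ennreal S"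
        unfolding S by (rule le_suminf)
      then have "2^k * (f (Suc k) x - f k x)\<^sup>2 \<le> S"
        using \<open>0 \<le> S\<close> ennreal_le_iff by blast
      then have "(f (Suc k) x - f k x)\<^sup>2 \<le> S * (1/2)^k"
        by (simp add: field_simps)
      then have "sqrt ((f (Suc k) x - f k x)\<^sup>2) \<le> sqrt (S * (1/2)^k)"
        by (rule real_sqrt_le_mono)
      then show ?thesis
        unfolding real_sqrt_abs by (simp add: real_sqrt_mult real_sqrt_power)
    qed
    have "summable (\<lambda>k. f (Suc k) x - f k x)"
    proof (rule summable_comparison_test')
      show "summable (\<lambda>k. sqrt S * (sqrt (1/2))^k)"
        by (intro summable_mult summable_geometric) (simp add: real_sqrt_divide)
      show "norm (f (Suc k) x - f k x) \<le> sqrt S * (sqrt (1/2))^k" for k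
        using bound by simp
    qed
    then have "convergent (\<lambda>n. \<Sum>k<n. f (Suc k) x - f k x)"
      by (simp add: summable_iff_convergent)
    from convergent_add[OF this convergent_const[of "f 0 x"]] show ?case
      by (simp only: sum_lessThan_telescope[of "\<lambda>k. f k x"] diff_add_cancel)
  qed
  define g where "g x = lim (\<lambda>k. f k x)" for x
  have g[measurable]: "g \<in> borel_measurable M"
    unfolding g_def by measurable
  have lim: "AE x in M. (\<lambda>k. f k x) \<longlonglongrightarrow> g x"
    using conv unfolding g_def by eventually_elim (simp add: convergent_LIMSEQ_iff)
  have gk: "(\<integral>\<^sup>+x. ennreal ((g x - f k x)\<^sup>2) \<partial>M) \<le> ennreal ((1/4)^k)" for k
  proof -
    have "(\<integral>\<^sup>+x. ennreal ((g x - f k x)\<^sup>2) \<partial>M) = (\<integral>\<^sup>+x. liminf (\<lambda>j. ennreal ((f j x - f k x)\<^sup>2)) \<partial>M)"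
    proof (rule nn_integral_cong_AE)
      show "AE x in M. ennreal ((g x - f k x)\<^sup>2) = liminf (\<lambda>j. ennreal ((f j x - f k x)\<^sup>2))"
        using lim
      proof eventually_elim
        case (elim x)
        have "(\<lambda>j. ennreal ((f j x - f k x)\<^sup>2)) \<longlonglongrightarrow> ennreal ((g x - f k x)\<^sup>2)"
          by (intro tendsto_intros elim tendsto_ennrealI)
        from lim_imp_Liminf[OF _ this] show ?case by simp
      qed
    qed
    also have "\<dots> \<le> liminf (\<lambda>j. \<integral>\<^sup>+x. ennreal ((f j x - f k x)\<^sup>2) \<partial>M)"
      by (rule nn_integral_liminf) measurable
    also have "\<dots> \<le> limsup (\<lambda>j. \<integral>\<^sup>+x. ennreal ((f j x - f k x)\<^sup>2) \<partial>M)"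
      by (rule Liminf_le_Limsup) simp
    also have "\<dots> \<le> ennreal ((1/4)^k)"
      by (rule Limsup_bounded) (use nn in \<open>auto simp: eventually_sequentially\<close>)
    finally show ?thesis .
  qed
  have sq: "square_integrable M (\<lambda>x. g x - f k x)" for k
    unfolding square_integrable_def
  proof
    show "integrable M (\<lambda>x. (g x - f k x)\<^sup>2)"
      using gk[of k] by (intro integrableI_bounded) (auto simp: ennreal_power intro: le_less_trans)
  qed measurable
  show ?thesis
  proof
    show "square_integrable M g"
      using square_integrable_add[OF sq f, of 0 0] by simp
    show "(\<integral>x. (g x - f k x)\<^sup>2 \<partial>M) \<le> (1/4)^k" for k
      using gk[of k] nn_integral_eq_integral[OF square_integrable_sq[OF sq[of k]]] by simp
  qed
qed

text \<open>Dyadic convex combinations of the tail from \<open>n\<close> on stand in for its convex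
  hull: closure under midpoints is all that the parallelogram law uses, and it gives a plain
  induction rule.\<close>

inductive_set midpoint_hull :: "(nat \<Rightarrow> 'a \<Rightarrow> real) \<Rightarrow> nat \<Rightarrow> ('a \<Rightarrow> real) set"
  for f :: "nat \<Rightarrow> 'a \<Rightarrow> real" and n :: nat where
  base: "n \<le> m \<Longrightarrow> f m \<in> midpoint_hull f n"
| mid: "g \<in> midpoint_hull f n \<Longrightarrow> h \<in> midpoint_hull f n \<Longrightarrow>
    (\<lambda>x. (g x + h x) / 2) \<in> midpoint_hull f n"

lemma midpoint_hull_antimono:
  assumes "m \<le> n" shows "midpoint_hull f n \<subseteq> midpoint_hull f m"
proof
  fix g assume "g \<in> midpoint_hull f n"
  then show "g \<in> midpoint_hull f m"
    by induction (use assms in \<open>auto intro: midpoint_hull.intros\<close>)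
qed

lemma midpoint_hull_square_integrable:
  assumes "\<And>n. square_integrable M (f n)" and "g \<in> midpoint_hull f n"
  shows "square_integrable M g"
  using assms(2)
proof induction
  case (mid g h)
  then show ?case
    using square_integrable_scale[OF square_integrable_add[OF mid.IH], of "1/2"] by simp
qed (use assms(1) in auto)

text \<open>Pairing with \<open>\<phi>\<close> is linear and an interval around \<open>L\<close> is
  convex, so midpoints inherit the estimate from the tail.\<close>

lemma midpoint_hull_integral_mult:
  assumes f: "\<And>n. square_integrable M (f n)" and \<phi>: "square_integrable M \<phi>"
    and close: "\<And>m. n \<le> m \<Longrightarrow> \<bar>(\<integral>x. f m x * \<phi> x \<partial>M) - L\<bar> \<le> e"
    and g: "g \<in> midpoint_hull f n"
  shows "\<bar>(\<integral>x. g x * \<phi> x \<partial>M) - L\<bar> \<le> e"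
  using g
proof induction
  case (mid g h)
  note si = midpoint_hull_square_integrable[OF f mid.hyps(1)] midpoint_hull_square_integrable[OF f mid.hyps(2)]
  have "(\<integral>x. (g x + h x) / 2 * \<phi> x \<partial>M) = (\<integral>x. (g x * \<phi> x) / 2 + (h x * \<phi> x) / 2 \<partial>M)"
    by (intro Bochner_Integration.integral_cong) (auto simp: field_simps)
  also have "\<dots> = (\<integral>x. g x * \<phi> x \<partial>M) / 2 + (\<integral>x. h x * \<phi> x \<partial>M) / 2"
    using square_integrable_mult[OF si(1) \<phi>] square_integrable_mult[OF si(2) \<phi>] by simp
  finally show ?case using mid.IH by (auto simp: abs_le_iff field_simps)
qed (use close in auto)

lemma square_integral_parallelogram:
  assumes g: "square_integrable M g" and h: "square_integrable M h"
  shows "(\<integral>x. (g x - h x)\<^sup>2 \<partial>M) =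
    2 * (\<integral>x. (g x)\<^sup>2 \<partial>M) + 2 * (\<integral>x. (h x)\<^sup>2 \<partial>M) - 4 * (\<integral>x. ((g x + h x) / 2)\<^sup>2 \<partial>M)"
proof -
  have "(\<integral>x. ((g x + h x) / 2)\<^sup>2 \<partial>M) = (\<integral>x. (g x - (-1) * h x)\<^sup>2 \<partial>M) / 4"
    by (simp add: power_divide)
  then show ?thesis
    using square_integral_diff_scale[OF g h, of "-1"] square_integral_diff_scale[OF g h, of 1]
    by simp
qed

text \<open>A weak limit is found as a strong limit of iterated midpoints of minimal norm: by the
  parallelogram law nearly minimal elements of the hulls of the tails form a Cauchy sequence.\<close>

lemma L2_weakly_compact:
  fixes f :: "nat \<Rightarrow> 'a \<Rightarrow> real"
  assumes f: "\<And>n. square_integrable M (f n)" and K: "\<And>n. (\<integral>x. (f n x)\<^sup>2 \<partial>M) \<le> K"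
  obtains g where "square_integrable M g"
    "\<And>\<phi> L. square_integrable M \<phi> \<Longrightarrow> (\<lambda>n. \<integral>x. f n x * \<phi> x \<partial>M) \<longlonglongrightarrow> L \<Longrightarrow>
      (\<integral>x. g x * \<phi> x \<partial>M) = L"
proof -
  define N where "N h = (\<integral>x. (h x)\<^sup>2 \<partial>M)" for h :: "'a \<Rightarrow> real"
  define d where "d n = Inf (N ` midpoint_hull f n)" for n
  \<comment> \<open>The divisor 8 is 2 + 2 + 4, the total weight of the errors in the parallelogram
    law.\<close>
  define e where "e k = (1/4::real)^k / 8" for k :: nat
  have e_pos: "0 < e k" for k by (simp add: e_def)
  have e_anti: "e j \<le> e k" if "k \<le> j" for j k
    using that by (simp add: e_def power_decreasing)
  have N0: "0 \<le> N h" for h by (simp add: N_def)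
  have bdd: "bdd_below (N ` H)" for H using N0 by (intro bdd_belowI[of _ 0]) auto
  have ne: "N ` midpoint_hull f n \<noteq> {}" for n by (auto intro: midpoint_hull.base)
  have d_le: "d n \<le> N h" if "h \<in> midpoint_hull f n" for n h
    unfolding d_def using that bdd by (intro cInf_lower) auto
  have d_K: "d n \<le> K" for n
    using d_le[OF midpoint_hull.base[of n n f]] K[of n] by (simp add: N_def)
  have d_mono: "d m \<le> d n" if "m \<le> n" for m n
    unfolding d_def using midpoint_hull_antimono[OF that] ne bdd
    by (intro cInf_superset_mono image_mono) auto
  have bdd_d: "bdd_above (range d)" using d_K by (intro bdd_aboveI) auto
  define D where "D = Sup (range d)"
  have d_D: "d n \<le> D" for n unfolding D_def using bdd_d by (intro cSup_upper) auto
  have "\<exists>n. D - e k < d n" for k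
    using less_cSup_iff[of "range d" "D - e k"] bdd_d e_pos[of k] by (auto simp: D_def)
  then obtain n where n: "\<And>k. D - e k < d (n k)" by metis
  \<comment> \<open>The sum makes \<open>m\<close> monotone and at least \<open>n\<close>; the
    summand \<open>k\<close> pushes the tails out to infinity, so that \<open>h k\<close> ends up in
    the hull of every tail.\<close>
  define m where "m k = k + (\<Sum>i\<le>k. n i)" for k
  have m_ge: "n k \<le> m k" "k \<le> m k" for k
    using member_le_sum[of k "{..k}" n] by (auto simp: m_def)
  have m_mono: "m k \<le> m j" if "k \<le> j" for k j
    unfolding m_def using that by (intro add_mono sum_mono2) auto
  have m: "D - e k < d (m k)" for k using n[of k] d_mono[OF m_ge(1)] by (meson less_le_trans)
  have "\<exists>h\<in>midpoint_hull f (m k). N h < D + e k" for k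
  proof -
    have "Inf (N ` midpoint_hull f (m k)) < D + e k"
      using d_D[of "m k"] e_pos[of k] unfolding d_def by linarith
    then show ?thesis using cInf_less_iff[OF ne bdd] by auto
  qed
  then obtain h where h: "\<And>k. h k \<in> midpoint_hull f (m k)" and Nh: "\<And>k. N (h k) < D + e k"
    by metis
  have h_si: "square_integrable M (h k)" for k
    using midpoint_hull_square_integrable[OF f h] .
  have cauchy: "(\<integral>x. (h j x - h k x)\<^sup>2 \<partial>M) \<le> (1/4)^k" if "k \<le> j" for j k
  proof -
    have "h j \<in> midpoint_hull f (m k)"
      using h[of j] midpoint_hull_antimono[OF m_mono[OF that]] by auto
    then have "d (m k) \<le> N (\<lambda>x. (h j x + h k x) / 2)"
      using h[of k] by (intro d_le midpoint_hull.mid)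
    then have "D - e k < N (\<lambda>x. (h j x + h k x) / 2)" using m[of k] by simp
    moreover have "(\<integral>x. (h j x - h k x)\<^sup>2 \<partial>M) = 2 * N (h j) + 2 * N (h k) - 4 * N (\<lambda>x. (h j x + h k x) / 2)"
      unfolding N_def by (rule square_integral_parallelogram[OF h_si h_si])
    ultimately have "(\<integral>x. (h j x - h k x)\<^sup>2 \<partial>M) \<le> 8 * e k"
      using Nh[of j] Nh[of k] e_anti[OF that] by linarith
    then show ?thesis by (simp add: e_def)
  qed
  obtain g where g: "square_integrable M g" and gh: "\<And>k. (\<integral>x. (g x - h k x)\<^sup>2 \<partial>M) \<le> (1/4)^k"
    using L2_complete[OF h_si cauchy] by blast
  show ?thesis
  proof
    fix \<phi> L assume \<phi>: "square_integrable M \<phi>" and L: "(\<lambda>n. \<integral>x. f n x * \<phi> x \<partial>M) \<longlonglongrightarrow> L"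
    have "(\<lambda>k. \<integral>x. (g x - h k x)\<^sup>2 \<partial>M) \<longlonglongrightarrow> 0"
      by (rule tendsto_sandwich[OF _ _ tendsto_const LIMSEQ_power_zero[of "1/4::real"]])
        (use gh in auto)
    then have "(\<lambda>k. \<integral>x. (g x - h k x) * \<phi> x \<partial>M) \<longlonglongrightarrow> 0"
      by (intro integral_mult_tendsto_0 square_integrable_diff g h_si \<phi>)
    moreover have "(\<integral>x. (g x - h k x) * \<phi> x \<partial>M) = (\<integral>x. g x * \<phi> x \<partial>M) - (\<integral>x. h k x * \<phi> x \<partial>M)" for k
      using square_integrable_mult[OF g \<phi>] square_integrable_mult[OF h_si \<phi>]
      by (simp add: left_diff_distrib)
    ultimately have "(\<lambda>k. (\<integral>x. g x * \<phi> x \<partial>M) - (\<integral>x. h k x * \<phi> x \<partial>M)) \<longlonglongrightarrow> 0" by simp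
    \<comment> \<open>Only pairings that converge already are considered, so \<open>g\<close> is
      found without extracting a subsequence of \<open>f\<close>.\<close>
    moreover have hL: "(\<lambda>k. \<integral>x. h k x * \<phi> x \<partial>M) \<longlonglongrightarrow> L"
    proof (rule LIMSEQ_I)
      fix r :: real assume "0 < r"
      then obtain n0 where n0: "\<And>n. n0 \<le> n \<Longrightarrow> \<bar>(\<integral>x. f n x * \<phi> x \<partial>M) - L\<bar> \<le> r / 2"
        using LIMSEQ_D[OF L, of "r/2"] by (auto intro: less_imp_le)
      have "\<bar>(\<integral>x. h k x * \<phi> x \<partial>M) - L\<bar> \<le> r / 2" if "n0 \<le> k" for k
      proof (rule midpoint_hull_integral_mult[OF f \<phi>, of n0])
        show "h k \<in> midpoint_hull f n0"
          using h[of k] midpoint_hull_antimono[of n0 "m k" f] m_ge(2)[of k] that by auto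
      qed (use n0 in auto)
      then show "\<exists>no. \<forall>n\<ge>no. norm ((\<integral>x. h n x * \<phi> x \<partial>M) - L) < r"
        using \<open>0 < r\<close> by (intro exI[of _ n0]) (fastforce intro: le_less_trans)
    qed
    ultimately have "(\<lambda>k. (\<integral>x. g x * \<phi> x \<partial>M)) \<longlonglongrightarrow> 0 + L"
      using tendsto_add by fastforce
    then show "(\<integral>x. g x * \<phi> x \<partial>M) = L"
      by (simp add: LIMSEQ_const_iff)
  qed (rule g)
qed

section \<open>Test functions and weak derivatives\<close>

lemma test_functionE:
  assumes "\<phi> \<in> test_functions U"
  obtains K where "compact K" "K \<subseteq> U" "\<And>x. x \<notin> K \<Longrightarrow> \<phi> x = 0" "\<And>x. x \<notin> K \<Longrightarrow> deriv \<phi> x = 0"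
proof -
  obtain K where K: "compact K" "K \<subseteq> U" "\<And>x. x \<notin> K \<Longrightarrow> \<phi> x = 0"
    using assms by (auto simp: test_functions_def)
  have "deriv \<phi> x = 0" if "x \<notin> K" for x
  proof (rule DERIV_imp_deriv)
    have "((\<lambda>_. 0) has_real_derivative 0) (at x)" by simp
    then show "(\<phi> has_real_derivative 0) (at x)"
    proof (rule has_field_derivative_transform_within_open)
      show "open (- K)" using K(1) by (simp add: compact_imp_closed open_Compl)
    qed (use that K in auto)
  qed
  with K show thesis by (rule that)
qed

lemma test_function_deriv:
  assumes "\<phi> \<in> test_functions U"
  shows "(\<phi> has_real_derivative deriv \<phi> x) (at x)"
  using assms
  by (auto simp: test_functions_def C1_differentiable_on_eq DERIV_deriv_iff_real_differentiable)

lemma test_function_continuous: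
  "\<phi> \<in> test_functions U \<Longrightarrow> continuous_on A \<phi>"
  by (meson DERIV_continuous continuous_at_imp_continuous_on test_function_deriv)

lemma test_function_deriv_continuous:
  assumes "\<phi> \<in> test_functions U"
  shows "continuous_on A (deriv \<phi>)"
proof -
  have "continuous_on UNIV (\<lambda>x. vector_derivative \<phi> (at x))"
    using assms by (auto simp: test_functions_def C1_differentiable_on_eq)
  moreover have "vector_derivative \<phi> (at x) = deriv \<phi> x" for x
    using test_function_deriv[OF assms]
    by (simp add: has_real_derivative_iff_has_vector_derivative vector_derivative_at)
  ultimately have "continuous_on UNIV (deriv \<phi>)" by simp
  then show ?thesis by (rule continuous_on_subset) simp
qed

lemma test_function_measurable [measurable_dest]:
  "\<phi> \<in> test_functions U \<Longrightarrow> \<phi> \<in> borel_measurable borel"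
  by (rule borel_measurable_continuous_onI[OF test_function_continuous])

lemma test_function_deriv_measurable:
  "\<phi> \<in> test_functions U \<Longrightarrow> deriv \<phi> \<in> borel_measurable borel"
  by (rule borel_measurable_continuous_onI[OF test_function_deriv_continuous])

lemma integrable_continuous_compact_support:
  fixes f :: "real \<Rightarrow> real"
  assumes "continuous_on UNIV f" "compact K" "\<And>x. x \<notin> K \<Longrightarrow> f x = 0"
  shows "integrable lborel f"
proof -
  have "integrable lborel (\<lambda>x. indicator K x *\<^sub>R f x)"
    using assms(1,2) by (intro borel_integrable_compact) (auto intro: continuous_on_subset)
  moreover have "(\<lambda>x. indicator K x *\<^sub>R f x) = f"
    using assms(3) by (auto simp: fun_eq_iff split: split_indicator)
  ultimately show ?thesis by simp
qed

lemma test_function_integrable: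
  assumes "\<phi> \<in> test_functions U"
  shows "integrable lborel \<phi>" "integrable lborel (deriv \<phi>)"
proof -
  obtain K where "compact K" "\<And>x. x \<notin> K \<Longrightarrow> \<phi> x = 0" "\<And>x. x \<notin> K \<Longrightarrow> deriv \<phi> x = 0"
    using test_functionE[OF assms] by metis
  then show "integrable lborel \<phi>" "integrable lborel (deriv \<phi>)"
    using test_function_continuous[OF assms] test_function_deriv_continuous[OF assms]
    by (blast intro: integrable_continuous_compact_support)+
qed

lemma test_function_bounded:
  assumes "\<phi> \<in> test_functions U"
  obtains B where "\<And>x. \<bar>\<phi> x\<bar> \<le> B"
proof -
  obtain K where K: "compact K" "\<And>x. x \<notin> K \<Longrightarrow> \<phi> x = 0"
    using test_functionE[OF assms] by metis
  have "bounded (\<phi> ` K)"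
    using K(1) test_function_continuous[OF assms]
    by (intro compact_imp_bounded compact_continuous_image)
  then obtain B where "\<And>x. x \<in> K \<Longrightarrow> \<bar>\<phi> x\<bar> \<le> B"
    by (auto simp: bounded_iff)
  then have "\<bar>\<phi> x\<bar> \<le> max B 0" for x
    using K(2) by (cases "x \<in> K") (simp_all add: le_max_iff_disj)
  then show thesis by (rule that)
qed

lemma test_function_set_integral:
  assumes "\<phi> \<in> test_functions U"
  shows "(LINT x:U|lborel. f x * \<phi> x) = (LINT x|lborel. f x * \<phi> x)"
    and "(LINT x:U|lborel. f x * deriv \<phi> x) = (LINT x|lborel. f x * deriv \<phi> x)"
proof -
  obtain K where "K \<subseteq> U" "\<And>x. x \<notin> K \<Longrightarrow> \<phi> x = 0" "\<And>x. x \<notin> K \<Longrightarrow> deriv \<phi> x = 0"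
    using test_functionE[OF assms] by metis
  then have "indicator U x *\<^sub>R (f x * \<phi> x) = f x * \<phi> x"
    "indicator U x *\<^sub>R (f x * deriv \<phi> x) = f x * deriv \<phi> x" for x
    by (cases "x \<in> U"; force)+
  then show "(LINT x:U|lborel. f x * \<phi> x) = (LINT x|lborel. f x * \<phi> x)"
    "(LINT x:U|lborel. f x * deriv \<phi> x) = (LINT x|lborel. f x * deriv \<phi> x)"
    unfolding set_lebesgue_integral_def by presburger+
qed

text \<open>The distributional derivative of a jump at \<open>p\<close> is the point mass there: the
  fundamental theorem of calculus on \<open>{p..b}\<close> with \<open>b\<close> beyond the support.
  The point \<open>p\<close> may lie outside of \<open>U\<close>.\<close>

lemma integral_deriv_test_function:
  assumes "\<phi> \<in> test_functions U"
  shows "(LINT x|lborel. indicator {p<..} x * deriv \<phi> x) = - \<phi> p"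
proof -
  obtain K where K: "compact K" "\<And>x. x \<notin> K \<Longrightarrow> \<phi> x = 0" "\<And>x. x \<notin> K \<Longrightarrow> deriv \<phi> x = 0"
    using test_functionE[OF assms] by metis
  obtain b0 where b0: "\<And>x. x \<in> K \<Longrightarrow> \<bar>x\<bar> \<le> b0"
    using compact_imp_bounded[OF K(1)] by (auto simp: bounded_iff)
  define b where "b = max b0 p + 1"
  have b: "p < b" "x \<in> K \<Longrightarrow> x < b" for x
    using b0[of x] by (auto simp: b_def)
  note [measurable] = test_function_deriv_measurable[OF assms]
  have "(LINT x|lborel. indicator {p<..} x * deriv \<phi> x) = (LINT x|lborel. indicator {p..b} x *\<^sub>R deriv \<phi> x)"
  proof (rule integral_cong_AE)
    show "AE x in lborel. indicator {p<..} x * deriv \<phi> x = indicator {p..b} x *\<^sub>R deriv \<phi> x"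
      using AE_lborel_singleton[of p]
    proof eventually_elim
      case (elim x)
      then show ?case using K(3)[of x] b(2)[of x] by (cases "x \<in> K") (auto simp: indicator_def)
    qed
  qed measurable
  also have "\<dots> = integral {p..b} (deriv \<phi>)"
  proof -
    have "set_integrable lborel {p..b} (deriv \<phi>)"
      unfolding set_integrable_def
      by (intro borel_integrable_compact test_function_deriv_continuous[OF assms]) auto
    from set_borel_integral_eq_integral(2)[OF this] show ?thesis
      by (simp add: set_lebesgue_integral_def)
  qed
  also have "\<dots> = \<phi> b - \<phi> p"
    by (intro integral_unique fundamental_theorem_of_calculus)
      (use b(1) test_function_deriv[OF assms] in
        \<open>auto simp: has_real_derivative_iff_has_vector_derivative[symmetric] intro: has_field_derivative_at_within\<close>)
  also have "\<phi> b = 0" using K(2) b(2) by blast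
  finally show ?thesis by simp
qed

text \<open>Fubini on the half plane \<open>t < x\<close>, with the product of
  \<open>\<bar>g t\<bar>\<close> and \<open>\<bar>deriv \<phi> x\<bar>\<close> as integrable bound;
  the inner integral over \<open>x\<close> is that of a jump at \<open>t\<close>.\<close>

lemma primitive_integration_by_parts:
  fixes g :: "real \<Rightarrow> real"
  assumes g: "integrable lborel g" and \<phi>: "\<phi> \<in> test_functions U"
  shows "(LINT x|lborel. (LINT t|lborel. indicator {..<x} t * g t) * deriv \<phi> x) =
    - (LINT t|lborel. g t * \<phi> t)"
proof -
  note [measurable] = borel_measurable_integrable[OF g] test_function_deriv_measurable[OF \<phi>]
  have dint: "integrable lborel (deriv \<phi>)" using test_function_integrable[OF \<phi>] by simp
  have meas: "(\<lambda>(x, t). indicator {..<x} t * g t * deriv \<phi> x) \<in> borel_measurable (lborel \<Otimes>\<^sub>M lborel)"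
  proof -
    have "(\<lambda>(x::real, t::real). indicator {..<x} t * g t * deriv \<phi> x) =
        (\<lambda>p. (if snd p < fst p then 1 else 0) * g (snd p) * deriv \<phi> (fst p))"
      by (auto simp: fun_eq_iff indicator_def)
    then show ?thesis by simp
  qed
  have int: "integrable (lborel \<Otimes>\<^sub>M lborel) (\<lambda>(x, t). indicator {..<x} t * g t * deriv \<phi> x)"
  proof (rule lborel_pair.Fubini_integrable[OF meas])
    have i2: "integrable lborel (\<lambda>t. indicator {..<x} t * g t * deriv \<phi> x)" for x
      using g by (intro integrable_mult_left integrable_real_mult_indicator
          | simp add: mult.commute[of "indicator _ _"])+
    then show "AE x in lborel. integrable lborel (\<lambda>t. case (x, t) of (x, t) \<Rightarrow> indicator {..<x} t * g t * deriv \<phi> x)"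
      by simp
    show "integrable lborel (\<lambda>x. LINT t|lborel. norm (case (x, t) of (x, t) \<Rightarrow> indicator {..<x} t * g t * deriv \<phi> x))"
    proof (rule Bochner_Integration.integrable_bound)
      show "integrable lborel (\<lambda>x. (LINT t|lborel. \<bar>g t\<bar>) * \<bar>deriv \<phi> x\<bar>)"
        using dint by simp
      show "(\<lambda>x. LINT t|lborel. norm (case (x, t) of (x, t) \<Rightarrow> indicator {..<x} t * g t * deriv \<phi> x))
          \<in> borel_measurable lborel"
        using meas by measurable
      have "(LINT t|lborel. \<bar>indicator {..<x} t * g t * deriv \<phi> x\<bar>) \<le> (LINT t|lborel. \<bar>g t\<bar> * \<bar>deriv \<phi> x\<bar>)" for x
        using integrable_norm[OF i2[of x]] g
        by (intro integral_mono) (auto simp: abs_mult split: split_indicator)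
      then show "AE x in lborel. norm (LINT t|lborel. norm (case (x, t) of (x, t) \<Rightarrow> indicator {..<x} t * g t * deriv \<phi> x))
          \<le> norm ((LINT t|lborel. \<bar>g t\<bar>) * \<bar>deriv \<phi> x\<bar>)"
        by (simp add: abs_mult)
    qed
  qed
  have "(LINT x|lborel. (LINT t|lborel. indicator {..<x} t * g t) * deriv \<phi> x) =
      (LINT x|lborel. (LINT t|lborel. indicator {..<x} t * g t * deriv \<phi> x))"
    by simp
  also have "\<dots> = (LINT t|lborel. (LINT x|lborel. indicator {..<x} t * g t * deriv \<phi> x))"
    using lborel_pair.Fubini_integral[OF int] by simp
  also have "\<dots> = (LINT t|lborel. g t * (LINT x|lborel. indicator {t<..} x * deriv \<phi> x))"
  proof (intro Bochner_Integration.integral_cong refl)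
    fix t
    have "(LINT x|lborel. indicator {..<x} t * g t * deriv \<phi> x) =
        (LINT x|lborel. g t * (indicator {t<..} x * deriv \<phi> x))"
      by (intro Bochner_Integration.integral_cong) (auto split: split_indicator)
    then show "(LINT x|lborel. indicator {..<x} t * g t * deriv \<phi> x) =
        g t * (LINT x|lborel. indicator {t<..} x * deriv \<phi> x)" by simp
  qed
  also have "\<dots> = - (LINT t|lborel. g t * \<phi> t)"
    by (simp add: integral_deriv_test_function[OF \<phi>])
  finally show ?thesis .
qed

section \<open>The fundamental lemma of the calculus of variations\<close>

lemma AE_zero_of_integral_greaterThan:
  fixes f :: "real \<Rightarrow> real"
  assumes f: "integrable lborel f" and zero: "\<And>x. (LINT t|lborel. indicator {x<..} t * f t) = 0"
  shows "AE x in lborel. f x = 0"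
proof -
  note [measurable] = borel_measurable_integrable[OF f]
  \<comment> \<open>The positive and the negative part of \<open>f\<close> are densities of two
    finite measures that agree on all half-lines; these generate the Borel sets, and densities are
    unique almost everywhere.\<close>
  define p q where "p = (\<lambda>x. ennreal (max 0 (f x)))" and "q = (\<lambda>x. ennreal (max 0 (- f x)))"
  have pm[measurable]: "p \<in> borel_measurable lborel" and qm[measurable]: "q \<in> borel_measurable lborel"
    by (simp_all add: p_def q_def)
  have int: "integrable lborel (\<lambda>t. indicator {x<..} t * max 0 (f t))"
    "integrable lborel (\<lambda>t. indicator {x<..} t * max 0 (- f t))" for x :: real
    by (rule Bochner_Integration.integrable_bound[OF f]; auto simp: indicator_def)+
  have P: "emeasure (density lborel p) {x<..} = ennreal (LINT t|lborel. indicator {x<..} t * max 0 (f t))" for x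
  proof -
    have "emeasure (density lborel p) {x<..} = (\<integral>\<^sup>+t. ennreal (indicator {x<..} t * max 0 (f t)) \<partial>lborel)"
      by (subst emeasure_density) (auto simp: p_def indicator_def intro!: nn_integral_cong)
    also have "\<dots> = ennreal (LINT t|lborel. indicator {x<..} t * max 0 (f t))"
      by (rule nn_integral_eq_integral[OF int(1)]) auto
    finally show ?thesis .
  qed
  have Q: "emeasure (density lborel q) {x<..} = ennreal (LINT t|lborel. indicator {x<..} t * max 0 (- f t))" for x
  proof -
    have "emeasure (density lborel q) {x<..} = (\<integral>\<^sup>+t. ennreal (indicator {x<..} t * max 0 (- f t)) \<partial>lborel)"
      by (subst emeasure_density) (auto simp: q_def indicator_def intro!: nn_integral_cong)
    also have "\<dots> = ennreal (LINT t|lborel. indicator {x<..} t * max 0 (- f t))"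
      by (rule nn_integral_eq_integral[OF int(2)]) auto
    finally show ?thesis .
  qed
  have "(LINT t|lborel. indicator {x<..} t * max 0 (f t)) - (LINT t|lborel. indicator {x<..} t * max 0 (- f t)) = 0" for x
  proof -
    have "(LINT t|lborel. indicator {x<..} t * max 0 (f t)) - (LINT t|lborel. indicator {x<..} t * max 0 (- f t))
      = (LINT t|lborel. indicator {x<..} t * max 0 (f t) - indicator {x<..} t * max 0 (- f t))"
      using int by (simp add: Bochner_Integration.integral_diff)
    also have "\<dots> = (LINT t|lborel. indicator {x<..} t * f t)"
      by (intro Bochner_Integration.integral_cong) (auto simp: indicator_def max_def)
    finally show ?thesis using zero by simp
  qed
  then have "density lborel p = density lborel q"
    by (intro measure_eqI_lessThan) (auto simp: P Q)
  then have "AE x in lborel. p x = q x"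
    by (intro sigma_finite_measure.density_unique[OF sigma_finite_lborel]) auto
  then show ?thesis
    by eventually_elim (auto simp: p_def q_def max_def split: if_splits)
qed

text \<open>\<open>U\<close> is the union of the countably many rational intervals whose closure it
  contains. On each of these, the half-line integrals of the truncated function are again integrals
  over intervals, hence zero.\<close>

lemma AE_zero_of_interval_integrals:
  fixes h :: "real \<Rightarrow> real"
  assumes U: "open U" and h: "set_integrable lborel U h"
    and zero: "\<And>a b. a < b \<Longrightarrow> {a..b} \<subseteq> U \<Longrightarrow> (LINT t|lborel. indicator {a<..<b} t * h t) = 0"
  shows "AE x in lborel. x \<in> U \<longrightarrow> h x = 0"
proof -
  have piece: "AE x in lborel. x \<in> {a<..<b} \<longrightarrow> h x = 0" if ab: "{a..b} \<subseteq> U" for a b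
  proof -
    have "set_integrable lborel {a<..<b} h"
      by (rule set_integrable_subset[OF h]) (use ab in auto)
    then have int: "integrable lborel (\<lambda>x. indicator {a<..<b} x * h x)"
      by (simp add: set_integrable_def)
    have "AE x in lborel. indicator {a<..<b} x * h x = 0"
    proof (rule AE_zero_of_integral_greaterThan[OF int])
      fix x :: real
      have "(LINT t|lborel. indicator {x<..} t * (indicator {a<..<b} t * h t)) =
          (LINT t|lborel. indicator {max a x<..<b} t * h t)"
        by (intro Bochner_Integration.integral_cong) (auto simp: indicator_def)
      also have "\<dots> = 0"
      proof (cases "max a x < b")
        case True
        then show ?thesis using ab by (intro zero) auto
      next
        case False
        then have "{max a x<..<b} = {}" by auto
        then show ?thesis by simp
      qed
      finally show "(LINT t|lborel. indicator {x<..} t * (indicator {a<..<b} t * h t)) = 0" .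
    qed
    then show ?thesis by eventually_elim (auto simp: indicator_def)
  qed
  define I where "I = {(a, b). a \<in> \<rat> \<and> b \<in> \<rat> \<and> {a..b} \<subseteq> U}"
  have "countable I"
    by (rule countable_subset[of _ "\<rat> \<times> \<rat>"]) (auto simp: I_def countable_rat)
  then have "AE x in lborel. \<forall>(a, b)\<in>I. x \<in> {a<..<b} \<longrightarrow> h x = 0"
    using piece by (subst AE_ball_countable) (auto simp: I_def)
  then show ?thesis
  proof eventually_elim
    case (elim x)
    show ?case
    proof
      assume "x \<in> U"
      then obtain e where e: "0 < e" "ball x e \<subseteq> U" using U by (meson openE)
      obtain a where a: "a \<in> \<rat>" "x - e < a" "a < x" using Rats_dense_in_real[of "x - e" x] e by auto
      obtain b where b: "b \<in> \<rat>" "x < b" "b < x + e" using Rats_dense_in_real[of x "x + e"] e by auto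
      have "{a..b} \<subseteq> ball x e" using a b by (auto simp: dist_real_def)
      then have "(a, b) \<in> I" using a b e by (auto simp: I_def)
      then show "h x = 0" using elim a b by auto
    qed
  qed
qed

lemma has_real_derivative_pos_part_power2:
  "((\<lambda>x::real. (max 0 x)\<^sup>2) has_real_derivative 2 * max 0 x) (at x)"
proof -
  consider "x < 0" | "x = 0" | "0 < x" by linarith
  then show ?thesis
  proof cases
    case 1
    have "((\<lambda>x::real. 0) has_real_derivative 0) (at x)" by simp
    then have "((\<lambda>x::real. (max 0 x)\<^sup>2) has_real_derivative 0) (at x)"
      by (rule has_field_derivative_transform_within_open[where S="{..<0}"]) (use 1 in auto)
    then show ?thesis using 1 by (simp add: max_def)
  next
    case 2
    have "((\<lambda>h::real. (max 0 h)\<^sup>2 / h) \<longlongrightarrow> 0) (at 0)"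
    proof (rule tendsto_0_le[where K=1 and f="\<lambda>h::real. h"])
      show "\<forall>\<^sub>F h in at 0. norm ((max 0 h)\<^sup>2 / h) \<le> norm (h::real) * 1"
        by (auto simp: eventually_at_filter max_def power2_eq_square)
    qed (rule tendsto_ident_at)
    then show ?thesis by (simp add: 2 DERIV_def)
  next
    case 3
    have "((\<lambda>x::real. x\<^sup>2) has_real_derivative 2 * x) (at x)"
      by (auto intro!: derivative_eq_intros)
    then have "((\<lambda>x::real. (max 0 x)\<^sup>2) has_real_derivative 2 * x) (at x)"
      by (rule has_field_derivative_transform_within_open[where S="{0<..}"]) (use 3 in auto)
    then show ?thesis using 3 by (simp add: max_def)
  qed
qed

text \<open>Since \<open>test_functions\<close> asks for C1 only, a product of two squared positive
  parts can serve as a bump.\<close>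

lemma C1_bump_function:
  fixes a b :: real
  assumes "a < b"
  obtains \<beta> \<beta>' :: "real \<Rightarrow> real"
  where "\<And>x. (\<beta> has_real_derivative \<beta>' x) (at x)" "continuous_on UNIV \<beta>'"
    "\<And>x. 0 \<le> \<beta> x" "\<And>x. \<beta> x \<le> 1" "\<And>x. 0 < \<beta> x \<longleftrightarrow> a < x \<and> x < b"
proof -
  \<comment> \<open>Each squared factor is at most the square of \<open>b - a\<close> on the
    interval, so \<open>c\<close> normalizes the bump to values at most 1.\<close>
  define c where "c = (b - a)^4"
  have c: "0 < c" using assms by (simp add: c_def)
  define \<beta> where "\<beta> x = (max 0 (x - a))\<^sup>2 * (max 0 (b - x))\<^sup>2 / c" for x
  define \<beta>' where "\<beta>' x = (2 * max 0 (x - a) * (max 0 (b - x))\<^sup>2 - (max 0 (x - a))\<^sup>2 * (2 * max 0 (b - x))) / c" for x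
  have 1: "((\<lambda>x. (max 0 (x - a))\<^sup>2) has_real_derivative 2 * max 0 (x - a)) (at x)" for x
  proof -
    have "((\<lambda>x. x - a) has_real_derivative 1) (at x)" by (auto intro!: derivative_eq_intros)
    from DERIV_chain2[OF has_real_derivative_pos_part_power2 this] show ?thesis by simp
  qed
  have 2: "((\<lambda>x. (max 0 (b - x))\<^sup>2) has_real_derivative - (2 * max 0 (b - x))) (at x)" for x
  proof -
    have "((\<lambda>x. b - x) has_real_derivative - 1) (at x)" by (auto intro!: derivative_eq_intros)
    from DERIV_chain2[OF has_real_derivative_pos_part_power2 this] show ?thesis by simp
  qed
  show thesis
  proof
    show "(\<beta> has_real_derivative \<beta>' x) (at x)" for x
      unfolding \<beta>_def \<beta>'_def by (rule derivative_eq_intros 1 2 refl)+ (use c in \<open>auto simp: field_simps\<close>)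
    show "continuous_on UNIV \<beta>'"
      unfolding \<beta>'_def using c by (intro continuous_intros) auto
    show "0 \<le> \<beta> x" for x using c by (simp add: \<beta>_def)
    show "0 < \<beta> x \<longleftrightarrow> a < x \<and> x < b" for x
    proof (cases "a < x \<and> x < b")
      case True
      then show ?thesis using c by (simp add: \<beta>_def)
    next
      case False
      then have "max 0 (x - a) = 0 \<or> max 0 (b - x) = 0" by auto
      then show ?thesis using False by (auto simp: \<beta>_def)
    qed
    show "\<beta> x \<le> 1" for x
    proof (cases "a < x \<and> x < b")
      case True
      have "(x - a) * (b - x) \<le> (b - a) * (b - a)" using True by (intro mult_mono) auto
      then have "((x - a) * (b - x))\<^sup>2 \<le> ((b - a) * (b - a))\<^sup>2" using True by (intro power_mono) auto
      also have "((b - a) * (b - a))\<^sup>2 = c" by (simp add: c_def power2_eq_square power4_eq_xxxx)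
      finally show ?thesis using True c by (simp add: \<beta>_def max_def power_mult_distrib)
    next
      case False
      then have "\<beta> x = 0" by (auto simp: \<beta>_def max_def)
      then show ?thesis by simp
    qed
  qed
qed

text \<open>For a bump \<open>\<beta>\<close> the functions \<open>1 - (1 - \<beta> x)^k\<close> are
  test functions that tend pointwise to the indicator of the open interval where
  \<open>\<beta>\<close> is positive; dominated convergence reduces the claim to interval
  integrals.\<close>

lemma fundamental_lemma_calculus_of_variations:
  fixes h :: "real \<Rightarrow> real"
  assumes U: "open U" and h: "set_integrable lborel U h"
    and zero: "\<And>\<phi>. \<phi> \<in> test_functions U \<Longrightarrow> (LINT x:U|lborel. h x * \<phi> x) = 0"
  shows "AE x in lborel. x \<in> U \<longrightarrow> h x = 0"
proof (rule AE_zero_of_interval_integrals[OF U h])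
  fix a b :: real assume "a < b" and ab: "{a..b} \<subseteq> U"
  obtain \<beta> \<beta>' :: "real \<Rightarrow> real" where
    \<beta>: "\<And>x. (\<beta> has_real_derivative \<beta>' x) (at x)" "continuous_on UNIV \<beta>'"
    "\<And>x. 0 \<le> \<beta> x" "\<And>x. \<beta> x \<le> 1" "\<And>x. 0 < \<beta> x \<longleftrightarrow> a < x \<and> x < b"
    using C1_bump_function[OF \<open>a < b\<close>] by metis
  have c\<beta>: "continuous_on UNIV \<beta>"
    using \<beta>(1) by (meson DERIV_continuous continuous_at_imp_continuous_on)
  define \<phi> where "\<phi> k x = 1 - (1 - \<beta> x)^k" for k x
  have \<beta>0: "\<beta> x = 0" if "x \<notin> {a..b}" for x
    using \<beta>(3)[of x] \<beta>(5)[of x] that by (auto simp: order.order_iff_strict)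
  have test: "\<phi> k \<in> test_functions U" for k
    unfolding test_functions_def
  proof (intro CollectI conjI exI)
    have "(\<phi> k has_real_derivative (real k * (1 - \<beta> x)^(k - 1) * \<beta>' x)) (at x)" for x
      unfolding \<phi>_def by (rule derivative_eq_intros \<beta>(1) refl)+ simp
    moreover have "continuous_on UNIV (\<lambda>x. real k * (1 - \<beta> x)^(k - 1) * \<beta>' x)"
      by (intro continuous_intros c\<beta> \<beta>(2))
    ultimately show "\<phi> k C1_differentiable_on UNIV"
      unfolding C1_differentiable_on_def has_real_derivative_iff_has_vector_derivative
      by (intro exI[of _ "\<lambda>x. real k * (1 - \<beta> x)^(k - 1) * \<beta>' x"]) blast
    show "compact {a..b}" by simp
    show "{a..b} \<subseteq> U" by fact
    show "\<forall>x. x \<notin> {a..b} \<longrightarrow> \<phi> k x = 0" using \<beta>0 by (simp add: \<phi>_def)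
  qed
  have "set_borel_measurable lborel U h" using h
    by (simp add: set_integrable_def set_borel_measurable_def borel_measurable_integrable)
  then have hm: "(\<lambda>x. indicator U x * h x) \<in> borel_measurable lborel"
    by (simp add: set_borel_measurable_def)
  have [measurable]: "U \<in> sets lborel" using U by simp
  have \<phi>01: "0 \<le> \<phi> k x" "\<phi> k x \<le> 1" for k x
    using \<beta>(3,4)[of x] by (auto simp: \<phi>_def power_le_one)
  have lim: "(\<lambda>k. \<phi> k x) \<longlonglongrightarrow> indicator {a<..<b} x" for x
  proof (cases "a < x \<and> x < b")
    case True
    then have "(\<lambda>k. (1 - \<beta> x)^k) \<longlonglongrightarrow> 0"
      using \<beta>(4)[of x] \<beta>(5)[of x] by (intro LIMSEQ_power_zero) auto
    then have "(\<lambda>k. \<phi> k x) \<longlonglongrightarrow> 1 - 0"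
      unfolding \<phi>_def by (intro tendsto_diff tendsto_const)
    then show ?thesis using True by simp
  next
    case False
    then have "\<beta> x = 0" using \<beta>(3)[of x] \<beta>(5)[of x] by (auto simp: order.order_iff_strict)
    then show ?thesis using False by (simp add: \<phi>_def)
  qed
  have "(\<lambda>k. LINT x|lborel. indicator U x * h x * \<phi> k x) \<longlonglongrightarrow> (LINT x|lborel. indicator U x * h x * indicator {a<..<b} x)"
  proof (rule integral_dominated_convergence)
    show "integrable lborel (\<lambda>x. \<bar>indicator U x * h x\<bar>)"
      using h by (simp add: set_integrable_def)
    show "AE x in lborel. (\<lambda>k. indicator U x * h x * \<phi> k x) \<longlonglongrightarrow> indicator U x * h x * indicator {a<..<b} x"
      by (intro AE_I2 tendsto_intros lim)
    show "AE x in lborel. norm (indicator U x * h x * \<phi> k x) \<le> \<bar>indicator U x * h x\<bar>" for k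
      using \<phi>01 by (intro AE_I2) (auto simp: abs_mult mult_left_le)
    show "(\<lambda>x. indicator U x * h x * indicator {a<..<b} x) \<in> borel_measurable lborel"
      using hm by measurable
    show "(\<lambda>x. indicator U x * h x * \<phi> k x) \<in> borel_measurable lborel" for k
      using hm test_function_measurable[OF test] by measurable
  qed
  moreover have "(LINT x|lborel. indicator U x * h x * \<phi> k x) = 0" for k
    using zero[OF test, of k] by (simp add: set_lebesgue_integral_def mult.assoc)
  ultimately have "(LINT x|lborel. indicator U x * h x * indicator {a<..<b} x) = 0"
    by (simp add: LIMSEQ_const_iff)
  also have "(LINT x|lborel. indicator U x * h x * indicator {a<..<b} x) = (LINT t|lborel. indicator {a<..<b} t * h t)"
  proof (intro Bochner_Integration.integral_cong refl)
    show "indicator U x * h x * indicator {a<..<b} x = indicator {a<..<b} x * h x" for x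
      using subsetD[OF ab, of x] by (auto split: split_indicator)
  qed
  finally show "(LINT t|lborel. indicator {a<..<b} t * h t) = 0" .
qed

lemma integrable_mult_bounded:
  fixes f g :: "'a \<Rightarrow> real"
  assumes f: "integrable M f" and g: "g \<in> borel_measurable M" "\<And>x. \<bar>g x\<bar> \<le> B"
  shows "integrable M (\<lambda>x. f x * g x)"
proof (rule Bochner_Integration.integrable_bound)
  show "integrable M (\<lambda>x. B * \<bar>f x\<bar>)" using f by simp
  show "(\<lambda>x. f x * g x) \<in> borel_measurable M" using f g(1) by simp
  have "\<bar>f x\<bar> * \<bar>g x\<bar> \<le> \<bar>B * \<bar>f x\<bar>\<bar>" for x
  proof -
    have "\<bar>f x\<bar> * \<bar>g x\<bar> \<le> \<bar>f x\<bar> * B" by (intro mult_left_mono g(2)) simp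
    then show ?thesis by (simp add: mult.commute)
  qed
  then show "AE x in M. norm (f x * g x) \<le> norm (B * \<bar>f x\<bar>)" by (simp add: abs_mult)
qed

section \<open>Weak limits identified through their primitives\<close>

lemma LIMSEQ_if_convergent_subseqs:
  fixes X :: "nat \<Rightarrow> real"
  assumes bounded: "\<And>n. \<bar>X n\<bar> \<le> K"
    and sub: "\<And>r l. strict_mono r \<Longrightarrow> (\<lambda>n. X (r n)) \<longlonglongrightarrow> l \<Longrightarrow> l = L"
  shows "X \<longlonglongrightarrow> L"
proof (rule ccontr)
  assume "\<not> X \<longlonglongrightarrow> L"
  then obtain e where e: "0 < e" "\<And>N. \<exists>n\<ge>N. e \<le> \<bar>X n - L\<bar>"
    unfolding LIMSEQ_iff by (auto simp: not_less)
  then have "infinite {n. e \<le> \<bar>X n - L\<bar>}"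
    unfolding infinite_nat_iff_unbounded_le by auto
  then obtain r :: "nat \<Rightarrow> nat" where r: "strict_mono r" "\<And>n. e \<le> \<bar>X (r n) - L\<bar>"
    using infinite_enumerate by blast
  have "bounded (range (\<lambda>n. X (r n)))" using bounded by (auto simp: bounded_iff)
  then obtain l s where s: "strict_mono (s :: nat \<Rightarrow> nat)" "((\<lambda>n. X (r n)) \<circ> s) \<longlonglongrightarrow> l"
    using bounded_imp_convergent_subsequence by blast
  then have "l = L" using sub[OF strict_mono_o[OF r(1) s(1)], of l] by (simp add: o_def)
  with s(2) have "(\<lambda>n. \<bar>X (r (s n)) - L\<bar>) \<longlonglongrightarrow> \<bar>L - L\<bar>"
    by (intro tendsto_intros) (simp add: o_def)
  then have "\<forall>\<^sub>F n in sequentially. \<bar>X (r (s n)) - L\<bar> < e"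
    using e(1) by (intro order_tendstoD(2)) auto
  then obtain n where "\<bar>X (r (s n)) - L\<bar> < e" by (auto simp: eventually_sequentially)
  with r(2)[of "s n"] show False by simp
qed

lemma square_integrable_indicator:
  "A \<in> sets M \<Longrightarrow> emeasure M A < \<infinity> \<Longrightarrow> square_integrable M (indicator A)"
  unfolding square_integrable_def power2_eq_square indicator_inter_arith[symmetric] by simp

lemma square_integrable_imp_set_integrable:
  assumes f: "square_integrable M (\<lambda>x. indicator A x * f x)" and A: "A \<in> sets M" "emeasure M A < \<infinity>"
  shows "set_integrable M A f"
proof -
  have "integrable M (\<lambda>x. indicator A x * (indicator A x * f x))"
    by (rule square_integrable_mult[OF square_integrable_indicator[OF A] f])
  moreover have "(\<lambda>x. indicator A x * (indicator A x * f x)) = (\<lambda>x. indicator A x *\<^sub>R f x)"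
    by (auto split: split_indicator)
  ultimately show ?thesis by (simp add: set_integrable_def)
qed

text \<open>Interval integrals are differences of primitives, up to the null set \<open>{a}\<close>,
  so equal primitives give equal interval integrals of \<open>g\<close> and
  \<open>h\<close>.\<close>

lemma AE_eq_of_primitives:
  fixes g h :: "real \<Rightarrow> real"
  assumes g: "square_integrable lborel g" and h: "square_integrable lborel h"
    and eq: "\<And>x. x \<in> {0..1} \<Longrightarrow> (LINT t|lborel. g t * indicator {0<..<x} t) = (LINT t|lborel. h t * indicator {0<..<x} t)"
  shows "AE x in lborel. x \<in> {0<..<1} \<longrightarrow> g x = h x"
proof -
  define k where "k t = g t - h t" for t
  have k: "square_integrable lborel k" unfolding k_def by (rule square_integrable_diff[OF g h])
  have ind: "square_integrable lborel (indicator {a<..<b} :: real \<Rightarrow> real)" for a b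
    by (cases "a \<le> b") (auto intro!: square_integrable_indicator)
  have int: "integrable lborel (\<lambda>t. k t * indicator {a<..<b} t)" for a b
    by (rule square_integrable_mult[OF k ind])
  have zero: "(LINT t|lborel. k t * indicator {0<..<x} t) = 0" if "x \<in> {0..1}" for x
    using eq[OF that] square_integrable_mult[OF g ind, of 0 x] square_integrable_mult[OF h ind, of 0 x]
    by (simp add: k_def left_diff_distrib)
  have "AE x in lborel. x \<in> {0<..<1} \<longrightarrow> k x = 0"
  proof (rule AE_zero_of_interval_integrals)
    show "set_integrable lborel {0<..<1} k"
      using int[of 0 1] by (simp add: set_integrable_def mult.commute)
    fix a b :: real assume ab: "a < b" "{a..b} \<subseteq> {0<..<1}"
    then have "0 < a" "b < 1"
      using subsetD[OF ab(2), of a] subsetD[OF ab(2), of b] by auto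
    have "(LINT t|lborel. indicator {a<..<b} t * k t) =
        (LINT t|lborel. k t * indicator {0<..<b} t - k t * indicator {0<..<a} t)"
    proof (rule integral_cong_AE)
      show "AE t in lborel. indicator {a<..<b} t * k t = k t * indicator {0<..<b} t - k t * indicator {0<..<a} t"
        using AE_lborel_singleton[of a]
      proof eventually_elim
        case (elim t)
        then show ?case using \<open>0 < a\<close> ab(1) by (auto split: split_indicator)
      qed
    qed (use square_integrable_measurable[OF k] in measurable)
    also have "\<dots> = 0"
      using int zero[of a] zero[of b] \<open>0 < a\<close> \<open>b < 1\<close> ab(1) by simp
    finally show "(LINT t|lborel. indicator {a<..<b} t * k t) = 0" .
  qed simp
  then show ?thesis by eventually_elim (auto simp: k_def)
qed

text \<open>Every weak cluster point of \<open>f\<close> has the primitive \<open>P\<close>, which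
  determines it almost everywhere on the unit interval. Hence all convergent subsequences of a
  bounded sequence of pairings share one limit, and the whole sequence converges.\<close>

lemma L2_weak_limit_of_primitives:
  fixes f :: "nat \<Rightarrow> real \<Rightarrow> real"
  assumes f: "\<And>n. square_integrable lborel (f n)" and K: "\<And>n. (LINT t|lborel. (f n t)\<^sup>2) \<le> K"
    and supp: "\<And>n t. t \<notin> {0<..<1} \<Longrightarrow> f n t = 0"
    and lim: "\<And>x. x \<in> {0..1} \<Longrightarrow> (\<lambda>n. LINT t|lborel. indicator {..<x} t * f n t) \<longlonglongrightarrow> P x"
  obtains g where "square_integrable lborel g" "\<And>t. t \<notin> {0<..<1} \<Longrightarrow> g t = 0"
    "\<And>x. x \<in> {0..1} \<Longrightarrow> (LINT t|lborel. indicator {..<x} t * g t) = P x"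
    "\<And>\<phi>. square_integrable lborel \<phi> \<Longrightarrow>
      (\<lambda>n. LINT t|lborel. f n t * \<phi> t) \<longlonglongrightarrow> (LINT t|lborel. g t * \<phi> t)"
proof -
  have ind: "square_integrable lborel (indicator {0<..<x} :: real \<Rightarrow> real)" for x
    by (cases "0 \<le> x") (auto intro!: square_integrable_indicator)
  have lim': "(\<lambda>n. LINT t|lborel. f n t * indicator {0<..<x} t) \<longlonglongrightarrow> P x" if "x \<in> {0..1}" for x
  proof -
    have "indicator {..<x} t * f n t = f n t * indicator {0<..<x} t" for n t
      using supp[of t n] by (cases "t \<in> {0<..<1}") (auto split: split_indicator)
    with lim[OF that] show ?thesis by simp
  qed
  have weak: "\<exists>g. square_integrable lborel g \<and> (\<forall>x\<in>{0..1}. (LINT t|lborel. g t * indicator {0<..<x} t) = P x) \<and>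
      (\<forall>\<phi> L. square_integrable lborel \<phi> \<longrightarrow> (\<lambda>n. LINT t|lborel. f (r n) t * \<phi> t) \<longlonglongrightarrow> L \<longrightarrow>
        (LINT t|lborel. g t * \<phi> t) = L)" if r: "strict_mono r" for r
  proof -
    obtain g where g: "square_integrable lborel g"
      "\<And>\<phi> L. square_integrable lborel \<phi> \<Longrightarrow> (\<lambda>n. LINT t|lborel. f (r n) t * \<phi> t) \<longlonglongrightarrow> L \<Longrightarrow>
        (LINT t|lborel. g t * \<phi> t) = L"
      using L2_weakly_compact[of lborel "\<lambda>n. f (r n)" K] f K by blast
    moreover have "(LINT t|lborel. g t * indicator {0<..<x} t) = P x" if "x \<in> {0..1}" for x
      using LIMSEQ_subseq_LIMSEQ[OF lim'[OF that] r] by (intro g(2) ind) (simp add: o_def)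
    ultimately show ?thesis by blast
  qed
  obtain g0 where g0: "square_integrable lborel g0"
    "\<And>x. x \<in> {0..1} \<Longrightarrow> (LINT t|lborel. g0 t * indicator {0<..<x} t) = P x"
    using weak[OF strict_mono_id] by auto
  \<comment> \<open>Nothing is recorded about \<open>g0\<close> outside of \<open>{0<..<1}\<close>;
    the cut makes its integrals over \<open>{..<x}\<close> and \<open>{0<..<x}\<close>
    agree.\<close>
  define g where "g t = indicator {0<..<1} t * g0 t" for t
  have g: "square_integrable lborel g"
    unfolding g_def by (rule square_integrable_bounded_mult[OF g0(1)]) (auto split: split_indicator)
  show thesis
  proof
    show "square_integrable lborel g" by fact
    show "g t = 0" if "t \<notin> {0<..<1}" for t using that by (simp add: g_def)
    show "(LINT t|lborel. indicator {..<x} t * g t) = P x" if x: "x \<in> {0..1}" for x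
    proof -
      have "indicator {..<x} t * g t = g0 t * indicator {0<..<x} t" for t
        using x by (auto simp: g_def split: split_indicator)
      then show ?thesis using g0(2)[OF x] by simp
    qed
    fix \<phi> :: "real \<Rightarrow> real" assume \<phi>: "square_integrable lborel \<phi>"
    \<comment> \<open>The weak limits are compared on \<open>{0<..<1}\<close> only, so the test
      function is cut down to it as well.\<close>
    define \<psi> where "\<psi> t = indicator {0<..<1} t * \<phi> t" for t
    have \<psi>: "square_integrable lborel \<psi>"
      unfolding \<psi>_def by (rule square_integrable_bounded_mult[OF \<phi>]) (auto split: split_indicator)
    have f\<psi>: "f n t * \<phi> t = f n t * \<psi> t" for n t
      using supp[of t n] by (cases "t \<in> {0<..<1}") (auto simp: \<psi>_def)
    have "(\<lambda>n. LINT t|lborel. f n t * \<psi> t) \<longlonglongrightarrow> (LINT t|lborel. g t * \<phi> t)"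
    proof (rule LIMSEQ_if_convergent_subseqs)
      fix n
      have "(LINT t|lborel. f n t * \<psi> t)\<^sup>2 \<le> (LINT t|lborel. (f n t)\<^sup>2) * (LINT t|lborel. (\<psi> t)\<^sup>2)"
        by (rule integral_Cauchy_Schwarz[OF f \<psi>])
      also have "\<dots> \<le> K * (LINT t|lborel. (\<psi> t)\<^sup>2)" by (intro mult_right_mono K) simp
      finally show "\<bar>LINT t|lborel. f n t * \<psi> t\<bar> \<le> sqrt (K * (LINT t|lborel. (\<psi> t)\<^sup>2))"
        by (metis real_sqrt_abs real_sqrt_le_mono)
    next
      fix r l assume r: "strict_mono r" and l: "(\<lambda>n. LINT t|lborel. f (r n) t * \<psi> t) \<longlonglongrightarrow> l"
      obtain h where h: "square_integrable lborel h"
        "\<And>x. x \<in> {0..1} \<Longrightarrow> (LINT t|lborel. h t * indicator {0<..<x} t) = P x"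
        "(LINT t|lborel. h t * \<psi> t) = l"
        using weak[OF r] \<psi> l by blast
      have "AE x in lborel. x \<in> {0<..<1} \<longrightarrow> h x = g0 x"
        by (rule AE_eq_of_primitives[OF h(1) g0(1)]) (simp add: h(2) g0(2))
      then have "(LINT t|lborel. h t * \<psi> t) = (LINT t|lborel. g t * \<phi> t)"
      proof (intro integral_cong_AE)
        assume "AE x in lborel. x \<in> {0<..<1} \<longrightarrow> h x = g0 x"
        then show "AE t in lborel. h t * \<psi> t = g t * \<phi> t"
          by eventually_elim (auto simp: \<psi>_def g_def split: split_indicator)
        show "(\<lambda>t. h t * \<psi> t) \<in> borel_measurable lborel"
          using h(1) \<psi> by (intro borel_measurable_times square_integrable_measurable)
        show "(\<lambda>t. g t * \<phi> t) \<in> borel_measurable lborel"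
          using g \<phi> by (intro borel_measurable_times square_integrable_measurable)
      qed
      then show "l = (LINT t|lborel. g t * \<phi> t)" using h(3) by simp
    qed
    then show "(\<lambda>n. LINT t|lborel. f n t * \<phi> t) \<longlonglongrightarrow> (LINT t|lborel. g t * \<phi> t)"
      by (simp add: f\<psi>)
  qed
qed

lemma primitive_continuous:
  fixes g :: "real \<Rightarrow> real"
  assumes g: "integrable lborel g"
  shows "continuous_on UNIV (\<lambda>x. LINT t|lborel. indicator {..<x} t * g t)"
proof (rule continuous_on_sequentiallyI)
  fix u :: "nat \<Rightarrow> real" and a assume u: "u \<longlonglongrightarrow> a"
  note [measurable] = borel_measurable_integrable[OF g]
  show "(\<lambda>n. LINT t|lborel. indicator {..<u n} t * g t) \<longlonglongrightarrow> (LINT t|lborel. indicator {..<a} t * g t)"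
  proof (rule integral_dominated_convergence[where w="\<lambda>t. \<bar>g t\<bar>"])
    show "AE t in lborel. (\<lambda>n. indicator {..<u n} t * g t) \<longlonglongrightarrow> indicator {..<a} t * g t"
      using AE_lborel_singleton[of a]
    proof eventually_elim
      case (elim t)
      have "\<forall>\<^sub>F n in sequentially. (indicator {..<u n} t :: real) = indicator {..<a} t"
      proof (cases "t < a")
        case True
        from order_tendstoD(1)[OF u this] show ?thesis by eventually_elim (use True in auto)
      next
        case False
        with elim have "a < t" by simp
        from order_tendstoD(2)[OF u this] show ?thesis by eventually_elim (use \<open>a < t\<close> in auto)
      qed
      then have "(\<lambda>n. indicator {..<u n} t :: real) \<longlonglongrightarrow> indicator {..<a} t"
        by (rule tendsto_eventually)
      then show ?case by (intro tendsto_intros)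
    qed
    show "AE t in lborel. norm (indicator {..<u n} t * g t) \<le> \<bar>g t\<bar>" for n
      by (auto split: split_indicator)
  qed (use g in \<open>auto simp: measurable_lborel1\<close>)
qed

text \<open>Lets computations on \<open>U\<close> take place on the whole line, with the extension
  by zero.\<close>

lemma L2_on_iff: "f \<in> L2_on U \<longleftrightarrow> square_integrable lborel (\<lambda>x. indicator U x * f x)"
proof -
  have "(indicator U x * f x)\<^sup>2 = indicator U x * (f x)\<^sup>2" for x :: real
    by (auto split: split_indicator)
  then show ?thesis
    by (simp add: L2_on_def square_integrable_def set_borel_measurable_def set_integrable_def)
qed

lemma set_integrable_mult_test_function:
  assumes f: "set_integrable lborel U f" and \<phi>: "\<phi> \<in> test_functions V"
  shows "set_integrable lborel U (\<lambda>x. f x * \<phi> x)"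
proof -
  obtain B where "\<And>x. \<bar>\<phi> x\<bar> \<le> B" using test_function_bounded[OF \<phi>] by metis
  then have "integrable lborel (\<lambda>x. (indicator U x *\<^sub>R f x) * \<phi> x)"
    using f test_function_measurable[OF \<phi>] unfolding set_integrable_def
    by (intro integrable_mult_bounded) auto
  then show ?thesis by (simp add: set_integrable_def mult.assoc)
qed

text \<open>On a set of finite measure L2 functions are integrable, so the fundamental lemma applies
  to \<open>g - h\<close>. This makes any known weak derivative comparable with the
  \<open>SOME\<close> choice in \<open>weak_deriv\<close>.\<close>

lemma has_weak_deriv_L2_unique:
  assumes U: "open U" "emeasure lborel U < \<infinity>"
    and g: "has_weak_deriv_L2 U f g" and h: "has_weak_deriv_L2 U f h"
  shows "AE x in lborel. x \<in> U \<longrightarrow> g x = h x"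
proof -
  have gU: "square_integrable lborel (\<lambda>x. indicator U x * g x)"
    and hU: "square_integrable lborel (\<lambda>x. indicator U x * h x)"
    using g h by (auto simp: has_weak_deriv_L2_def L2_on_iff)
  have U_sets: "U \<in> sets lborel" using U(1) by simp
  have int: "set_integrable lborel U g" "set_integrable lborel U h"
    by (rule square_integrable_imp_set_integrable[OF _ U_sets U(2)] gU hU)+
  have "AE x in lborel. x \<in> U \<longrightarrow> g x - h x = 0"
  proof (rule fundamental_lemma_calculus_of_variations[OF U(1)])
    show "set_integrable lborel U (\<lambda>x. g x - h x)" using int by (rule set_integral_diff)
    fix \<phi> assume \<phi>: "\<phi> \<in> test_functions U"
    have "(LINT x:U|lborel. g x * \<phi> x) = (LINT x:U|lborel. h x * \<phi> x)"
      using g h \<phi> by (auto simp: has_weak_deriv_L2_def)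
    then show "(LINT x:U|lborel. (g x - h x) * \<phi> x) = 0"
      using set_integral_diff(2)[OF set_integrable_mult_test_function[OF int(1) \<phi>]
          set_integrable_mult_test_function[OF int(2) \<phi>]] by (simp add: left_diff_distrib)
  qed
  then show ?thesis by eventually_elim simp
qed

section \<open>Piecewise affine chains\<close>

text \<open>For positive \<open>n\<close> this is the primitive of \<open>n\<close> times the
  indicator of the \<open>i\<close>-th cell: 0 before the cell, 1 behind it.\<close>

definition ramp :: "nat \<Rightarrow> nat \<Rightarrow> real \<Rightarrow> real" where
  "ramp n i x = max 0 (min 1 (real n * x - real i))"

text \<open>The derivative of a sum of ramps of heights \<open>y i\<close>; the factor
  \<open>n\<close>, the inverse cell length, turns increments into slopes.\<close>

definition step :: "nat \<Rightarrow> nat set \<Rightarrow> (nat \<Rightarrow> real) \<Rightarrow> real \<Rightarrow> real" where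
  "step n A y t = (\<Sum>i\<in>A. real n * y i * indicator {real i * lam n<..<real (i + 1) * lam n} t)"

lemma ramp_bounds: "0 \<le> ramp n i x" "ramp n i x \<le> 1"
  by (auto simp: ramp_def)

lemma ramp_at_1: "i < n \<Longrightarrow> ramp n i 1 = 1"
  by (simp add: ramp_def)

text \<open>Membership in \<open>affine_chains\<close> gives the affine formula inside the cell
  only; continuity carries it to the end points, where it fixes both coefficients.\<close>

lemma affine_chain_between:
  assumes n: "1 \<le> n" and v: "v \<in> affine_chains n" and j: "j < n"
    and x: "real j \<le> real n * x" "real n * x \<le> real (j + 1)"
  shows "v x = v (real j * lam n) + (v (real (j + 1) * lam n) - v (real j * lam n)) * (real n * x - real j)"
proof -
  define a b where "a = real j * lam n" and "b = real (j + 1) * lam n"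
  have n0: "0 < real n" using n by simp
  have ab: "a < b" "0 \<le> a" "b \<le> 1" "a \<le> x" "x \<le> b"
    using n0 j x by (auto simp: a_def b_def lam_def field_simps)
  obtain p q where pq: "\<And>x. x \<in> {a<..<b} \<Longrightarrow> v x = p + q * x"
    using v j unfolding affine_chains_def a_def b_def by blast
  have cont: "continuous_on {a..b} (\<lambda>x. v x - (p + q * x))"
    using v ab unfolding affine_chains_def
    by (intro continuous_intros) (auto intro: continuous_on_subset)
  have eq: "v x = p + q * x" if "x \<in> {a..b}" for x
  proof -
    have "v x - (p + q * x) = 0"
      by (rule continuous_constant_on_closure[of "{a<..<b}"])
        (use cont pq that ab(1) in \<open>auto simp: closure_greaterThanLessThan\<close>)
    then show ?thesis by simp
  qed
  have vx: "v x = p + q * x" and va: "v a = p + q * a" and vb: "v b = p + q * b"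
    using eq ab by auto
  have "real n * a = real j" "real n * (b - a) = 1"
    using n0 by (auto simp: a_def b_def lam_def field_simps)
  then have "(b - a) * (real n * x - real j) = x - a"
    by (metis mult.assoc mult.commute mult_1 right_diff_distrib)
  then have "q * (b - a) * (real n * x - real j) = q * (x - a)" by simp
  then have "v x = v a + (v b - v a) * (real n * x - real j)"
    unfolding vx va vb by (simp only: right_diff_distrib[symmetric] add_diff_cancel_left) (simp add: right_diff_distrib)
  then show ?thesis by (simp only: a_def b_def)
qed

text \<open>Ramps left of the cell of \<open>x\<close> equal 1 and their increments telescope, ramps
  to the right vanish, and the one of the cell itself interpolates.\<close>

lemma affine_chain_eq_sum_ramp:
  assumes n: "1 \<le> n" and v: "v \<in> affine_chains n" and x: "x \<in> {0..1}"
  shows "v x = v 0 + (\<Sum>i<n. (v (real (i + 1) * lam n) - v (real i * lam n)) * ramp n i x)"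
proof -
  obtain j where j: "j < n" "real j \<le> real n * x" "real n * x \<le> real (j + 1)"
  proof (cases "x = 1")
    case True
    \<comment> \<open>At \<open>x = 1\<close> the floor would give the index \<open>n\<close>, one
      past the last cell.\<close>
    then show thesis using n by (intro that[of "n - 1"]) auto
  next
    case False
    define j where "j = nat \<lfloor>real n * x\<rfloor>"
    have "0 \<le> real n * x" "real n * x < real n" using False x n by auto
    then have "real j \<le> real n * x" "real n * x < real j + 1"
      unfolding j_def by (simp_all add: of_nat_nat)
    moreover from this(1) \<open>real n * x < real n\<close> have "j < n" by linarith
    ultimately show thesis by (intro that[of j]) simp_all
  qed
  define y where "y i = v (real (i + 1) * lam n) - v (real i * lam n)" for i
  have "(\<Sum>i<n. y i * ramp n i x) = (\<Sum>i<j. y i * ramp n i x) + (\<Sum>i\<in>{j..<n}. y i * ramp n i x)"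
    using j(1) sum.atLeastLessThan_concat[of 0 j n "\<lambda>i. y i * ramp n i x"] by (simp add: atLeast0LessThan)
  also have "(\<Sum>i\<in>{j..<n}. y i * ramp n i x) = y j * ramp n j x + (\<Sum>i\<in>{Suc j..<n}. y i * ramp n i x)"
    using j(1) by (rule sum.atLeast_Suc_lessThan)
  also have "(\<Sum>i\<in>{Suc j..<n}. y i * ramp n i x) = 0"
    using j(3) by (intro sum.neutral) (auto simp: ramp_def max_def)
  also have "ramp n j x = real n * x - real j" using j by (auto simp: ramp_def)
  also have "(\<Sum>i<j. y i * ramp n i x) = (\<Sum>i<j. y i)"
    using j(2) by (intro sum.cong) (auto simp: ramp_def)
  also have "\<dots> = v (real j * lam n) - v 0"
    using sum_lessThan_telescope[of "\<lambda>i. v (real i * lam n)" j] by (simp add: y_def)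
  finally show ?thesis
    using affine_chain_between[OF n v j] by (simp add: y_def)
qed

lemma step_measurable [measurable]: "step n A y \<in> borel_measurable borel"
  unfolding step_def by measurable

text \<open>The open cells are disjoint, so there are no mixed terms.\<close>

lemma step_square:
  assumes n: "1 \<le> n" and A: "finite A"
  shows "(step n A y t)\<^sup>2 = (\<Sum>i\<in>A. (real n * y i)\<^sup>2 * indicator {real i * lam n<..<real (i + 1) * lam n} t)"
proof -
  let ?I = "\<lambda>i. {real i * lam n<..<real (i + 1) * lam n}"
  have unique: "i = j" if "t \<in> ?I i" "t \<in> ?I j" for i j
  proof -
    have "0 < lam n" using n by (simp add: lam_def)
    have "real i * lam n < real (j + 1) * lam n" "real j * lam n < real (i + 1) * lam n"
      using that by auto
    then have "real i < real (j + 1)" "real j < real (i + 1)"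
      using \<open>0 < lam n\<close> by (simp_all only: mult_less_cancel_right_pos)
    then show ?thesis by simp
  qed
  show ?thesis
  proof (cases "\<exists>i\<in>A. t \<in> ?I i")
    case True
    then obtain i where i: "i \<in> A" "t \<in> ?I i" by auto
    have "(\<Sum>j\<in>A. z j * indicator (?I j) t) = z i" for z :: "nat \<Rightarrow> real"
    proof -
      have "(\<Sum>j\<in>A. z j * indicator (?I j) t) = z i * indicator (?I i) t + (\<Sum>j\<in>A - {i}. z j * indicator (?I j) t)"
        using i A by (intro sum.remove) auto
      also have "(\<Sum>j\<in>A - {i}. z j * indicator (?I j) t) = 0"
        using unique[OF i(2)] by (intro sum.neutral) (auto simp: indicator_def of_bool_def)
      finally show ?thesis using i by simp
    qed
    then show ?thesis unfolding step_def by simp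
  next
    case False
    then have "(\<Sum>j\<in>A. z j * indicator (?I j) t) = 0" for z :: "nat \<Rightarrow> real"
      by (intro sum.neutral) (auto simp: indicator_def of_bool_def)
    then show ?thesis unfolding step_def by simp
  qed
qed

lemma integrable_interval_indicator:
  fixes a b c :: real
  shows "integrable lborel (\<lambda>t. c * indicator {a<..<b} t)"
  using emeasure_bounded_finite[of "{a<..<b}"]
  by (intro integrable_mult_right integrable_real_indicator) auto

lemma step_integrable: "integrable lborel (step n A y)"
  unfolding step_def by (intro Bochner_Integration.integrable_sum integrable_interval_indicator)

lemma step_square_integral:
  assumes n: "1 \<le> n" and A: "finite A"
  shows "square_integrable lborel (step n A y)"
    and "(LINT t|lborel. (step n A y t)\<^sup>2) = real n * (\<Sum>i\<in>A. (y i)\<^sup>2)"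
proof -
  show "square_integrable lborel (step n A y)"
    unfolding square_integrable_def step_square[OF assms]
    by (intro conjI Bochner_Integration.integrable_sum integrable_interval_indicator) measurable
  have "(LINT t|lborel. (step n A y t)\<^sup>2) =
      (\<Sum>i\<in>A. LINT t|lborel. (real n * y i)\<^sup>2 * indicator {real i * lam n<..<real (i + 1) * lam n} t)"
    unfolding step_square[OF assms]
    by (intro Bochner_Integration.integral_sum integrable_interval_indicator)
  also have "\<dots> = (\<Sum>i\<in>A. real n * (y i)\<^sup>2)"
  proof (intro sum.cong refl)
    fix i
    have "real i * lam n \<le> real (i + 1) * lam n" by (intro mult_right_mono) (auto simp: lam_def)
    then have "(LINT t|lborel. (real n * y i)\<^sup>2 * indicator {real i * lam n<..<real (i + 1) * lam n} t) =
        (real n * y i)\<^sup>2 * (real (i + 1) * lam n - real i * lam n)" by simp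
    also have "\<dots> = real n * (y i)\<^sup>2"
      using n by (simp add: lam_def field_simps power2_eq_square)
    finally show "(LINT t|lborel. (real n * y i)\<^sup>2 * indicator {real i * lam n<..<real (i + 1) * lam n} t) = real n * (y i)\<^sup>2" .
  qed
  finally show "(LINT t|lborel. (step n A y t)\<^sup>2) = real n * (\<Sum>i\<in>A. (y i)\<^sup>2)"
    by (simp add: sum_distrib_left)
qed

lemma step_primitive:
  assumes n: "1 \<le> n"
  shows "(LINT t|lborel. indicator {..<x} t * step n A y t) = (\<Sum>i\<in>A. y i * ramp n i x)"
proof -
  have "(LINT t|lborel. indicator {..<x} t * step n A y t) =
      (LINT t|lborel. (\<Sum>i\<in>A. real n * y i * indicator {real i * lam n<..<min x (real (i + 1) * lam n)} t))"
    unfolding step_def sum_distrib_left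
    by (intro Bochner_Integration.integral_cong refl sum.cong) (auto split: split_indicator)
  also have "\<dots> = (\<Sum>i\<in>A. (LINT t|lborel. real n * y i * indicator {real i * lam n<..<min x (real (i + 1) * lam n)} t))"
    by (intro Bochner_Integration.integral_sum integrable_interval_indicator)
  also have "\<dots> = (\<Sum>i\<in>A. y i * ramp n i x)"
  proof (intro sum.cong refl)
    fix i
    have n0: "0 < real n" using n by simp
    let ?a = "real i * lam n" and ?b = "real (i + 1) * lam n"
    have ab: "?a < ?b" using n0 by (simp add: lam_def field_simps)
    have nab: "real n * ?a = real i" "real n * ?b = real (i + 1)" using n0 by (auto simp: lam_def)
    show "(LINT t|lborel. real n * y i * indicator {?a<..<min x ?b} t) = y i * ramp n i x"
    proof (cases "?a \<le> min x ?b")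
      case True
      then have "(LINT t|lborel. real n * y i * indicator {?a<..<min x ?b} t) = y i * (real n * min x ?b - real n * ?a)"
        by (simp add: algebra_simps)
      also have "real n * min x ?b = min (real n * x) (real n * ?b)"
        using n0 by (simp add: min_mult_distrib_left)
      also have "min (real n * x) (real n * ?b) - real n * ?a = ramp n i x"
      proof -
        have "real n * ?a \<le> real n * x" using True n0 by (intro mult_left_mono) auto
        then show ?thesis unfolding nab ramp_def by (auto simp: min_def max_def)
      qed
      finally show ?thesis .
    next
      case False
      then have "x < ?a" using ab by auto
      then have "real n * x < real n * ?a" using n0 by simp
      then have "ramp n i x = 0" unfolding nab by (simp add: ramp_def)
      moreover have "{?a<..<min x ?b} = {}" using False by auto
      ultimately show ?thesis by (simp del: greaterThanLessThan_empty_iff)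
    qed
  qed
  finally show ?thesis .
qed

lemma step_support:
  assumes "A \<subseteq> {..<n}" "t \<notin> {0<..<1}"
  shows "step n A y t = 0"
  unfolding step_def
proof (intro sum.neutral ballI)
  fix i assume "i \<in> A"
  then have "i < n" using assms(1) by auto
  then have "0 \<le> real i * lam n" "real (i + 1) * lam n \<le> 1" by (auto simp: lam_def field_simps)
  then have "t \<notin> {real i * lam n<..<real (i + 1) * lam n}" using assms(2) by auto
  then show "real n * y i * indicator {real i * lam n<..<real (i + 1) * lam n} t = 0" by simp
qed

text \<open>The argument \<open>w\<close> of \<open>J (w + \<delta>)\<close> in the energy: the deviation of the \<open>i\<close>-th bond length from
  its equilibrium.\<close>

definition bond :: "nat \<Rightarrow> (real \<Rightarrow> real) \<Rightarrow> nat \<Rightarrow> real" where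
  "bond n v i = (v (real (i + 1) * lam n) - v (real i * lam n)) / sqrt (lam n)"

section \<open>Functions with finitely many jumps\<close>

text \<open>\<open>Lim\<close> is a description and needs a nontrivial filter: an interval to the
  right of \<open>x\<close> has positive measure, so discarding null sets leaves something. Ordinary
  convergence then passes to the finer filter.\<close>

lemma ess_right_lim_eq:
  assumes "(f \<longlongrightarrow> L) (at_right x)"
  shows "ess_right_lim f x = L"
  unfolding ess_right_lim_def
proof (rule tendsto_Lim)
  show "inf (at_right x) (ae_filter lborel) \<noteq> bot"
  proof
    assume "inf (at_right x) (ae_filter lborel) = bot"
    then have "\<forall>\<^sub>F z in inf (at_right x) (ae_filter lborel). False" by simp
    then obtain P R where P: "\<forall>\<^sub>F z in at_right x. P z" and R: "AE z in lborel. R z"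
      and PR: "\<And>z. P z \<Longrightarrow> R z \<Longrightarrow> False"
      unfolding eventually_inf by auto
    obtain y where y: "x < y" "\<And>z. x < z \<Longrightarrow> z < y \<Longrightarrow> P z"
      using P unfolding eventually_at_right_field by blast
    have "AE z in lborel. z \<notin> {x<..<y}" using R by eventually_elim (use y(2) PR in auto)
    then have "{x<..<y} \<in> null_sets lborel" by (subst AE_iff_null_sets) auto
    then show False using y(1) by (auto simp: null_sets_def)
  qed
  show "(f \<longlongrightarrow> L) (inf (at_right x) (ae_filter lborel))"
    using assms by (rule tendsto_mono[rotated]) simp
qed

lemma ess_left_lim_eq:
  assumes "(f \<longlongrightarrow> L) (at_left x)"
  shows "ess_left_lim f x = L"
  unfolding ess_left_lim_def
proof (rule tendsto_Lim)
  show "inf (at_left x) (ae_filter lborel) \<noteq> bot"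
  proof
    assume "inf (at_left x) (ae_filter lborel) = bot"
    then have "\<forall>\<^sub>F z in inf (at_left x) (ae_filter lborel). False" by simp
    then obtain P R where P: "\<forall>\<^sub>F z in at_left x. P z" and R: "AE z in lborel. R z"
      and PR: "\<And>z. P z \<Longrightarrow> R z \<Longrightarrow> False"
      unfolding eventually_inf by auto
    obtain y where y: "y < x" "\<And>z. y < z \<Longrightarrow> z < x \<Longrightarrow> P z"
      using P unfolding eventually_at_left_field by blast
    have "AE z in lborel. z \<notin> {y<..<x}" using R by eventually_elim (use y(2) PR in auto)
    then have "{y<..<x} \<in> null_sets lborel" by (subst AE_iff_null_sets) auto
    then show False using y(1) by (auto simp: null_sets_def)
  qed
  show "(f \<longlongrightarrow> L) (inf (at_left x) (ae_filter lborel))"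
    using assms by (rule tendsto_mono[rotated]) simp
qed

text \<open>The shape of the limit function. Positions may coincide, since several ramps can merge
  into one jump; \<open>m = 0\<close> gives plain primitives.\<close>

definition primitive_with_jumps ::
  "(real \<Rightarrow> real) \<Rightarrow> nat \<Rightarrow> (nat \<Rightarrow> real) \<Rightarrow> (nat \<Rightarrow> real) \<Rightarrow> real \<Rightarrow> real" where
  "primitive_with_jumps g m h X x =
    (LINT t|lborel. indicator {..<x} t * g t) + (\<Sum>j<m. h j * indicator {X j<..} x)"

text \<open>The integral is continuous in its upper end and cancels; of the indicators, only those
  with \<open>X j = x\<close> differ on the two sides of \<open>x\<close>.\<close>

lemma jump_primitive_with_jumps:
  assumes g: "integrable lborel g"
  shows "jump (primitive_with_jumps g m h X) x = (\<Sum>j<m. if X j = x then h j else 0)"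
proof -
  let ?A = "\<lambda>x. LINT t|lborel. indicator {..<x} t * g t"
  have cont: "isCont ?A x"
    using primitive_continuous[OF g] by (simp add: continuous_on_eq_continuous_at)
  then have A: "(?A \<longlongrightarrow> ?A x) (at_right x)" "(?A \<longlongrightarrow> ?A x) (at_left x)"
    unfolding isCont_def by (auto intro: tendsto_within_subset)
  have right: "((\<lambda>z. indicator {X j<..} z :: real) \<longlongrightarrow> indicator {X j..} x) (at_right x)" for j
  proof (rule tendsto_eventually)
    show "\<forall>\<^sub>F z in at_right x. indicator {X j<..} z = (indicator {X j..} x :: real)"
    proof (cases "X j \<le> x")
      case True
      then show ?thesis unfolding eventually_at_right_field by (intro exI[of _ "x + 1"]) auto
    next
      case False
      then show ?thesis unfolding eventually_at_right_field by (intro exI[of _ "X j"]) auto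
    qed
  qed
  have left: "((\<lambda>z. indicator {X j<..} z :: real) \<longlongrightarrow> indicator {X j<..} x) (at_left x)" for j
  proof (rule tendsto_eventually)
    show "\<forall>\<^sub>F z in at_left x. indicator {X j<..} z = (indicator {X j<..} x :: real)"
    proof (cases "X j < x")
      case True
      then show ?thesis unfolding eventually_at_left_field by (intro exI[of _ "X j"]) auto
    next
      case False
      then show ?thesis unfolding eventually_at_left_field by (intro exI[of _ "x - 1"]) auto
    qed
  qed
  have "ess_right_lim (primitive_with_jumps g m h X) x = ?A x + (\<Sum>j<m. h j * indicator {X j..} x)"
    unfolding primitive_with_jumps_def by (intro ess_right_lim_eq tendsto_intros A right)
  moreover have "ess_left_lim (primitive_with_jumps g m h X) x = ?A x + (\<Sum>j<m. h j * indicator {X j<..} x)"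
    unfolding primitive_with_jumps_def by (intro ess_left_lim_eq tendsto_intros A left)
  ultimately have "jump (primitive_with_jumps g m h X) x =
      (\<Sum>j<m. h j * indicator {X j..} x) - (\<Sum>j<m. h j * indicator {X j<..} x)"
    by (simp add: jump_def)
  also have "\<dots> = (\<Sum>j<m. if X j = x then h j else 0)"
    unfolding sum_subtractf[symmetric] by (intro sum.cong refl) (auto split: split_indicator)
  finally show ?thesis .
qed

lemma primitive_with_jumps_measurable:
  assumes g: "integrable lborel g"
  shows "primitive_with_jumps g m h X \<in> borel_measurable borel"
proof -
  have [measurable]: "(\<lambda>x. LINT t|lborel. indicator {..<x} t * g t) \<in> borel_measurable borel"
    by (rule borel_measurable_continuous_onI[OF primitive_continuous[OF g]])
  show ?thesis unfolding primitive_with_jumps_def[abs_def] by measurable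
qed

lemma primitive_abs_le:
  fixes g :: "real \<Rightarrow> real"
  assumes g: "integrable lborel g"
  shows "\<bar>LINT t|lborel. indicator A t * g t\<bar> \<le> (LINT t|lborel. \<bar>g t\<bar>)"
proof -
  have "\<bar>LINT t|lborel. indicator A t * g t\<bar> \<le> (LINT t|lborel. \<bar>indicator A t * g t\<bar>)"
    using integral_norm_bound[of lborel "\<lambda>t. indicator A t * g t"] by simp
  also have "\<dots> \<le> (LINT t|lborel. \<bar>g t\<bar>)"
    using g by (intro integral_mono') (auto split: split_indicator)
  finally show ?thesis .
qed

lemma primitive_with_jumps_bounded:
  assumes g: "integrable lborel g"
  shows "\<bar>primitive_with_jumps g m h X x\<bar> \<le> (LINT t|lborel. \<bar>g t\<bar>) + (\<Sum>j<m. \<bar>h j\<bar>)"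
proof -
  have "\<bar>\<Sum>j<m. h j * indicator {X j<..} x\<bar> \<le> (\<Sum>j<m. \<bar>h j * indicator {X j<..} x\<bar>)" by (rule sum_abs)
  also have "\<dots> \<le> (\<Sum>j<m. \<bar>h j\<bar>)" by (intro sum_mono) (auto split: split_indicator)
  finally show ?thesis
    using primitive_abs_le[OF g, of "{..<x}"] unfolding primitive_with_jumps_def by linarith
qed

lemma integrable_mult_bounded_left:
  fixes f g :: "'a \<Rightarrow> real"
  assumes "integrable M f" "g \<in> borel_measurable M" "\<And>x. \<bar>g x\<bar> \<le> B"
  shows "integrable M (\<lambda>x. g x * f x)"
  using integrable_mult_bounded[OF assms] by (simp add: mult.commute)

lemma primitive_with_jumps_by_parts:
  assumes g: "integrable lborel g" and \<phi>: "\<phi> \<in> test_functions U"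
  shows "(LINT x|lborel. primitive_with_jumps g m h X x * deriv \<phi> x) =
    - ((LINT t|lborel. g t * \<phi> t) + (\<Sum>j<m. h j * \<phi> (X j)))"
proof -
  let ?A = "\<lambda>x. LINT t|lborel. indicator {..<x} t * g t"
  note dint = test_function_integrable(2)[OF \<phi>]
  have Am: "?A \<in> borel_measurable borel"
    by (rule borel_measurable_continuous_onI[OF primitive_continuous[OF g]])
  have i1: "integrable lborel (\<lambda>x. ?A x * deriv \<phi> x)"
    by (rule integrable_mult_bounded_left[OF dint _ primitive_abs_le[OF g]]) (use Am in simp)
  have i2: "integrable lborel (\<lambda>x. indicator {X j<..} x * deriv \<phi> x)" for j
    by (rule integrable_mult_bounded_left[OF dint, where B=1]) (auto split: split_indicator)
  have "(LINT x|lborel. primitive_with_jumps g m h X x * deriv \<phi> x) =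
      (LINT x|lborel. ?A x * deriv \<phi> x + (\<Sum>j<m. h j * (indicator {X j<..} x * deriv \<phi> x)))"
    unfolding primitive_with_jumps_def by (simp only: distrib_right sum_distrib_right mult.assoc)
  also have "\<dots> = (LINT x|lborel. ?A x * deriv \<phi> x) + (\<Sum>j<m. h j * (LINT x|lborel. indicator {X j<..} x * deriv \<phi> x))"
  proof -
    have "integrable lborel (\<lambda>x. \<Sum>j<m. h j * (indicator {X j<..} x * deriv \<phi> x))"
      by (intro Bochner_Integration.integrable_sum integrable_mult_right i2)
    then show ?thesis
      using i1 i2 by (simp add: Bochner_Integration.integral_sum integrable_mult_right)
  qed
  finally show ?thesis
    by (simp add: primitive_integration_by_parts[OF g \<phi>] integral_deriv_test_function[OF \<phi>] sum_negf)
qed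

text \<open>Integration by parts yields a sum over indices, the definition asks for a sum over
  points. Grouping the indices by position matches them: off the positions the jump vanishes, and
  positions outside of \<open>{0<..<1}\<close> are invisible to \<open>\<phi>\<close>.\<close>

lemma primitive_with_jumps_has_SBV_density:
  assumes g: "integrable lborel g"
  shows "has_SBV_density (primitive_with_jumps g m h X) g"
proof -
  let ?u = "primitive_with_jumps g m h X"
  have fin: "finite {x. jump ?u x \<noteq> 0}"
  proof (rule finite_subset)
    show "{x. jump ?u x \<noteq> 0} \<subseteq> X ` {..<m}"
    proof
      fix x assume "x \<in> {x. jump ?u x \<noteq> 0}"
      then have "(\<Sum>j<m. if X j = x then h j else 0) \<noteq> 0"
        by (simp add: jump_primitive_with_jumps[OF g])
      then obtain j where "j \<in> {..<m}" "(if X j = x then h j else 0) \<noteq> 0" by (rule sum.not_neutral_contains_not_neutral)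
      then show "x \<in> X ` {..<m}" by (auto split: if_splits)
    qed
  qed simp
  show ?thesis
    unfolding has_SBV_density_def
  proof (intro conjI ballI)
    show "set_integrable lborel {0<..<1} ?u"
      unfolding set_integrable_def real_scaleR_def
    proof (rule integrable_mult_bounded[OF _ _ primitive_with_jumps_bounded[OF g]])
      show "integrable lborel (indicator {0<..<1::real} :: real \<Rightarrow> real)"
        using integrable_interval_indicator[of 1 0 1] by simp
    qed (use primitive_with_jumps_measurable[OF g] in simp)
    show "set_integrable lborel {0<..<1} g"
      using g by (intro integrable_mult_indicator[of "{0<..<1}" lborel g, folded set_integrable_def]) auto
    show "(\<lambda>x. \<bar>jump ?u x\<bar>) summable_on {0<..<1}"
      by (rule finite_nonzero_values_imp_summable_on, rule finite_subset[OF _ fin]) auto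
    fix \<phi> assume \<phi>: "\<phi> \<in> test_functions {0<..<1}"
    have \<phi>0: "\<phi> x = 0" if "x \<notin> {0<..<1}" for x
      using test_functionE[OF \<phi>] that by (metis subsetD)
    have "(\<Sum>\<^sub>\<infinity>x\<in>{0<..<1}. jump ?u x * \<phi> x) = (\<Sum>\<^sub>\<infinity>x\<in>X ` {..<m}. jump ?u x * \<phi> x)"
    proof (rule infsum_cong_neutral)
      fix x assume "x \<in> {0<..<1} - X ` {..<m}"
      then have "jump ?u x = 0" unfolding jump_primitive_with_jumps[OF g] by (intro sum.neutral) auto
      then show "jump ?u x * \<phi> x = 0" by simp
    qed (use \<phi>0 in auto)
    also have "\<dots> = (\<Sum>x\<in>X ` {..<m}. jump ?u x * \<phi> x)" by (rule infsum_finite) simp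
    also have "\<dots> = (\<Sum>x\<in>X ` {..<m}. \<Sum>j | j \<in> {..<m} \<and> X j = x. h j * \<phi> (X j))"
      unfolding jump_primitive_with_jumps[OF g]
      by (intro sum.cong refl) (simp add: sum_distrib_right sum.If_cases Int_def cong: conj_cong)
    also have "\<dots> = (\<Sum>j<m. h j * \<phi> (X j))" by (rule sum.image_gen[symmetric]) simp
    finally have jumps: "(\<Sum>\<^sub>\<infinity>x\<in>{0<..<1}. jump ?u x * \<phi> x) = (\<Sum>j<m. h j * \<phi> (X j))" .
    show "(LINT x:{0<..<1}|lborel. ?u x * deriv \<phi> x) =
        - ((LINT x:{0<..<1}|lborel. g x * \<phi> x) + (\<Sum>\<^sub>\<infinity>x\<in>{0<..<1}. jump ?u x * \<phi> x))"
      unfolding jumps test_function_set_integral[OF \<phi>]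
      by (rule primitive_with_jumps_by_parts[OF g \<phi>])
  qed
qed

text \<open>The jump sum depends on \<open>u\<close> alone and cancels, which leaves the fundamental
  lemma for \<open>g - h\<close>.\<close>

lemma has_SBV_density_unique:
  assumes g: "has_SBV_density u g" and h: "has_SBV_density u h"
  shows "AE x in lborel. x \<in> {0<..<1} \<longrightarrow> g x = h x"
proof -
  have int: "set_integrable lborel {0<..<1} g" "set_integrable lborel {0<..<1} h"
    using g h by (auto simp: has_SBV_density_def)
  have "AE x in lborel. x \<in> {0<..<1} \<longrightarrow> g x - h x = 0"
  proof (rule fundamental_lemma_calculus_of_variations)
    show "set_integrable lborel {0<..<1} (\<lambda>x. g x - h x)" using int by (rule set_integral_diff)
    fix \<phi> assume \<phi>: "\<phi> \<in> test_functions {0<..<1}"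
    have "(LINT x:{0<..<1}|lborel. g x * \<phi> x) = (LINT x:{0<..<1}|lborel. h x * \<phi> x)"
      using g h \<phi> by (force simp: has_SBV_density_def)
    then show "(LINT x:{0<..<1}|lborel. (g x - h x) * \<phi> x) = 0"
      using set_integral_diff(2)[OF set_integrable_mult_test_function[OF int(1) \<phi>]
          set_integrable_mult_test_function[OF int(2) \<phi>]] by (simp add: left_diff_distrib)
  qed simp
  then show ?thesis by eventually_elim simp
qed

text \<open>\<open>ac_density\<close> is a \<open>SOME\<close> choice, so its square integrability
  has to be inherited from \<open>g\<close> through almost everywhere uniqueness.\<close>

lemma ac_density_in_L2:
  assumes g: "has_SBV_density u g" "g \<in> L2_on {0<..<1}"
  shows "ac_density u \<in> L2_on {0<..<1}"
proof -
  let ?h = "ac_density u"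
  have h: "has_SBV_density u ?h" unfolding ac_density_def
    by (rule someI[of "has_SBV_density u", OF g(1)])
  have meas: "(\<lambda>x. indicator {0<..<1} x * ?h x) \<in> borel_measurable lborel"
    using h by (auto simp: has_SBV_density_def set_integrable_def dest: borel_measurable_integrable)
  have g': "square_integrable lborel (\<lambda>x. indicator {0<..<1} x * g x)"
    using g(2) by (simp add: L2_on_iff)
  have "integrable lborel (\<lambda>x. (indicator {0<..<1} x * ?h x)\<^sup>2)"
  proof (subst integrable_cong_AE)
    show "AE x in lborel. (indicator {0<..<1} x * ?h x)\<^sup>2 = (indicator {0<..<1} x * g x)\<^sup>2"
      using has_SBV_density_unique[OF h g(1)] by eventually_elim (auto split: split_indicator)
    show "integrable lborel (\<lambda>x. (indicator {0<..<1} x * g x)\<^sup>2)" using g' by (rule square_integrable_sq)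
  qed (use meas square_integrable_measurable[OF g'] in measurable)
  with meas show ?thesis by (simp add: L2_on_iff square_integrable_def)
qed

text \<open>One extraction per index; passing to a further subsequence keeps the earlier
  limits.\<close>

lemma common_convergent_subsequence:
  fixes z :: "nat \<Rightarrow> nat \<Rightarrow> 'a :: heine_borel"
  assumes "\<And>j. j < m \<Longrightarrow> bounded (range (\<lambda>k. z k j))"
  shows "\<exists>r l. strict_mono (r :: nat \<Rightarrow> nat) \<and> (\<forall>j<m. (\<lambda>k. z (r k) j) \<longlonglongrightarrow> l j)"
  using assms
proof (induction m)
  case 0
  then show ?case using strict_mono_id by auto
next
  case (Suc m)
  then obtain r l where r: "strict_mono (r :: nat \<Rightarrow> nat)" and l: "\<And>j. j < m \<Longrightarrow> (\<lambda>k. z (r k) j) \<longlonglongrightarrow> l j"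
    by (metis less_SucI)
  have "bounded (range (\<lambda>k. z (r k) m))"
    using Suc.prems[of m] by (rule bounded_subset) auto
  then obtain l' s where s: "strict_mono (s :: nat \<Rightarrow> nat)" and l': "((\<lambda>k. z (r k) m) \<circ> s) \<longlonglongrightarrow> l'"
    using bounded_imp_convergent_subsequence by blast
  have "(\<lambda>k. z ((r \<circ> s) k) j) \<longlonglongrightarrow> (l(m := l')) j" if "j < Suc m" for j
  proof (cases "j = m")
    case True
    then show ?thesis using l' by (simp add: o_def)
  next
    case False
    then show ?thesis using LIMSEQ_subseq_LIMSEQ[OF l[of j] s] that by (simp add: o_def)
  qed
  then show ?case using strict_mono_o[OF r s] by blast
qed

text \<open>Test functions on \<open>U\<close> vanish at the positions, which lie outside of
  \<open>U\<close>, so the jumps drop out of the integration by parts.\<close>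

lemma has_weak_deriv_L2_primitive_with_jumps:
  assumes g: "integrable lborel g" "g \<in> L2_on U" and X: "\<And>j. j < m \<Longrightarrow> X j \<notin> U"
    and f: "\<And>x. x \<in> U \<Longrightarrow> f x = primitive_with_jumps g m h X x"
  shows "has_weak_deriv_L2 U f g"
  unfolding has_weak_deriv_L2_def
proof (intro conjI ballI)
  fix \<phi> assume \<phi>: "\<phi> \<in> test_functions U"
  have "\<phi> (X j) = 0" if "j < m" for j using test_functionE[OF \<phi>] X[OF that] by (metis subsetD)
  then have "(LINT x:U|lborel. primitive_with_jumps g m h X x * deriv \<phi> x) = - (LINT x:U|lborel. g x * \<phi> x)"
    unfolding test_function_set_integral[OF \<phi>] primitive_with_jumps_by_parts[OF g(1) \<phi>] by simp
  moreover have "(LINT x:U|lborel. f x * deriv \<phi> x) =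
      (LINT x:U|lborel. primitive_with_jumps g m h X x * deriv \<phi> x)"
    unfolding set_lebesgue_integral_def using f
    by (intro Bochner_Integration.integral_cong) (auto split: split_indicator)
  ultimately show "(LINT x:U|lborel. f x * deriv \<phi> x) = - (LINT x:U|lborel. g x * \<phi> x)" by simp
qed (rule g(2))

lemma weak_deriv_L2:
  assumes "has_weak_deriv_L2 U f g"
  shows "has_weak_deriv_L2 U f (weak_deriv U f)"
  unfolding weak_deriv_def by (rule someI[of "has_weak_deriv_L2 U f", OF assms])

text \<open>Replaces the \<open>SOME\<close> choice in \<open>weak_deriv\<close> by a known
  derivative inside an inner product.\<close>

lemma weak_deriv_inner:
  assumes U: "open U" "emeasure lborel U < \<infinity>" and g: "has_weak_deriv_L2 U f g"
    and w: "w \<in> L2_on U"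
  shows "(LINT x:U|lborel. weak_deriv U f x * w x) = (LINT x|lborel. (indicator U x * g x) * (indicator U x * w x))"
  unfolding set_lebesgue_integral_def
proof (rule integral_cong_AE)
  have d: "has_weak_deriv_L2 U f (weak_deriv U f)" by (rule weak_deriv_L2[OF g])
  have m: "(\<lambda>x. indicator U x * k x) \<in> borel_measurable lborel" if "k \<in> L2_on U" for k :: "real \<Rightarrow> real"
    using that square_integrable_measurable unfolding L2_on_iff by blast
  have L: "weak_deriv U f \<in> L2_on U" "g \<in> L2_on U" using d g by (auto simp: has_weak_deriv_L2_def)
  have m': "(\<lambda>x. (indicator U x * weak_deriv U f x) * (indicator U x * w x)) \<in> borel_measurable lborel"
    "(\<lambda>x. (indicator U x * g x) * (indicator U x * w x)) \<in> borel_measurable lborel"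
    by (rule borel_measurable_times[OF m[OF L(1)] m[OF w]] borel_measurable_times[OF m[OF L(2)] m[OF w]])+
  have "(\<lambda>x. (indicator U x * weak_deriv U f x) * (indicator U x * w x)) = (\<lambda>x. indicator U x *\<^sub>R (weak_deriv U f x * w x))"
    by (auto split: split_indicator)
  with m' show "(\<lambda>x. indicator U x *\<^sub>R (weak_deriv U f x * w x)) \<in> borel_measurable lborel" by simp
  show "(\<lambda>x. (indicator U x * g x) * (indicator U x * w x)) \<in> borel_measurable lborel" by (rule m')
  show "AE x in lborel. indicator U x *\<^sub>R (weak_deriv U f x * w x) = (indicator U x * g x) * (indicator U x * w x)"
    using has_weak_deriv_L2_unique[OF U d g] by eventually_elim (auto split: split_indicator)
qed

section \<open>Compactness of chains\<close>

text \<open>The deterministic part: the potentials enter only through the three bounds on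
  deviations. The restriction to \<open>1 \<le> n\<close> avoids \<open>lam 0\<close>, which is 0 by
  the convention on division.\<close>

locale chain_sequence =
  fixes v :: "nat \<Rightarrow> real \<Rightarrow> real" and \<gamma>s :: "nat \<Rightarrow> real" and \<gamma> \<eta> K K' :: real and Q :: nat
  assumes chain: "1 \<le> n \<Longrightarrow> v n \<in> affine_chains n"
    and left_end: "1 \<le> n \<Longrightarrow> v n 0 = 0" and right_end: "1 \<le> n \<Longrightarrow> v n 1 = \<gamma>s n"
    and \<gamma>s_lim: "\<gamma>s \<longlonglongrightarrow> \<gamma>" and \<eta>_pos: "0 < \<eta>"
    and short_bonds: "1 \<le> n \<Longrightarrow> (\<Sum>i | i < n \<and> \<bar>bond n (v n) i\<bar> < \<eta>. (bond n (v n) i)\<^sup>2) \<le> K"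
    and compressed_bonds: "1 \<le> n \<Longrightarrow> (\<Sum>i | i < n \<and> bond n (v n) i \<le> - \<eta>. \<bar>bond n (v n) i\<bar>) \<le> K'"
    and long_bonds: "1 \<le> n \<Longrightarrow> card {i. i < n \<and> \<eta> \<le> bond n (v n) i} \<le> Q"
begin

abbreviation "dev n \<equiv> bond n (v n)"

definition incr :: "nat \<Rightarrow> nat \<Rightarrow> real" where
  "incr n i = v n (real (i + 1) * lam n) - v n (real i * lam n)"

text \<open>Strongly compressed bonds count as broken as well, so that every bond left in
  \<open>regular\<close> falls under the quadratic bound.\<close>

definition regular :: "nat \<Rightarrow> nat set" where "regular n = {i. i < n \<and> \<bar>dev n i\<bar> < \<eta>}"
definition broken :: "nat \<Rightarrow> nat set" where "broken n = {i. i < n \<and> \<eta> \<le> \<bar>dev n i\<bar>}"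

text \<open>The derivative of \<open>absc\<close>, which is the chain with all broken bonds
  flattened to increment zero.\<close>

definition slope :: "nat \<Rightarrow> real \<Rightarrow> real" where "slope n = step n (regular n) (incr n)"
definition absc :: "nat \<Rightarrow> real \<Rightarrow> real" where
  "absc n x = (\<Sum>i\<in>regular n. incr n i * ramp n i x)"

lemma lam_pos: "1 \<le> n \<Longrightarrow> 0 < lam n" and lam_le_1: "lam n \<le> 1"
  by (cases n; simp add: lam_def)+

lemma incr_eq: "1 \<le> n \<Longrightarrow> incr n i = sqrt (lam n) * dev n i"
  using lam_pos[of n] by (simp add: incr_def bond_def)

lemma fin_regular: "finite (regular n)" and fin_broken: "finite (broken n)"
  by (auto simp: regular_def broken_def)

lemma regular_broken: "{..<n} = regular n \<union> broken n" "regular n \<inter> broken n = {}"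
  by (auto simp: regular_def broken_def)

lemma sum_split: "(\<Sum>i<n. z i) = (\<Sum>i\<in>regular n. z i) + (\<Sum>i\<in>broken n. z i)" for z :: "nat \<Rightarrow> real"
  unfolding regular_broken(1) by (rule sum.union_disjoint[OF fin_regular fin_broken regular_broken(2)])

lemma K_nonneg: "0 \<le> K"
proof -
  have "0 \<le> (\<Sum>i | i < 1 \<and> \<bar>dev 1 i\<bar> < \<eta>. (dev 1 i)\<^sup>2)" by (intro sum_nonneg) simp
  also have "\<dots> \<le> K" by (rule short_bonds) simp
  finally show ?thesis .
qed

lemma K'_nonneg: "0 \<le> K'"
proof -
  have "0 \<le> (\<Sum>i | i < 1 \<and> dev 1 i \<le> - \<eta>. \<bar>dev 1 i\<bar>)" by (intro sum_nonneg) simp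
  also have "\<dots> \<le> K'" by (rule compressed_bonds) simp
  finally show ?thesis .
qed

lemma slope_square_integrable: "1 \<le> n \<Longrightarrow> square_integrable lborel (slope n)"
  unfolding slope_def by (rule step_square_integral(1)[OF _ fin_regular])

text \<open>The factor \<open>sqrt (lam n)\<close> between deviation and increment squares to
  \<open>1 / n\<close> and cancels the \<open>n\<close> that comes from squared slopes and cell
  lengths.\<close>

lemma slope_square_integral: "1 \<le> n \<Longrightarrow> (LINT t|lborel. (slope n t)\<^sup>2) \<le> K"
proof -
  assume n: "1 \<le> n"
  have "(LINT t|lborel. (slope n t)\<^sup>2) = real n * (\<Sum>i\<in>regular n. (incr n i)\<^sup>2)"
    unfolding slope_def by (rule step_square_integral(2)[OF n fin_regular])
  also have "\<dots> = (\<Sum>i\<in>regular n. (dev n i)\<^sup>2)"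
  proof -
    have "real n * (incr n i)\<^sup>2 = (dev n i)\<^sup>2" for i
      using n lam_pos[OF n] by (simp add: incr_eq[OF n] power_mult_distrib) (simp add: lam_def)
    then show ?thesis by (simp add: sum_distrib_left)
  qed
  also have "\<dots> \<le> K" using short_bonds[OF n] by (simp add: regular_def)
  finally show ?thesis .
qed

lemma slope_support: "t \<notin> {0<..<1} \<Longrightarrow> slope n t = 0"
  unfolding slope_def by (rule step_support) (auto simp: regular_def)

lemma slope_primitive: "1 \<le> n \<Longrightarrow> (LINT t|lborel. indicator {..<x} t * slope n t) = absc n x"
  unfolding slope_def absc_def by (rule step_primitive)

text \<open>Cauchy-Schwarz against the indicator of \<open>{x..<y}\<close>; this supplies the
  equicontinuity for Arzela-Ascoli.\<close>

lemma absc_holder: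
  assumes n: "1 \<le> n" and xy: "x \<le> y"
  shows "\<bar>absc n y - absc n x\<bar> \<le> sqrt (K * (y - x))"
proof -
  have int: "integrable lborel (\<lambda>t. indicator {..<x} t * slope n t)" for x
    using step_integrable[of n "regular n" "incr n"] unfolding slope_def[symmetric]
    by (rule integrable_mult_bounded_left[where B=1]) (auto split: split_indicator)
  have ind: "square_integrable lborel (indicator {x..<y} :: real \<Rightarrow> real)"
    using xy by (intro square_integrable_indicator) auto
  have "absc n y - absc n x = (LINT t|lborel. indicator {..<y} t * slope n t - indicator {..<x} t * slope n t)"
    using int by (simp add: slope_primitive[OF n])
  also have "\<dots> = (LINT t|lborel. slope n t * indicator {x..<y} t)"
    using xy by (intro Bochner_Integration.integral_cong refl) (auto split: split_indicator)
  finally have "(absc n y - absc n x)\<^sup>2 \<le> (LINT t|lborel. (slope n t)\<^sup>2) * (LINT t|lborel. (indicator {x..<y} t)\<^sup>2)"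
    using integral_Cauchy_Schwarz[OF slope_square_integrable[OF n] ind] by simp
  also have "(LINT t|lborel. (indicator {x..<y} t)\<^sup>2) = y - x"
    using xy by (simp add: power2_eq_square indicator_inter_arith[symmetric])
  also have "(LINT t|lborel. (slope n t)\<^sup>2) * (y - x) \<le> K * (y - x)"
    using xy by (intro mult_right_mono slope_square_integral[OF n]) simp
  finally show ?thesis by (metis real_sqrt_abs real_sqrt_le_mono)
qed

lemma absc_bounded:
  assumes n: "1 \<le> n" and x: "x \<in> {0..1}"
  shows "\<bar>absc n x\<bar> \<le> sqrt K"
proof -
  have "absc n 0 = 0" by (simp add: absc_def ramp_def)
  then have "\<bar>absc n x\<bar> \<le> sqrt (K * x)" using absc_holder[OF n, of 0 x] x by simp
  also have "\<dots> \<le> sqrt K" using x K_nonneg by (intro real_sqrt_le_mono) (simp add: mult_left_le)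
  finally show ?thesis .
qed

lemma chain_eq:
  assumes n: "1 \<le> n" and x: "x \<in> {0..1}"
  shows "v n x = absc n x + (\<Sum>i\<in>broken n. incr n i * ramp n i x)"
  using affine_chain_eq_sum_ramp[OF n chain[OF n] x] left_end[OF n]
  unfolding incr_def[symmetric] sum_split absc_def by simp

lemma chain_eq_primitive:
  assumes n: "1 \<le> n" and x: "x \<in> {0..1}"
  shows "v n x = (LINT t|lborel. indicator {..<x} t * step n {..<n} (incr n) t)"
  unfolding step_primitive[OF n]
  using affine_chain_eq_sum_ramp[OF n chain[OF n] x] left_end[OF n] by (simp add: incr_def)

text \<open>\<open>Q\<close> counts the long bonds; each compressed one uses up at least
  \<open>\<eta>\<close> of the total \<open>K'\<close>.\<close>

definition max_broken :: nat where "max_broken = Q + nat \<lceil>K' / \<eta>\<rceil>"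

lemma card_broken: "1 \<le> n \<Longrightarrow> card (broken n) \<le> max_broken"
proof -
  assume n: "1 \<le> n"
  have "\<eta> * real (card {i. i < n \<and> dev n i \<le> - \<eta>}) = (\<Sum>i | i < n \<and> dev n i \<le> - \<eta>. \<eta>)" by simp
  also have "\<dots> \<le> (\<Sum>i | i < n \<and> dev n i \<le> - \<eta>. \<bar>dev n i\<bar>)" by (intro sum_mono) auto
  also have "\<dots> \<le> K'" by (rule compressed_bonds[OF n])
  finally have "real (card {i. i < n \<and> dev n i \<le> - \<eta>}) \<le> K' / \<eta>"
    using \<eta>_pos by (simp add: field_simps)
  then have "card {i. i < n \<and> dev n i \<le> - \<eta>} \<le> nat \<lceil>K' / \<eta>\<rceil>"
    by linarith
  moreover have "broken n = {i. i < n \<and> \<eta> \<le> dev n i} \<union> {i. i < n \<and> dev n i \<le> - \<eta>}"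
    using \<eta>_pos by (auto simp: broken_def abs_if)
  then have "card (broken n) \<le> card {i. i < n \<and> \<eta> \<le> dev n i} + card {i. i < n \<and> dev n i \<le> - \<eta>}"
    by (simp add: card_Un_le)
  ultimately show "card (broken n) \<le> max_broken"
    using long_bonds[OF n] by (simp add: max_broken_def)
qed

text \<open>A compressed deviation is bounded by the whole sum \<open>K'\<close>, and the scaling by
  \<open>sqrt (lam n)\<close> makes its increment negligible. In the limit this gives nonnegative
  jump heights.\<close>

lemma incr_broken_lower:
  assumes n: "1 \<le> n" and i: "i \<in> broken n"
  shows "- (sqrt (lam n) * K') \<le> incr n i"
proof (cases "0 \<le> dev n i")
  case True
  then have "0 \<le> incr n i" using incr_eq[OF n, of i] lam_pos[OF n] by simp
  moreover have "0 \<le> sqrt (lam n) * K'" using lam_pos[OF n] K'_nonneg by simp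
  ultimately show ?thesis by linarith
next
  case False
  then have "i \<in> {i. i < n \<and> dev n i \<le> - \<eta>}" using i by (auto simp: broken_def)
  then have "\<bar>dev n i\<bar> \<le> (\<Sum>i | i < n \<and> dev n i \<le> - \<eta>. \<bar>dev n i\<bar>)" by (intro member_le_sum) auto
  also have "\<dots> \<le> K'" by (rule compressed_bonds[OF n])
  finally have "- K' \<le> dev n i" by simp
  then have "sqrt (lam n) * (- K') \<le> sqrt (lam n) * dev n i"
    using lam_pos[OF n] by (intro mult_left_mono) auto
  then show ?thesis by (simp add: incr_eq[OF n])
qed

text \<open>The upper bound comes from the right end: the increments add up to
  \<open>\<gamma>s n\<close>, the regular part is at most \<open>sqrt K\<close> in size and no other
  broken bond is below \<open>- K'\<close>, so a large increment has nothing to compensate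
  it.\<close>

lemma incr_broken_bounded:
  obtains H where "\<And>n i. 1 \<le> n \<Longrightarrow> i \<in> broken n \<Longrightarrow> \<bar>incr n i\<bar> \<le> H"
proof -
  obtain \<Gamma> where \<Gamma>: "\<And>n. \<bar>\<gamma>s n\<bar> \<le> \<Gamma>"
    using convergent_imp_Bseq[OF convergentI[OF \<gamma>s_lim]] by (auto simp: Bseq_def)
  have "\<bar>incr n i\<bar> \<le> \<Gamma> + sqrt K + real max_broken * K' + K'" if n: "1 \<le> n" and i: "i \<in> broken n" for n i
  proof -
    have low: "- K' \<le> incr n j" if "j \<in> broken n" for j
    proof -
      have "sqrt (lam n) * K' \<le> 1 * K'"
        using lam_le_1[of n] K'_nonneg by (intro mult_right_mono) auto
      then show ?thesis using incr_broken_lower[OF n that] by simp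
    qed
    have "v n 1 = absc n 1 + (\<Sum>j\<in>broken n. incr n j)"
      using chain_eq[OF n, of 1] by (simp add: ramp_at_1 broken_def)
    moreover have "(\<Sum>j\<in>broken n. incr n j) = incr n i + (\<Sum>j\<in>broken n - {i}. incr n j)"
      using i by (intro sum.remove fin_broken)
    moreover have "- (real max_broken * K') \<le> (\<Sum>j\<in>broken n - {i}. incr n j)"
    proof -
      have "real (card (broken n - {i})) \<le> real max_broken"
        using card_broken[OF n] card_Diff1_le[of "broken n" i] by simp
      then have "real (card (broken n - {i})) * K' \<le> real max_broken * K'"
        using K'_nonneg by (intro mult_right_mono)
      moreover have "real (card (broken n - {i})) * (- K') \<le> (\<Sum>j\<in>broken n - {i}. incr n j)"
        using low by (intro sum_bounded_below) auto
      ultimately show ?thesis by simp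
    qed
    ultimately have "incr n i \<le> \<Gamma> + sqrt K + real max_broken * K'"
      using absc_bounded[OF n, of 1] \<Gamma>[of n] right_end[OF n] by (simp add: abs_le_iff)
    moreover have "0 \<le> \<Gamma>" "0 \<le> sqrt K" "0 \<le> real max_broken * K'"
      using \<Gamma>[of 0] K_nonneg K'_nonneg by auto
    ultimately show ?thesis using low[OF i] K'_nonneg by linarith
  qed
  then show thesis by (rule that)
qed

text \<open>Broken bonds are numbered and padded to the fixed length \<open>max_broken\<close>, so
  that the extraction concerns finitely many sequences. The padding has site 0, a legal index for
  \<open>1 \<le> n\<close>, and height 0 in \<open>hgt\<close>.\<close>

definition site :: "nat \<Rightarrow> nat \<Rightarrow> nat" where
  "site n j = (if j < card (broken n) then sorted_list_of_set (broken n) ! j else 0)"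

definition hgt :: "nat \<Rightarrow> nat \<Rightarrow> real" where
  "hgt n j = (if j < card (broken n) then incr n (site n j) else 0)"

lemma site_bij: "bij_betw (site n) {..<card (broken n)} (broken n)"
proof -
  have "bij_betw ((!) (sorted_list_of_set (broken n))) {..<card (broken n)} (broken n)"
    using fin_broken[of n] by (intro bij_betw_nth) auto
  then show ?thesis by (subst bij_betw_cong[where g="(!) (sorted_list_of_set (broken n))"]) (auto simp: site_def)
qed

lemma site_in_broken: "j < card (broken n) \<Longrightarrow> site n j \<in> broken n"
  using bij_betwE[OF site_bij] by auto

lemma site_less: "1 \<le> n \<Longrightarrow> site n j < n"
  using site_in_broken[of j n] by (cases "j < card (broken n)") (auto simp: broken_def site_def)

lemma broken_site: "1 \<le> n \<Longrightarrow> broken n \<subseteq> site n ` {..<max_broken}"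
  using bij_betw_imp_surj_on[OF site_bij, of n] card_broken[of n]
    image_mono[of "{..<card (broken n)}" "{..<max_broken}" "site n"] by auto

lemma hgt_cases: "hgt n j = 0 \<or> (\<exists>i\<in>broken n. hgt n j = incr n i)"
  using site_in_broken by (auto simp: hgt_def)

lemma sum_broken:
  fixes z :: "nat \<Rightarrow> real"
  assumes n: "1 \<le> n"
  shows "(\<Sum>i\<in>broken n. incr n i * z i) = (\<Sum>j<max_broken. hgt n j * z (site n j))"
proof -
  have "(\<Sum>i\<in>broken n. incr n i * z i) = (\<Sum>j<card (broken n). incr n (site n j) * z (site n j))"
    by (rule sum.reindex_bij_betw[OF site_bij, symmetric])
  also have "\<dots> = (\<Sum>j<card (broken n). hgt n j * z (site n j))"
    by (intro sum.cong) (auto simp: hgt_def)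
  also have "\<dots> = (\<Sum>j<max_broken. hgt n j * z (site n j))"
    using card_broken[OF n] by (intro sum.mono_neutral_left) (auto simp: hgt_def)
  finally show ?thesis .
qed

lemma hgt_bounded:
  obtains H where "\<And>n j. 1 \<le> n \<Longrightarrow> \<bar>hgt n j\<bar> \<le> H" "0 \<le> H"
proof -
  obtain H where H: "\<And>n i. 1 \<le> n \<Longrightarrow> i \<in> broken n \<Longrightarrow> \<bar>incr n i\<bar> \<le> H"
    using incr_broken_bounded by metis
  have "\<bar>hgt n j\<bar> \<le> max H 0" if "1 \<le> n" for n j
    using hgt_cases[of n j] H[OF that] by (auto simp: le_max_iff_disj)
  then show thesis by (rule that[of "max H 0"]) auto
qed

lemma hgt_lower: "1 \<le> n \<Longrightarrow> - (sqrt (lam n) * K') \<le> hgt n j"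
  using hgt_cases[of n j] incr_broken_lower[of n] lam_pos[of n] K'_nonneg by auto

lemma chain_eq_site:
  "1 \<le> n \<Longrightarrow> x \<in> {0..1} \<Longrightarrow> v n x = absc n x + (\<Sum>j<max_broken. hgt n j * ramp n (site n j) x)"
  using chain_eq sum_broken by simp

lemma chain_bounded:
  obtains C where "\<And>n x. 1 \<le> n \<Longrightarrow> x \<in> {0..1} \<Longrightarrow> \<bar>v n x\<bar> \<le> C"
proof -
  obtain H where H: "\<And>n j. 1 \<le> n \<Longrightarrow> \<bar>hgt n j\<bar> \<le> H" "0 \<le> H" using hgt_bounded by metis
  have "\<bar>v n x\<bar> \<le> sqrt K + real max_broken * H" if n: "1 \<le> n" and x: "x \<in> {0..1}" for n x
  proof -
    have "\<bar>\<Sum>j<max_broken. hgt n j * ramp n (site n j) x\<bar> \<le> (\<Sum>j<max_broken. \<bar>hgt n j * ramp n (site n j) x\<bar>)"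
      by (rule sum_abs)
    also have "\<dots> \<le> (\<Sum>j<max_broken. H)"
    proof (intro sum_mono)
      fix j
      have "\<bar>hgt n j\<bar> * \<bar>ramp n (site n j) x\<bar> \<le> H * 1"
        using H(1)[OF n] H(2) ramp_bounds[of n "site n j" x] by (intro mult_mono) auto
      then show "\<bar>hgt n j * ramp n (site n j) x\<bar> \<le> H" by (simp add: abs_mult)
    qed
    finally show ?thesis
      using chain_eq_site[OF n x] absc_bounded[OF n x] by simp
  qed
  then show thesis by (rule that)
qed

text \<open>Positions and heights are finitely many and stay in a fixed compact box; the regular
  parts are equibounded and equicontinuous. Successive extractions give one subsequence that serves
  all.\<close>

lemma extraction:
  obtains r X h P where "strict_mono (r :: nat \<Rightarrow> nat)" "\<And>k. 1 \<le> r k"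
    "\<And>j. j < max_broken \<Longrightarrow> (\<lambda>k. real (site (r k) j) * lam (r k)) \<longlonglongrightarrow> X j"
    "\<And>j. j < max_broken \<Longrightarrow> (\<lambda>k. hgt (r k) j) \<longlonglongrightarrow> h j"
    "\<And>x. x \<in> {0..1} \<Longrightarrow> (\<lambda>k. absc (r k) x) \<longlonglongrightarrow> P x"
proof -
  obtain H where H: "\<And>n j. 1 \<le> n \<Longrightarrow> \<bar>hgt n j\<bar> \<le> H" "0 \<le> H" using hgt_bounded by metis
  define z where "z k j = (real (site (Suc k) j) * lam (Suc k), hgt (Suc k) j)" for k j
  have "bounded (range (\<lambda>k. z k j))" for j
  proof (rule bounded_subset)
    show "bounded ({0..1} \<times> {-H..H} :: (real \<times> real) set)" by (intro bounded_Times) auto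
    show "range (\<lambda>k. z k j) \<subseteq> {0..1} \<times> {-H..H}"
    proof (rule image_subsetI)
      fix k
      have "real (site (Suc k) j) \<le> real (Suc k)" using site_less[of "Suc k" j] by simp
      then have "real (site (Suc k) j) * lam (Suc k) \<le> 1" by (simp add: lam_def field_simps)
      moreover have "0 \<le> real (site (Suc k) j) * lam (Suc k)" by (simp add: lam_def)
      moreover have "\<bar>hgt (Suc k) j\<bar> \<le> H" by (rule H) simp
      ultimately show "z k j \<in> {0..1} \<times> {-H..H}" by (auto simp: z_def abs_le_iff)
    qed
  qed
  then obtain r1 l where r1: "strict_mono (r1 :: nat \<Rightarrow> nat)"
    and l: "\<And>j. j < max_broken \<Longrightarrow> (\<lambda>k. z (r1 k) j) \<longlonglongrightarrow> l j"
    using common_convergent_subsequence[of max_broken z] by blast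
  obtain P r2 where r2: "strict_mono (r2 :: nat \<Rightarrow> nat)"
    and P: "\<And>e. 0 < e \<Longrightarrow> \<exists>N. \<forall>k x. N \<le> k \<and> x \<in> {0..1} \<longrightarrow> norm (absc (Suc (r1 (r2 k))) x - P x) < e"
  proof (rule Arzela_Ascoli[of "{0..1::real}" "\<lambda>k. absc (Suc (r1 k))" "sqrt K"])
    show "compact {0..1::real}" by simp
    show "norm (absc (Suc (r1 n)) x) \<le> sqrt K" if "x \<in> {0..1}" for n x
      using absc_bounded[OF _ that] by simp
    show "\<exists>d. 0 < d \<and> (\<forall>n y. y \<in> {0..1} \<and> norm (x - y) < d \<longrightarrow> norm (absc (Suc (r1 n)) x - absc (Suc (r1 n)) y) < e)"
      if "x \<in> {0..1}" "0 < e" for x e :: real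
    \<comment> \<open>The modulus inverts the Hoelder bound; \<open>K + 1\<close> keeps the
      denominator positive when \<open>K = 0\<close>.\<close>
    proof (intro exI[of _ "e\<^sup>2 / (K + 1)"] conjI allI impI)
      show "0 < e\<^sup>2 / (K + 1)" using that K_nonneg by simp
      fix n y assume y: "y \<in> {0..1} \<and> norm (x - y) < e\<^sup>2 / (K + 1)"
      have "\<bar>absc (Suc (r1 n)) x - absc (Suc (r1 n)) y\<bar> \<le> sqrt (K * \<bar>x - y\<bar>)"
        using absc_holder[of "Suc (r1 n)" x y] absc_holder[of "Suc (r1 n)" y x]
        by (cases "x \<le> y") (auto simp: abs_minus_commute)
      also have "\<dots> < sqrt (e\<^sup>2)"
      proof (rule real_sqrt_less_mono)
        have "K * \<bar>x - y\<bar> \<le> (K + 1) * \<bar>x - y\<bar>" by (intro mult_right_mono) auto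
        also have "\<dots> < e\<^sup>2" using y K_nonneg by (simp add: field_simps)
        finally show "K * \<bar>x - y\<bar> < e\<^sup>2" .
      qed
      finally show "norm (absc (Suc (r1 n)) x - absc (Suc (r1 n)) y) < e" using that by simp
    qed
  qed blast
  define r where "r k = Suc (r1 (r2 k))" for k
  have lr: "(\<lambda>k. z (r1 (r2 k)) j) \<longlonglongrightarrow> l j" if "j < max_broken" for j
    using LIMSEQ_subseq_LIMSEQ[OF l[OF that] r2] by (simp add: o_def)
  show thesis
  proof
    show "strict_mono r" using r1 r2 by (simp add: strict_mono_def r_def)
    show "1 \<le> r k" for k by (simp add: r_def)
    show "(\<lambda>k. real (site (r k) j) * lam (r k)) \<longlonglongrightarrow> fst (l j)" if "j < max_broken" for j
      using tendsto_fst[OF lr[OF that]] by (simp add: z_def r_def)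
    show "(\<lambda>k. hgt (r k) j) \<longlonglongrightarrow> snd (l j)" if "j < max_broken" for j
      using tendsto_snd[OF lr[OF that]] by (simp add: z_def r_def)
    show "(\<lambda>k. absc (r k) x) \<longlonglongrightarrow> P x" if "x \<in> {0..1}" for x
      unfolding LIMSEQ_iff r_def using P that by meson
  qed
qed

end

section \<open>The limit function and the modes of convergence\<close>

lemma lam_tendsto_0: "lam \<longlonglongrightarrow> 0"
  unfolding lam_def[abs_def] by (rule lim_1_over_n)

lemma bounded_in_L2:
  fixes f :: "real \<Rightarrow> real"
  assumes U: "open U" "bounded U" and m: "(\<lambda>x. indicator U x * f x) \<in> borel_measurable borel"
    and b: "\<And>x. x \<in> U \<Longrightarrow> \<bar>f x\<bar> \<le> C"
  shows "f \<in> L2_on U"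
  unfolding L2_on_iff square_integrable_def
proof
  show "(\<lambda>x. indicator U x * f x) \<in> borel_measurable lborel" using m by simp
  show "integrable lborel (\<lambda>x. (indicator U x * f x)\<^sup>2)"
  proof (rule Bochner_Integration.integrable_bound)
    show "integrable lborel (\<lambda>x. C\<^sup>2 * indicator U x)"
      using U emeasure_bounded_finite[OF U(2)]
      by (intro integrable_mult_right integrable_real_indicator) auto
    show "(\<lambda>x. (indicator U x * f x)\<^sup>2) \<in> borel_measurable lborel" using m by simp
    have "(f x)\<^sup>2 \<le> C\<^sup>2" if "x \<in> U" for x
      using b[OF that] by (intro abs_le_square_iff[THEN iffD1]) simp
    then show "AE x in lborel. norm ((indicator U x * f x)\<^sup>2) \<le> norm (C\<^sup>2 * indicator U x)"
      by (auto split: split_indicator)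
  qed
qed

text \<open>Collects the limits along the subsequence \<open>r\<close>: \<open>P\<close> for the
  regular parts, and \<open>g\<close>, whose primitive is \<open>P\<close>, as the weak limit of
  their slopes.\<close>

locale chain_limit = chain_sequence +
  fixes r :: "nat \<Rightarrow> nat" and X h P :: "_ \<Rightarrow> real" and g :: "real \<Rightarrow> real"
  assumes r: "strict_mono r" and r_ge_1: "1 \<le> r k"
    and X_lim: "j < max_broken \<Longrightarrow> (\<lambda>k. real (site (r k) j) * lam (r k)) \<longlonglongrightarrow> X j"
    and h_lim: "j < max_broken \<Longrightarrow> (\<lambda>k. hgt (r k) j) \<longlonglongrightarrow> h j"
    and absc_lim: "x \<in> {0..1} \<Longrightarrow> (\<lambda>k. absc (r k) x) \<longlonglongrightarrow> P x"
    and g_sq: "square_integrable lborel g" and g_supp: "t \<notin> {0<..<1} \<Longrightarrow> g t = 0"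
    and g_prim: "x \<in> {0..1} \<Longrightarrow> (LINT t|lborel. indicator {..<x} t * g t) = P x"
    and slope_lim: "square_integrable lborel \<phi> \<Longrightarrow>
      (\<lambda>k. LINT t|lborel. slope (r k) t * \<phi> t) \<longlonglongrightarrow> (LINT t|lborel. g t * \<phi> t)"
begin

definition u :: "real \<Rightarrow> real" where "u = primitive_with_jumps g max_broken h X"

lemma lam_r: "(\<lambda>k. lam (r k)) \<longlonglongrightarrow> 0"
  using LIMSEQ_subseq_LIMSEQ[OF lam_tendsto_0 r] by (simp add: o_def)

lemma g_integrable: "integrable lborel g"
proof -
  have eq: "(\<lambda>x. indicator {0<..<1} x * g x) = g" using g_supp by (auto split: split_indicator)
  have "set_integrable lborel {0<..<1} g"
    by (rule square_integrable_imp_set_integrable) (auto simp: eq g_sq)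
  then show ?thesis by (simp add: set_integrable_def eq)
qed

lemma g_L2: "g \<in> L2_on U" if "U \<in> sets borel"
  unfolding L2_on_iff by (rule square_integrable_bounded_mult[OF g_sq]) (use that in \<open>auto split: split_indicator\<close>)

lemma X_range: "j < max_broken \<Longrightarrow> X j \<in> {0..1}"
proof -
  assume j: "j < max_broken"
  have "real (site (r k) j) * lam (r k) \<in> {0..1}" for k
  proof -
    have "real (site (r k) j) \<le> real (r k)" using site_less[OF r_ge_1, of k j] by simp
    then show ?thesis using r_ge_1[of k] by (simp add: lam_def field_simps)
  qed
  then show ?thesis
    by (intro closed_sequentially[OF _ _ X_lim[OF j]]) auto
qed

lemma h_nonneg: "j < max_broken \<Longrightarrow> 0 \<le> h j"
proof -
  assume j: "j < max_broken"
  have "(\<lambda>k. - (sqrt (lam (r k)) * K')) \<longlonglongrightarrow> - (sqrt 0 * K')"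
    by (intro tendsto_intros lam_r)
  then show ?thesis
    using LIMSEQ_le[OF _ h_lim[OF j], of "\<lambda>k. - (sqrt (lam (r k)) * K')" 0] hgt_lower[OF r_ge_1] by auto
qed

text \<open>The ramp has width \<open>lam (r k)\<close>, which tends to 0, so away from
  \<open>X j\<close> its value is eventually exactly 0 or 1.\<close>

lemma ramp_lim:
  assumes j: "j < max_broken" and x: "x \<noteq> X j"
  shows "(\<lambda>k. ramp (r k) (site (r k) j) x) \<longlonglongrightarrow> indicator {X j<..} x"
proof (rule tendsto_eventually)
  have n_lam: "real (r k) * lam (r k) = 1" for k using r_ge_1[of k] by (simp add: lam_def)
  have ramp: "ramp (r k) (site (r k) j) x = max 0 (min 1 (real (r k) * (x - real (site (r k) j) * lam (r k))))" for k
    using n_lam[of k] by (simp add: ramp_def right_diff_distrib mult.left_commute[of "real (r k)"])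
  show "\<forall>\<^sub>F k in sequentially. ramp (r k) (site (r k) j) x = indicator {X j<..} x"
  proof (cases "X j < x")
    case True
    \<comment> \<open>Eventually the cell starts left of \<open>x - e\<close> and is shorter than
      \<open>e\<close>, hence ends before \<open>x\<close>.\<close>
    define e where "e = (x - X j) / 2"
    have e: "0 < e" "X j < x - e" using True by (auto simp: e_def field_simps)
    show ?thesis
      using order_tendstoD(2)[OF X_lim[OF j] e(2)] order_tendstoD(2)[OF lam_r e(1)]
    proof eventually_elim
      case (elim k)
      have "real (r k) * lam (r k) \<le> real (r k) * (x - real (site (r k) j) * lam (r k))"
        using elim by (intro mult_left_mono) auto
      then show ?case using True unfolding ramp n_lam by simp
    qed
  next
    case False
    then have "x < X j" using x by simp
    from order_tendstoD(1)[OF X_lim[OF j] this] show ?thesis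
    proof eventually_elim
      case (elim k)
      have "real (r k) * (x - real (site (r k) j) * lam (r k)) \<le> 0"
        using elim by (intro mult_nonneg_nonpos) auto
      then show ?case using False unfolding ramp by simp
    qed
  qed
qed

lemma pointwise_lim:
  assumes x: "x \<in> {0..1}" "x \<notin> X ` {..<max_broken}"
  shows "(\<lambda>k. v (r k) x) \<longlonglongrightarrow> u x"
proof -
  have "(\<lambda>k. absc (r k) x + (\<Sum>j<max_broken. hgt (r k) j * ramp (r k) (site (r k) j) x))
      \<longlonglongrightarrow> P x + (\<Sum>j<max_broken. h j * indicator {X j<..} x)"
    using x by (intro tendsto_intros absc_lim h_lim ramp_lim) auto
  then show ?thesis
    by (simp add: chain_eq_site[OF r_ge_1 x(1)] u_def primitive_with_jumps_def g_prim[OF x(1)])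
qed

text \<open>At the end point 1 every ramp has reached 1, even if its limit position is 1. A jump at
  the right end is thus counted in \<open>\<gamma>\<close>, although \<open>pointwise_lim\<close>
  says nothing at the positions.\<close>

lemma \<gamma>_eq: "\<gamma> = P 1 + (\<Sum>j<max_broken. h j)"
proof (rule LIMSEQ_unique)
  show "(\<lambda>k. \<gamma>s (r k)) \<longlonglongrightarrow> \<gamma>"
    using LIMSEQ_subseq_LIMSEQ[OF \<gamma>s_lim r] by (simp add: o_def)
  have "\<gamma>s (r k) = absc (r k) 1 + (\<Sum>j<max_broken. hgt (r k) j)" for k
    using chain_eq_site[OF r_ge_1, of 1 k] right_end[OF r_ge_1, of k] site_less[OF r_ge_1]
    by (simp add: ramp_at_1)
  moreover have "(\<lambda>k. absc (r k) 1 + (\<Sum>j<max_broken. hgt (r k) j)) \<longlonglongrightarrow> P 1 + (\<Sum>j<max_broken. h j)"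
    by (intro tendsto_intros absc_lim h_lim) auto
  ultimately show "(\<lambda>k. \<gamma>s (r k)) \<longlonglongrightarrow> P 1 + (\<Sum>j<max_broken. h j)" by simp
qed

lemma u_SBV: "u \<in> SBV \<gamma>"
  unfolding SBV_def
proof (intro CollectI conjI allI impI)
  show "\<exists>g. has_SBV_density u g"
    using primitive_with_jumps_has_SBV_density[OF g_integrable] unfolding u_def by blast
  show "u x = 0" if "x < 0" for x
  proof -
    have zero: "indicator {..<x} t * g t = 0" for t
      using that g_supp[of t] by (auto split: split_indicator)
    have "(LINT t|lborel. indicator {..<x} t * g t) = 0" unfolding zero by simp
    moreover have "(\<Sum>j<max_broken. h j * indicator {X j<..} x) = 0"
    proof (intro sum.neutral ballI)
      fix j assume "j \<in> {..<max_broken}"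
      then have "0 \<le> X j" using X_range by auto
      then show "h j * indicator {X j<..} x = 0" using that by simp
    qed
    ultimately show ?thesis by (simp add: u_def primitive_with_jumps_def)
  qed
  show "u x = \<gamma>" if "1 < x" for x
  proof -
    have eq: "indicator {..<x} t * g t = indicator {..<1} t * g t" for t
      using that g_supp[of t] by (auto split: split_indicator)
    have "(LINT t|lborel. indicator {..<x} t * g t) = (LINT t|lborel. indicator {..<1} t * g t)"
      unfolding eq ..
    moreover have "(\<Sum>j<max_broken. h j * indicator {X j<..} x) = (\<Sum>j<max_broken. h j)"
    proof (intro sum.cong refl)
      fix j assume "j \<in> {..<max_broken}"
      then have "X j \<le> 1" using X_range by auto
      then show "h j * indicator {X j<..} x = h j" using that by simp
    qed
    ultimately show ?thesis by (simp add: u_def primitive_with_jumps_def g_prim \<gamma>_eq)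
  qed
qed

lemma u_measurable: "u \<in> borel_measurable borel"
  unfolding u_def by (rule primitive_with_jumps_measurable[OF g_integrable])

lemma u_bounded: obtains B where "\<And>x. \<bar>u x\<bar> \<le> B"
  using that primitive_with_jumps_bounded[OF g_integrable] unfolding u_def by blast

lemma v_measurable:
  assumes n: "1 \<le> n" and U: "U \<in> sets borel" "U \<subseteq> {0..1}"
  shows "(\<lambda>x. indicator U x * v n x) \<in> borel_measurable borel"
proof -
  have "continuous_on {0..1} (v n)" using chain[OF n] by (simp add: affine_chains_def)
  then have "(\<lambda>x. indicator {0..1} x *\<^sub>R v n x) \<in> borel_measurable borel"
    using borel_integrable_compact[of "{0..1::real}" "v n"] by (auto dest: borel_measurable_integrable)
  then have "(\<lambda>x. indicator U x * (indicator {0..1} x *\<^sub>R v n x)) \<in> borel_measurable borel"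
    using U(1) by (intro borel_measurable_times borel_measurable_indicator)
  moreover have "(\<lambda>x. indicator U x * (indicator {0..1} x *\<^sub>R v n x)) = (\<lambda>x. indicator U x * v n x)"
    using U(2) by (auto simp: fun_eq_iff subset_iff split: split_indicator)
  ultimately show ?thesis by simp
qed

text \<open>Chains and limit are uniformly bounded, and the chains converge off the finite set of
  positions. The weight \<open>w\<close> serves two uses: the constant 1 for L1 convergence, a
  member of H1 for the zero order part of the inner product.\<close>

lemma dominated_lim:
  assumes U: "U \<in> sets borel" "U \<subseteq> {0<..<1}" and w: "set_integrable lborel U w"
  shows "(\<lambda>k. LINT x:U|lborel. \<bar>v (r k) x - u x\<bar> * w x) \<longlonglongrightarrow> 0"
    and "(\<lambda>k. LINT x:U|lborel. v (r k) x * w x) \<longlonglongrightarrow> (LINT x:U|lborel. u x * w x)"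
proof -
  obtain C where C: "\<And>n x. 1 \<le> n \<Longrightarrow> x \<in> {0..1} \<Longrightarrow> \<bar>v n x\<bar> \<le> C" using chain_bounded by metis
  obtain B where B: "\<And>x. \<bar>u x\<bar> \<le> B" using u_bounded by metis
  have U01: "U \<subseteq> {0..1}" using U(2) by (auto simp: subset_iff)
  let ?w = "\<lambda>x. indicator U x * w x"
  have w': "integrable lborel ?w" using w by (simp add: set_integrable_def)
  note wm = borel_measurable_integrable[OF w']
  have vm: "(\<lambda>x. indicator U x * v (r k) x) \<in> borel_measurable borel" for k
    by (rule v_measurable[OF r_ge_1 U(1) U01])
  have um: "(\<lambda>x. indicator U x * u x) \<in> borel_measurable borel"
    using U(1) by (intro borel_measurable_times borel_measurable_indicator u_measurable)
  have dom: "integrable lborel (\<lambda>x. (C + B) * \<bar>?w x\<bar>)" using w' by simp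
  have lim: "AE x in lborel. x \<in> U \<longrightarrow> (\<lambda>k. v (r k) x) \<longlonglongrightarrow> u x"
  proof -
    have "X ` {..<max_broken} \<in> null_sets lborel" by (rule finite_imp_null_set_lborel) simp
    from AE_not_in[OF this] show ?thesis
      by eventually_elim (use U01 pointwise_lim in auto)
  qed
  have B0: "0 \<le> B" using B[of 0] by linarith
  have C0: "0 \<le> C" using C[of 1 0] by fastforce
  have "(\<lambda>k. LINT x|lborel. \<bar>indicator U x * v (r k) x - indicator U x * u x\<bar> * ?w x) \<longlonglongrightarrow> (LINT x::real|lborel. (0::real))"
  proof (rule integral_dominated_convergence[where w="\<lambda>x. (C + B) * \<bar>?w x\<bar>"])
    show "integrable lborel (\<lambda>x. (C + B) * \<bar>?w x\<bar>)" by (rule dom)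
    show "AE x in lborel. (\<lambda>k. \<bar>indicator U x * v (r k) x - indicator U x * u x\<bar> * ?w x) \<longlonglongrightarrow> 0"
      using lim
    proof eventually_elim
      case (elim x)
      show ?case
      proof (cases "x \<in> U")
        case True
        with elim have "(\<lambda>k. v (r k) x) \<longlonglongrightarrow> u x" by simp
        from tendsto_mult_right[OF tendsto_rabs[OF tendsto_diff[OF this tendsto_const[of "u x"]]], of "w x"]
        show ?thesis using True by simp
      qed simp
    qed
    show "(\<lambda>x. \<bar>indicator U x * v (r k) x - indicator U x * u x\<bar> * ?w x) \<in> borel_measurable lborel" for k
      using vm[of k] um wm by simp
    show "AE x in lborel. norm (\<bar>indicator U x * v (r k) x - indicator U x * u x\<bar> * ?w x) \<le> (C + B) * \<bar>?w x\<bar>" for k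
    proof (intro AE_I2)
      fix x
      show "norm (\<bar>indicator U x * v (r k) x - indicator U x * u x\<bar> * ?w x) \<le> (C + B) * \<bar>?w x\<bar>"
      proof (cases "x \<in> U")
        case True
        then have "\<bar>v (r k) x - u x\<bar> \<le> C + B"
          using C[OF r_ge_1, of x k] B[of x] U01 by (auto simp: subset_iff abs_le_iff)
        then show ?thesis using True by (simp add: abs_mult mult_right_mono)
      qed simp
    qed
  qed simp
  moreover have "\<bar>indicator U x * v (r k) x - indicator U x * u x\<bar> * ?w x = indicator U x *\<^sub>R (\<bar>v (r k) x - u x\<bar> * w x)" for k x
    by (auto split: split_indicator)
  ultimately show "(\<lambda>k. LINT x:U|lborel. \<bar>v (r k) x - u x\<bar> * w x) \<longlonglongrightarrow> 0"
    by (simp add: set_lebesgue_integral_def)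
  have "(\<lambda>k. LINT x|lborel. indicator U x * v (r k) x * ?w x) \<longlonglongrightarrow> (LINT x|lborel. indicator U x * u x * ?w x)"
  proof (rule integral_dominated_convergence[where w="\<lambda>x. (C + B) * \<bar>?w x\<bar>"])
    show "integrable lborel (\<lambda>x. (C + B) * \<bar>?w x\<bar>)" by (rule dom)
    show "AE x in lborel. (\<lambda>k. indicator U x * v (r k) x * ?w x) \<longlonglongrightarrow> indicator U x * u x * ?w x"
      using lim
    proof eventually_elim
      case (elim x)
      then show ?case by (cases "x \<in> U") (auto intro: tendsto_mult_right)
    qed
    show "(\<lambda>x. indicator U x * v (r k) x * ?w x) \<in> borel_measurable lborel" for k
      using vm[of k] wm by simp
    show "AE x in lborel. norm (indicator U x * v (r k) x * ?w x) \<le> (C + B) * \<bar>?w x\<bar>" for k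
    proof (intro AE_I2)
      fix x
      show "norm (indicator U x * v (r k) x * ?w x) \<le> (C + B) * \<bar>?w x\<bar>"
      proof (cases "x \<in> U")
        case True
        then have "\<bar>v (r k) x\<bar> \<le> C + B"
          using C[OF r_ge_1, of x k] B0 U01 by (auto simp: subset_iff)
        then show ?thesis using True by (simp add: abs_mult mult_right_mono)
      qed simp
    qed
    show "(\<lambda>x. indicator U x * u x * ?w x) \<in> borel_measurable lborel"
      using um wm by simp
  qed
  moreover have "indicator U x * f x * ?w x = indicator U x *\<^sub>R (f x * w x)" for f :: "real \<Rightarrow> real" and x
    by (auto split: split_indicator)
  ultimately show "(\<lambda>k. LINT x:U|lborel. v (r k) x * w x) \<longlonglongrightarrow> (LINT x:U|lborel. u x * w x)"
    by (simp add: set_lebesgue_integral_def)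
qed

lemma converges_L1_u: "converges_L1 {0<..<1} (\<lambda>k. v (r k)) u"
  unfolding converges_L1_def
proof (intro conjI allI)
  show "set_integrable lborel {0<..<1} (v (r k))" for k
  proof (rule set_integrable_subset)
    have "continuous_on {0..1} (v (r k))" using chain[OF r_ge_1] by (simp add: affine_chains_def)
    then show "set_integrable lborel {0..1} (v (r k))"
      unfolding set_integrable_def by (intro borel_integrable_compact) auto
  qed auto
  show "set_integrable lborel {0<..<1} u"
    using primitive_with_jumps_has_SBV_density[OF g_integrable] by (simp add: has_SBV_density_def u_def)
  have "set_integrable lborel {0<..<1::real} (\<lambda>x. 1::real)"
    using integrable_interval_indicator[of 1 0 1] by (simp add: set_integrable_def)
  from dominated_lim(1)[OF _ _ this]
  show "(\<lambda>k. LINT x:{0<..<1}|lborel. \<bar>v (r k) x - u x\<bar>) \<longlonglongrightarrow> 0" by simp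
qed

text \<open>The limit positions keep a distance from \<open>closure U\<close> and the cells shrink;
  as there are finitely many sites, one index works for all of them.\<close>

lemma broken_bonds_leave:
  assumes U: "X ` {..<max_broken} \<inter> closure U = {}"
  shows "\<forall>\<^sub>F k in sequentially. \<forall>i\<in>broken (r k).
    {real i * lam (r k)<..<real (i + 1) * lam (r k)} \<inter> U = {}"
proof -
  have "\<forall>\<^sub>F k in sequentially. {real (site (r k) j) * lam (r k)<..<real (site (r k) j + 1) * lam (r k)} \<inter> U = {}"
    if j: "j < max_broken" for j
  proof -
    have "X j \<in> - closure U" using U j by auto
    then obtain e where e: "0 < e" "ball (X j) e \<subseteq> - closure U"
      using open_contains_ball[of "- closure U"] by (auto simp: open_Compl)
    have e': "X j - e < X j" "X j < X j + e / 2" "0 < e / 2" using e(1) by auto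
    show ?thesis
      using order_tendstoD(1)[OF X_lim[OF j] e'(1)] order_tendstoD(2)[OF X_lim[OF j] e'(2)]
        order_tendstoD(2)[OF lam_r e'(3)]
    proof eventually_elim
      case (elim k)
      have "{real (site (r k) j) * lam (r k)<..<real (site (r k) j + 1) * lam (r k)} \<subseteq> ball (X j) e"
      proof
        fix t assume "t \<in> {real (site (r k) j) * lam (r k)<..<real (site (r k) j + 1) * lam (r k)}"
        then have "real (site (r k) j) * lam (r k) < t" "t < real (site (r k) j) * lam (r k) + lam (r k)"
          by (auto simp: algebra_simps)
        then have "X j - e < t" "t < X j + e" using elim by linarith+
        then show "t \<in> ball (X j) e" by (simp add: dist_real_def abs_less_iff)
      qed
      then show ?case using e(2) closure_subset[of U] by blast
    qed
  qed
  then have "\<forall>\<^sub>F k in sequentially. \<forall>j\<in>{..<max_broken}.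
      {real (site (r k) j) * lam (r k)<..<real (site (r k) j + 1) * lam (r k)} \<inter> U = {}"
    by (intro eventually_ball_finite) auto
  then show ?thesis
  proof eventually_elim
    case (elim k)
    show ?case using elim broken_site[OF r_ge_1, of k] by (auto 0 3 simp: image_iff subset_iff)
  qed
qed

text \<open>Once the broken cells have left \<open>U\<close>, the weak derivative of the chain on
  \<open>U\<close> is \<open>slope\<close>, whose weak convergence to \<open>g\<close> is
  known.\<close>

lemma locally_weakly_converges_u:
  "locally_weakly_converges_H1 ({0<..<1} - X ` {..<max_broken}) (\<lambda>k. v (r k)) u"
  unfolding locally_weakly_converges_H1_def
proof (intro allI impI)
  fix U :: "real set"
  assume "open U \<and> compact (closure U) \<and> closure U \<subseteq> {0<..<1} - X ` {..<max_broken}"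
  then have U: "open U" and cl: "closure U \<subseteq> {0<..<1}" "X ` {..<max_broken} \<inter> closure U = {}"
    and comp: "compact (closure U)" by auto
  have bU: "bounded U" using comp compact_imp_bounded bounded_subset closure_subset by metis
  have fU: "emeasure lborel U < \<infinity>" by (rule emeasure_bounded_finite[OF bU])
  have U01: "U \<subseteq> {0<..<1}" using cl(1) closure_subset by blast
  then have U01': "U \<subseteq> {0..1}" by auto
  have XU: "X j \<notin> U" if "j < max_broken" for j
    using cl(2) closure_subset[of U] that by auto
  have Us: "U \<in> sets borel" using U by simp
  let ?F = "\<lambda>n. step n {..<n} (incr n)"
  have F_L2: "?F n \<in> L2_on U" if "1 \<le> n" for n
    unfolding L2_on_iff
    by (rule square_integrable_bounded_mult[OF step_square_integral(1)[OF that]])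
      (use Us in \<open>auto split: split_indicator\<close>)
  \<comment> \<open>For fixed \<open>n\<close> the chain is a primitive without jumps, broken bonds
    included, so it lies in \<open>H1 U\<close> for every index and not only eventually.\<close>
  have vF: "has_weak_deriv_L2 U (v n) (?F n)" if n: "1 \<le> n" for n
  proof (rule has_weak_deriv_L2_primitive_with_jumps[where m=0])
    show "v n x = primitive_with_jumps (?F n) 0 h X x" if "x \<in> U" for x
      using chain_eq_primitive[OF n, of x] U01' that by (auto simp: primitive_with_jumps_def)
  qed (use step_integrable F_L2[OF n] in auto)
  have ug: "has_weak_deriv_L2 U u g"
    by (rule has_weak_deriv_L2_primitive_with_jumps[OF g_integrable g_L2[OF Us] XU]) (auto simp: u_def)
  show "weakly_converges_H1 U (\<lambda>k. v (r k)) u"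
    unfolding weakly_converges_H1_def
  proof (intro conjI allI ballI)
    obtain C where C: "\<And>n x. 1 \<le> n \<Longrightarrow> x \<in> {0..1} \<Longrightarrow> \<bar>v n x\<bar> \<le> C" using chain_bounded by metis
    obtain B where B: "\<And>x. \<bar>u x\<bar> \<le> B" using u_bounded by metis
    have "v (r k) \<in> L2_on U" for k
      by (rule bounded_in_L2[where C=C, OF U bU v_measurable[OF r_ge_1 Us U01']]) (use C[OF r_ge_1] U01' in auto)
    then show "v (r k) \<in> H1 U" for k using vF[OF r_ge_1] by (auto simp: H1_def)
    have "u \<in> L2_on U"
      by (rule bounded_in_L2[where C=B, OF U bU]) (use B u_measurable Us in auto)
    then show "u \<in> H1 U" using ug by (auto simp: H1_def)
    fix w assume w: "w \<in> H1 U"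
    then obtain dw where "has_weak_deriv_L2 U w dw" by (auto simp: H1_def)
    from weak_deriv_L2[OF this] have dw: "weak_deriv U w \<in> L2_on U"
      by (simp add: has_weak_deriv_L2_def)
    have wL2: "square_integrable lborel (\<lambda>x. indicator U x * w x)" using w by (simp add: H1_def L2_on_iff)
    let ?w' = "\<lambda>x. indicator U x * weak_deriv U w x"
    have w': "square_integrable lborel ?w'" using dw by (simp add: L2_on_iff)
    have zero_order: "(\<lambda>k. LINT x:U|lborel. v (r k) x * w x) \<longlonglongrightarrow> (LINT x:U|lborel. u x * w x)"
      by (rule dominated_lim(2)[OF Us U01 square_integrable_imp_set_integrable[OF wL2 _ fU]]) (use Us in simp)
    have "(\<lambda>k. LINT x:U|lborel. weak_deriv U (v (r k)) x * weak_deriv U w x)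
        \<longlonglongrightarrow> (LINT x:U|lborel. weak_deriv U u x * weak_deriv U w x)"
    proof (rule Lim_transform_eventually)
      have "(LINT t|lborel. g t * ?w' t) = (LINT x:U|lborel. weak_deriv U u x * weak_deriv U w x)"
        unfolding weak_deriv_inner[OF U fU ug dw]
        by (intro Bochner_Integration.integral_cong) (auto split: split_indicator)
      then show "(\<lambda>k. LINT t|lborel. slope (r k) t * ?w' t) \<longlonglongrightarrow> (LINT x:U|lborel. weak_deriv U u x * weak_deriv U w x)"
        using slope_lim[OF w'] by simp
      show "\<forall>\<^sub>F k in sequentially. (LINT t|lborel. slope (r k) t * ?w' t) =
          (LINT x:U|lborel. weak_deriv U (v (r k)) x * weak_deriv U w x)"
        using broken_bonds_leave[OF cl(2)]
      proof eventually_elim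
        case (elim k)
        have "?F (r k) t = slope (r k) t" if "t \<in> U" for t
        proof -
          have "?F (r k) t = slope (r k) t + step (r k) (broken (r k)) (incr (r k)) t"
            unfolding slope_def step_def sum_split ..
          also have "step (r k) (broken (r k)) (incr (r k)) t = 0"
            unfolding step_def
          proof (intro sum.neutral ballI)
            fix i assume "i \<in> broken (r k)"
            then have "t \<notin> {real i * lam (r k)<..<real (i + 1) * lam (r k)}" using elim that by blast
            then show "real (r k) * incr (r k) i * indicator {real i * lam (r k)<..<real (i + 1) * lam (r k)} t = 0"
              by (subst indicator_simps(2)) simp_all
          qed
          finally show ?thesis by simp
        qed
        then show ?case
          unfolding weak_deriv_inner[OF U fU vF[OF r_ge_1] dw]
          by (intro Bochner_Integration.integral_cong) (auto split: split_indicator)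
      qed
    qed
    from tendsto_add[OF zero_order this]
    show "(\<lambda>k. H1_inner U (v (r k)) w) \<longlonglongrightarrow> H1_inner U u w" by (simp add: H1_inner_def)
  qed
qed

lemma jump_u: "jump u x = (\<Sum>j<max_broken. if X j = x then h j else 0)"
  unfolding u_def by (rule jump_primitive_with_jumps[OF g_integrable])

lemma jump_u_nonneg: "0 \<le> jump u x"
  unfolding jump_u using h_nonneg by (intro sum_nonneg) auto

lemma finite_jump_set_u: "finite (jump_set u)"
proof (rule finite_subset)
  show "jump_set u \<subseteq> X ` {..<max_broken}"
  proof
    fix x assume "x \<in> jump_set u"
    then have "(\<Sum>j<max_broken. if X j = x then h j else 0) \<noteq> 0" by (simp add: jump_set_def jump_u)
    then obtain j where "j \<in> {..<max_broken}" "(if X j = x then h j else 0) \<noteq> 0"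
      by (rule sum.not_neutral_contains_not_neutral)
    then show "x \<in> X ` {..<max_broken}" by (auto split: if_splits)
  qed
qed simp

lemma ac_density_u: "ac_density u \<in> L2_on {0<..<1}"
  unfolding u_def
  by (rule ac_density_in_L2[OF primitive_with_jumps_has_SBV_density[OF g_integrable] g_L2]) simp

end

theorem (in chain_sequence) compactness:
  "\<exists>r u. strict_mono r \<and> (\<forall>k. 1 \<le> r k) \<and> u \<in> SBV \<gamma> \<and>
      converges_L1 {0<..<1} (\<lambda>k. v (r k)) u \<and>
      ac_density u \<in> L2_on {0<..<1} \<and>
      finite (jump_set u) \<and>
      (\<forall>x\<in>{0..1}. jump u x \<ge> 0) \<and>
      (\<exists>S. finite S \<and> S \<subseteq> {0..1} \<and>
           locally_weakly_converges_H1 ({0<..<1} - S) (\<lambda>k. v (r k)) u)"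
proof -
  obtain r X h P where r: "strict_mono (r :: nat \<Rightarrow> nat)" and r1: "\<And>k. 1 \<le> r k"
    and X: "\<And>j. j < max_broken \<Longrightarrow> (\<lambda>k. real (site (r k) j) * lam (r k)) \<longlonglongrightarrow> X j"
    and h: "\<And>j. j < max_broken \<Longrightarrow> (\<lambda>k. hgt (r k) j) \<longlonglongrightarrow> h j"
    and P: "\<And>x. x \<in> {0..1} \<Longrightarrow> (\<lambda>k. absc (r k) x) \<longlonglongrightarrow> P x"
    by (rule extraction) blast
  obtain g where "square_integrable lborel g" "\<And>t. t \<notin> {0<..<1} \<Longrightarrow> g t = 0"
    "\<And>x. x \<in> {0..1} \<Longrightarrow> (LINT t|lborel. indicator {..<x} t * g t) = P x"
    "\<And>\<phi>. square_integrable lborel \<phi> \<Longrightarrow>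
      (\<lambda>k. LINT t|lborel. slope (r k) t * \<phi> t) \<longlonglongrightarrow> (LINT t|lborel. g t * \<phi> t)"
  proof (rule L2_weak_limit_of_primitives[of "\<lambda>k. slope (r k)" K P])
    show "(\<lambda>k. LINT t|lborel. indicator {..<x} t * slope (r k) t) \<longlonglongrightarrow> P x" if "x \<in> {0..1}" for x
      using P[OF that] unfolding slope_primitive[OF r1] .
  qed (use slope_square_integrable[OF r1] slope_square_integral[OF r1] slope_support in blast)+
  then interpret chain_limit v \<gamma>s \<gamma> \<eta> K K' Q r X h P g
    using r r1 X h P by unfold_locales auto
  have "X ` {..<max_broken} \<subseteq> {0..1}" using X_range by auto
  then show ?thesis
    using r r1 u_SBV converges_L1_u ac_density_u finite_jump_set_u jump_u_nonneg locally_weakly_converges_u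
    by (intro exI[of _ r] exI[of _ u] conjI exI[of _ "X ` {..<max_broken}"]) auto
qed

section \<open>Coercivity of Lennard-Jones potentials\<close>

locale LJ_potential =
  fixes \<alpha> b c d :: real and \<Psi> :: "real \<Rightarrow> ereal" and \<eta> :: real and J :: "real \<Rightarrow> ereal"
  assumes c_pos: "0 < c" and d_gt_1: "1 < d" and \<eta>_pos: "0 < \<eta>"
    and \<Psi>_nonneg: "\<And>z. 0 \<le> \<Psi> z" and \<Psi>_convex: "convex_ext \<Psi>"
    and in_class: "J \<in> LJ_class \<alpha> b c d \<Psi> \<eta>"
begin

abbreviation "\<delta> \<equiv> minimizer J"

definition f :: "real \<Rightarrow> real" where "f z = real_of_ereal (J z)"

lemma
  shows not_MInf: "J z \<noteq> -\<infinity>"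
    and C3: "C_k_on 3 (dom_fin J) f"
    and infinite_nonpos: "z \<le> 0 \<Longrightarrow> J z = \<infinity>"
    and minimizer_unique: "\<exists>!z. is_arg_min J (\<lambda>_. True) z"
    and minimum_negative: "J \<delta> < 0"
    and strictly_convex: "strictly_convex_ext_on {0<..<\<delta>} J"
    and lower_bound: "0 < z \<Longrightarrow> ereal (1/d) * \<Psi> z - ereal d \<le> J z"
    and upper_bound: "0 < z \<Longrightarrow> J z \<le> ereal d * max (\<Psi> z) (ereal \<bar>z\<bar>)"
    and tendsto_0_at_top: "(J \<longlongrightarrow> 0) at_top"
    and quadratic_growth_ext:
      "\<bar>z - \<delta>\<bar> < \<eta> \<Longrightarrow> J z - J \<delta> \<ge> ereal (1/c * (z - \<delta>)\<^sup>2)"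
  using in_class unfolding LJ_class_def f_def by auto

lemma dom_fin_iff: "z \<in> dom_fin J \<longleftrightarrow> J z = ereal (f z)"
  using not_MInf[of z] by (cases "J z") (auto simp: dom_fin_def f_def)

lemma minimizer_in_dom: "\<delta> \<in> dom_fin J"
  using minimum_negative by (auto simp: dom_fin_def)

lemma minimizer_is_arg_min: "is_arg_min J (\<lambda>_. True) \<delta>"
  unfolding minimizer_def arg_min_def using minimizer_unique by (metis someI_ex)

lemma minimizer_le: "J \<delta> \<le> J z"
  using minimizer_is_arg_min by (auto simp: is_arg_min_def not_less)

lemma minimizer_less:
  assumes "z \<noteq> \<delta>" shows "J \<delta> < J z"
proof (rule ccontr)
  assume "\<not> J \<delta> < J z"
  then have "J z = J \<delta>" using minimizer_le[of z] by simp
  then have "is_arg_min J (\<lambda>_. True) z"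
    using minimizer_is_arg_min by (simp add: is_arg_min_def)
  with minimizer_unique minimizer_is_arg_min assms show False by blast
qed

text \<open>The bounds in LJ2 transfer finiteness in both directions, which makes the convexity of
  \<open>\<Psi>\<close> a statement on the domain of \<open>J\<close>.\<close>

lemma infinite_iff:
  assumes "0 < z" shows "J z = \<infinity> \<longleftrightarrow> \<Psi> z = \<infinity>"
proof
  assume "J z = \<infinity>"
  then show "\<Psi> z = \<infinity>"
    using upper_bound[OF assms] \<Psi>_nonneg[of z] by (cases "\<Psi> z") (auto simp: max_def split: if_splits)
next
  assume "\<Psi> z = \<infinity>"
  then show "J z = \<infinity>" using lower_bound[OF assms] d_gt_1 by simp
qed

lemma dom_fin_pos: "z \<in> dom_fin J \<Longrightarrow> 0 < z"
  using infinite_nonpos[of z] by (force simp: dom_fin_def)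

text \<open>The bounds by \<open>\<Psi>\<close> make the domain an interval, and the limit at infinity makes it
  unbounded.\<close>

lemma dom_fin_upward_closed:
  assumes x: "x \<in> dom_fin J" and "x \<le> y"
  shows "y \<in> dom_fin J"
proof (cases "x = y")
  case False
  have pos: "0 < x" using dom_fin_pos[OF x] .
  have "\<forall>\<^sub>F z in at_top. J z < 1"
    using tendsto_0_at_top by (rule order_tendstoD) simp
  then obtain Z where Z: "\<And>z. Z \<le> z \<Longrightarrow> J z < 1" by (auto simp: eventually_at_top_linorder)
  define z where "z = max Z (y + 1)"
  have z: "y < z" "J z \<noteq> \<infinity>" using Z[of z] by (auto simp: z_def)
  define t where "t = (y - x) / (z - x)"
  have t: "0 < t" "t < 1" using False \<open>x \<le> y\<close> z(1) by (auto simp: t_def)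
  have "t * (z - x) = y - x" using z(1) \<open>x \<le> y\<close> by (simp add: t_def)
  then have y: "(1 - t) * x + t * z = y" by (simp add: algebra_simps)
  have "\<Psi> x \<noteq> \<infinity>" using x infinite_iff[OF pos] by (simp add: dom_fin_def)
  moreover have "\<Psi> z \<noteq> \<infinity>" using z(2) infinite_iff[of z] pos \<open>x \<le> y\<close> z(1) by simp
  ultimately have "ereal (1 - t) * \<Psi> x + ereal t * \<Psi> z < \<infinity>"
    using \<Psi>_nonneg[of x] \<Psi>_nonneg[of z] by (cases "\<Psi> x"; cases "\<Psi> z") auto
  moreover have "\<Psi> y \<le> ereal (1 - t) * \<Psi> x + ereal t * \<Psi> z"
    using \<Psi>_convex t unfolding convex_ext_def y[symmetric] by blast
  ultimately have "\<Psi> y \<noteq> \<infinity>" by auto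
  then show ?thesis using infinite_iff[of y] pos \<open>x \<le> y\<close> by (simp add: dom_fin_def)
qed (use x in simp)

lemma continuous_on_dom_fin: "continuous_on (dom_fin J) f"
proof -
  have "\<forall>z\<in>dom_fin J. f differentiable (at z within dom_fin J)"
    using C3 unfolding C_k_on_def by (metis nth_deriv_within.simps(1) zero_less_numeral)
  then show ?thesis
    by (auto simp: continuous_on_eq_continuous_within intro: differentiable_imp_continuous_within)
qed

lemma tendsto_at_right_dom_fin:
  assumes "z \<in> dom_fin J" shows "(f \<longlongrightarrow> f z) (at_right z)"
proof -
  have "(f \<longlongrightarrow> f z) (at z within dom_fin J)"
    using continuous_on_dom_fin assms by (auto simp: continuous_on_def)
  then show ?thesis
    by (rule tendsto_within_subset) (use dom_fin_upward_closed[OF assms] in auto)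
qed

lemma tendsto_at_left_minimizer:
  assumes "x \<in> dom_fin J" "x < \<delta>" shows "(f \<longlongrightarrow> f \<delta>) (at_left \<delta>)"
proof -
  have "(f \<longlongrightarrow> f \<delta>) (at \<delta> within dom_fin J)"
    using continuous_on_dom_fin minimizer_in_dom by (auto simp: continuous_on_def)
  then have "(f \<longlongrightarrow> f \<delta>) (at \<delta> within {x..\<delta>})"
    by (rule tendsto_within_subset) (use dom_fin_upward_closed[OF assms(1)] in auto)
  then show ?thesis using assms(2) by (simp add: at_within_Icc_at_left)
qed

lemma quadratic_growth:
  assumes "z \<in> dom_fin J" "\<bar>z - \<delta>\<bar> < \<eta>"
  shows "(z - \<delta>)\<^sup>2 / c \<le> f z - f \<delta>"
  using quadratic_growth_ext[OF assms(2)] assms(1) minimizer_in_dom by (simp add: dom_fin_iff)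

text \<open>By convexity the secant from \<open>x\<close> to \<open>p = \<delta> - \<theta>\<close>
  is at least as steep as the one from \<open>p\<close> to \<open>\<delta>\<close>, and the latter
  drops by at least \<open>\<theta>\<^sup>2 / c\<close> over the length \<open>\<theta>\<close> by
  LJ4.\<close>

lemma linear_growth_left:
  assumes x: "x \<in> dom_fin J" and \<theta>: "0 < \<theta>" "\<theta> < \<eta>" "x \<le> \<delta> - \<theta>"
  shows "\<theta> / c * (\<delta> - x) \<le> f x - f \<delta>"
proof (cases "x = \<delta> - \<theta>")
  case True
  then show ?thesis using quadratic_growth[OF x] \<theta> by (simp add: power2_eq_square)
next
  case False
  define p where "p = \<delta> - \<theta>"
  have xp: "x < p" using False \<theta> by (simp add: p_def)
  have p_dom: "p \<in> dom_fin J" using dom_fin_upward_closed[OF x] xp by simp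
  have "(\<theta>)\<^sup>2 / c \<le> f p - f \<delta>" using quadratic_growth[OF p_dom] \<theta> by (simp add: p_def)
  \<comment> \<open>Convexity is assumed on the open interval left of \<open>\<delta>\<close>, so
    the chord ends at some \<open>y < \<delta>\<close> and \<open>y\<close> tends to
    \<open>\<delta>\<close> afterwards.\<close>
  have chord: "(y - x) * f p \<le> (y - p) * f x + (p - x) * f y" if y: "p < y" "y < \<delta>" for y
  proof -
    have y_dom: "y \<in> dom_fin J" using dom_fin_upward_closed[OF x, of y] xp y by simp
    define t where "t = (p - x) / (y - x)"
    have t: "0 < t" "t < 1" using xp y by (auto simp: t_def)
    have ty: "t * (y - x) = p - x" using xp y by (simp add: t_def)
    then have p_eq: "(1 - t) * x + t * y = p" by (simp add: algebra_simps)
    have "J p < ereal (1 - t) * J x + ereal t * J y"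
      using strictly_convex[unfolded strictly_convex_ext_on_def, rule_format, of x y t]
        t dom_fin_pos[OF x] xp y x y_dom p_eq
      by (simp add: dom_fin_def)
    then have "f p \<le> (1 - t) * f x + t * f y"
      using x y_dom p_dom by (simp add: dom_fin_iff)
    then have "(y - x) * f p \<le> (y - x) * ((1 - t) * f x + t * f y)"
      using xp y by (intro mult_left_mono) auto
    also have "\<dots> = ((y - x) - t * (y - x)) * f x + (t * (y - x)) * f y"
      by (simp add: algebra_simps)
    also have "\<dots> = (y - p) * f x + (p - x) * f y" unfolding ty by simp
    finally show ?thesis .
  qed
  have "(\<delta> - x) * f p \<le> (\<delta> - p) * f x + (p - x) * f \<delta>"
  proof (rule tendsto_le)
    have id: "((\<lambda>y. y) \<longlongrightarrow> \<delta>) (at_left \<delta>)" by (rule tendsto_ident_at)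
    show "((\<lambda>y. (y - x) * f p) \<longlongrightarrow> (\<delta> - x) * f p) (at_left \<delta>)"
      by (intro tendsto_intros id)
    show "((\<lambda>y. (y - p) * f x + (p - x) * f y) \<longlongrightarrow> (\<delta> - p) * f x + (p - x) * f \<delta>) (at_left \<delta>)"
      using \<theta> xp by (intro tendsto_intros id tendsto_at_left_minimizer[OF x]) (auto simp: p_def)
    have "p < \<delta>" using \<theta> by (simp add: p_def)
    then show "\<forall>\<^sub>F y in at_left \<delta>. (y - x) * f p \<le> (y - p) * f x + (p - x) * f y"
      unfolding eventually_at_left[OF \<open>p < \<delta>\<close>] using chord by blast
  qed simp
  then have "(\<delta> - x) * (f p - f \<delta>) \<le> \<theta> * (f x - f \<delta>)"
    by (simp add: p_def algebra_simps)
  moreover have "(\<delta> - x) * (\<theta>\<^sup>2 / c) \<le> (\<delta> - x) * (f p - f \<delta>)"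
    using \<open>\<theta>\<^sup>2 / c \<le> f p - f \<delta>\<close> xp \<theta> by (intro mult_left_mono) (auto simp: p_def)
  ultimately have "\<theta> * (\<theta> / c * (\<delta> - x)) \<le> \<theta> * (f x - f \<delta>)"
    by (simp add: power2_eq_square mult_ac)
  then show ?thesis using \<theta>(1) by (rule mult_left_le_imp_le)
qed

lemma gap_left:
  assumes "0 < \<rho>"
  obtains e where "0 < e" "\<And>z. z \<le> \<delta> - \<rho> \<Longrightarrow> J z \<ge> ereal (f \<delta> + e)"
proof -
  \<comment> \<open>LJ4 needs a distance strictly below \<open>\<eta>\<close>, hence the factor
    1/2.\<close>
  define \<theta> where "\<theta> = min \<rho> (\<eta> / 2)"
  have \<theta>: "0 < \<theta>" "\<theta> < \<eta>" "\<theta> \<le> \<rho>" using assms \<eta>_pos by (auto simp: \<theta>_def)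
  have "J z \<ge> ereal (f \<delta> + \<theta>\<^sup>2 / c)" if z: "z \<le> \<delta> - \<rho>" for z
  proof (cases "z \<in> dom_fin J")
    case True
    have "\<theta> / c * (\<delta> - z) \<le> f z - f \<delta>" using linear_growth_left[OF True \<theta>(1,2)] z \<theta>(3) by simp
    moreover have "\<theta> / c * \<theta> \<le> \<theta> / c * (\<delta> - z)"
      using z \<theta> c_pos by (intro mult_left_mono) auto
    ultimately show ?thesis using True by (simp add: dom_fin_iff power2_eq_square)
  qed (simp add: dom_fin_def)
  then show thesis using \<theta>(1) c_pos by (intro that[of "\<theta>\<^sup>2 / c"]) auto
qed

text \<open>Compactness replaces convexity: on a bounded interval the continuous \<open>f\<close>
  attains its minimum, which exceeds \<open>f \<delta>\<close> because the minimizer is unique, and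
  farther out \<open>J\<close> is close to 0 while \<open>f \<delta> < 0\<close>. The resulting
  \<open>e\<close> depends on the potential.\<close>

lemma gap_right:
  assumes "\<delta> < t"
  obtains e where "0 < e" "\<And>z. t \<le> z \<Longrightarrow> J z \<ge> ereal (f \<delta> + e)"
proof -
  have dom: "z \<in> dom_fin J" if "t \<le> z" for z
    using dom_fin_upward_closed[OF minimizer_in_dom] assms that by simp
  have neg: "f \<delta> < 0" using minimum_negative minimizer_in_dom by (simp add: dom_fin_iff)
  have "\<forall>\<^sub>F z in at_top. J z > ereal (f \<delta> / 2)"
    using tendsto_0_at_top by (rule order_tendstoD) (use neg in simp)
  then obtain Z where Z: "\<And>z. Z \<le> z \<Longrightarrow> J z > ereal (f \<delta> / 2)"
    by (auto simp: eventually_at_top_linorder)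
  have "\<exists>y\<in>{t..max Z t}. \<forall>z\<in>{t..max Z t}. f y \<le> f z"
    by (rule continuous_attains_inf) (use dom in \<open>auto intro: continuous_on_subset[OF continuous_on_dom_fin]\<close>)
  then obtain y where y: "t \<le> y" "\<And>z. t \<le> z \<Longrightarrow> z \<le> max Z t \<Longrightarrow> f y \<le> f z" by auto
  have "f \<delta> < f y"
    using minimizer_less[of y] y(1) assms dom[OF y(1)] minimizer_in_dom by (simp add: dom_fin_iff)
  show thesis
  proof (rule that[of "min (f y - f \<delta>) (- f \<delta> / 2)"])
    show "0 < min (f y - f \<delta>) (- f \<delta> / 2)" using \<open>f \<delta> < f y\<close> neg by simp
    show "J z \<ge> ereal (f \<delta> + min (f y - f \<delta>) (- f \<delta> / 2))" if z: "t \<le> z" for z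
    proof (cases "z \<le> max Z t")
      case True
      then show ?thesis using y(2)[OF z] dom[OF z] by (simp add: dom_fin_iff)
    next
      case False
      then have "ereal (f \<delta> / 2) < J z" using Z[of z] by auto
      then show ?thesis using dom[OF z] by (auto simp: dom_fin_iff min_def)
    qed
  qed
qed

end

text \<open>A condition on countably many values of the potential, with which measurability is
  plain, and which forces the depth \<open>e\<close> of the well outside of an interval \<open>[t - r, t]\<close>
  containing the minimizer.\<close>

definition well_depth :: "real \<Rightarrow> real \<Rightarrow> real \<Rightarrow> real \<Rightarrow> (real \<Rightarrow> ereal) \<Rightarrow> bool" where
  "well_depth r t s e J \<longleftrightarrow> (\<exists>q\<in>\<rat>. q < t \<and> J q < ereal s) \<and>
    (\<forall>q\<in>\<rat>. q \<le> t - r \<longrightarrow> ereal s \<le> J q) \<and> (\<forall>q\<in>\<rat>. t \<le> q \<longrightarrow> ereal (s + e) \<le> J q)"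

context LJ_potential
begin

text \<open>Right continuity on the domain passes lower bounds from rational to real
  arguments.\<close>

lemma rat_limit_ge:
  assumes z: "z \<in> dom_fin J" and "z < u" and ge: "\<And>q. q \<in> \<rat> \<Longrightarrow> z < q \<Longrightarrow> q < u \<Longrightarrow> ereal a \<le> J q"
  shows "ereal a \<le> J z"
proof (rule ccontr)
  assume "\<not> ereal a \<le> J z"
  then have "f z < a" using z by (simp add: dom_fin_iff)
  from order_tendstoD(2)[OF tendsto_at_right_dom_fin[OF z] this]
  obtain y where y: "z < y" "\<And>x. z < x \<Longrightarrow> x < y \<Longrightarrow> f x < a"
    unfolding eventually_at_right_field by blast
  obtain q where q: "q \<in> \<rat>" "z < q" "q < min y u"
    using Rats_dense_in_real[of z "min y u"] y(1) \<open>z < u\<close> by auto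
  then have "q \<in> dom_fin J" using dom_fin_upward_closed[OF z] by simp
  moreover have "f q < a" using y q by simp
  ultimately show False using ge[OF q(1,2)] q(3) by (simp add: dom_fin_iff)
qed

text \<open>A rational \<open>t\<close> between \<open>\<delta>\<close> and
  \<open>\<delta> + \<eta>\<close> puts \<open>\<delta>\<close> inside the interval of length
  \<open>\<eta>\<close> that ends at \<open>t\<close>; the gaps on both sides leave room for a level
  \<open>s\<close> slightly above the minimum.\<close>

lemma well_depth_exists:
  obtains t s e where "t \<in> \<rat>" "s \<in> \<rat>" "e \<in> \<rat>" "0 < e" "well_depth \<eta> t s e J"
proof -
  obtain t where t: "t \<in> \<rat>" "\<delta> < t" "t < \<delta> + \<eta>"
    using Rats_dense_in_real[of "\<delta>" "\<delta> + \<eta>"] \<eta>_pos by auto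
  obtain e1 where e1: "0 < e1" "\<And>z. z \<le> t - \<eta> \<Longrightarrow> J z \<ge> ereal (f \<delta> + e1)"
    using gap_left[of "\<delta> - (t - \<eta>)"] t by auto
  obtain e2 where e2: "0 < e2" "\<And>z. t \<le> z \<Longrightarrow> J z \<ge> ereal (f \<delta> + e2)"
    using gap_right[OF t(2)] by auto
  \<comment> \<open>The height of \<open>s\<close> above the minimum and the depth \<open>e\<close>
    each take less than half of the right gap \<open>e2\<close>, so \<open>s + e\<close> stays below
    \<open>f \<delta> + e2\<close>.\<close>
  obtain s where s: "s \<in> \<rat>" "f \<delta> < s" "s < f \<delta> + min e1 (e2 / 2)"
    using Rats_dense_in_real[of "f \<delta>" "f \<delta> + min e1 (e2 / 2)"] e1(1) e2(1) by auto
  obtain e where e: "e \<in> \<rat>" "0 < e" "e < e2 / 2"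
    using Rats_dense_in_real[of 0 "e2 / 2"] e2(1) by auto
  have "\<exists>q\<in>\<rat>. q < t \<and> J q < ereal s"
  proof (rule ccontr)
    assume "\<not> ?thesis"
    then have "ereal s \<le> J \<delta>" using t by (intro rat_limit_ge[OF minimizer_in_dom t(2)]) (auto simp: not_less)
    then show False using s minimizer_in_dom by (simp add: dom_fin_iff)
  qed
  moreover have "ereal s \<le> J q" if "q \<le> t - \<eta>" for q
    using e1(2)[OF that] s by (elim order_trans[rotated]) simp
  moreover have "ereal (s + e) \<le> J q" if "t \<le> q" for q
    using e2(2)[OF that] s e by (elim order_trans[rotated]) simp
  ultimately have "well_depth \<eta> t s e J" by (simp add: well_depth_def)
  then show thesis using that t s e by blast
qed

text \<open>The minimum is below \<open>s\<close>, so it cannot sit left of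
  \<open>t - \<eta>\<close>; a deviation \<open>w \<ge> \<eta>\<close> therefore stretches the bond
  to at least \<open>t\<close>, where the potential is at least \<open>s + e\<close>.\<close>

lemma well_depth_gap:
  assumes well: "well_depth \<eta> t s e J" and w: "\<eta> \<le> w"
  shows "e \<le> f (w + \<delta>) - f \<delta>"
proof -
  obtain q where "J q < ereal s" using well by (auto simp: well_depth_def)
  then have "J \<delta> < ereal s" using minimizer_le[of q] by (rule le_less_trans[rotated])
  then have s: "f \<delta> < s" using minimizer_in_dom by (simp add: dom_fin_iff)
  have "t - \<eta> \<le> \<delta>"
  proof (rule ccontr)
    assume "\<not> t - \<eta> \<le> \<delta>"
    then have "ereal s \<le> J \<delta>"
      using well by (intro rat_limit_ge[OF minimizer_in_dom, of "t - \<eta>"]) (auto simp: well_depth_def)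
    then show False using s minimizer_in_dom by (simp add: dom_fin_iff)
  qed
  have dom: "w + \<delta> \<in> dom_fin J"
    using dom_fin_upward_closed[OF minimizer_in_dom] w \<eta>_pos by simp
  have "ereal (s + e) \<le> J (w + \<delta>)"
    using well \<open>t - \<eta> \<le> \<delta>\<close> w
    by (intro rat_limit_ge[OF dom, of "w + \<delta> + 1"]) (auto simp: well_depth_def)
  then show ?thesis using s dom by (simp add: dom_fin_iff)
qed

end

section \<open>Stationary actions: from hit counts to cardinalities\<close>

lemma (in ergodic_action) action_in_space: "\<omega> \<in> space M \<Longrightarrow> \<tau> i \<omega> \<in> space M"
  using action_measurable[of i] by (simp add: measurable_space)

text \<open>Stationarity is stated for images; by the group law the preimage under
  \<open>\<tau> i\<close> is the image under \<open>\<tau> (- i)\<close>.\<close>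

lemma (in ergodic_action) prob_action_vimage:
  assumes B: "B \<in> sets M"
  shows "prob (\<tau> i -` B \<inter> space M) = prob B"
proof -
  have "\<tau> i -` B \<inter> space M = \<tau> (- i) ` B"
  proof (intro equalityI subsetI)
    fix \<omega> assume \<omega>: "\<omega> \<in> \<tau> i -` B \<inter> space M"
    then have "\<tau> (- i) (\<tau> i \<omega>) = \<omega>"
      using action_add[of \<omega> "- i" i] action_zero[of \<omega>] by simp
    with \<omega> show "\<omega> \<in> \<tau> (- i) ` B" by (metis IntD1 imageI vimageD)
  next
    fix \<omega> assume "\<omega> \<in> \<tau> (- i) ` B"
    then obtain \<omega>' where \<omega>': "\<omega>' \<in> B" "\<omega> = \<tau> (- i) \<omega>'" by auto
    then have "\<omega>' \<in> space M" using sets.sets_into_space[OF B] by auto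
    then show "\<omega> \<in> \<tau> i -` B \<inter> space M"
      using \<omega>' action_add[of \<omega>' i "- i"] action_zero[of \<omega>'] action_in_space[of \<omega>' "- i"] by simp
  qed
  then show ?thesis using stationary[OF B] by simp
qed

text \<open>The index sets do not depend on \<omega>. On a set \<open>A k\<close> of probability
  above \<open>1 - prob B / 2\<close> all hit counts are at most \<open>k\<close>, while each index
  contributes at least \<open>prob B / 2\<close> to the integral of the count over that set; so
  \<open>card (P n)\<close> is at most \<open>2 * k / prob B\<close>.\<close>

lemma (in ergodic_action) bounded_hits_imp_bounded_card:
  fixes P :: "nat \<Rightarrow> nat set"
  assumes B: "B \<in> sets M" "0 < prob B" and fin: "\<And>n. finite (P n)"
    and hits: "\<And>\<omega>. \<omega> \<in> space M \<Longrightarrow> \<exists>C. \<forall>n. real (card {i \<in> P n. \<tau> (int i) \<omega> \<in> B}) \<le> C"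
  obtains Q :: nat where "\<And>n. card (P n) \<le> Q"
proof -
  define N where "N n \<omega> = (\<Sum>i\<in>P n. indicator (\<tau> (int i) -` B \<inter> space M) \<omega> :: real)" for n \<omega>
  have vim[measurable]: "\<tau> i -` B \<inter> space M \<in> sets M" for i
    using action_measurable[of i] B(1) by (rule measurable_sets)
  have N_card: "N n \<omega> = real (card {i \<in> P n. \<tau> (int i) \<omega> \<in> B})" if "\<omega> \<in> space M" for n \<omega>
    using fin[of n] that unfolding N_def
    by (simp add: indicator_def of_bool_def sum.If_cases Int_def)
  have N_meas[measurable]: "N n \<in> borel_measurable M" for n
    unfolding N_def by measurable
  define A where "A k = {\<omega> \<in> space M. \<forall>n. N n \<omega> \<le> real k}" for k :: nat
  have A[measurable]: "A k \<in> sets M" for k unfolding A_def by measurable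
  have "incseq A" by (auto simp: incseq_def A_def intro: order_trans)
  then have "(\<lambda>k. prob (A k)) \<longlonglongrightarrow> prob (\<Union>k. A k)"
    by (intro finite_Lim_measure_incseq) (use A in auto)
  moreover have "(\<Union>k. A k) = space M"
  proof (intro equalityI subsetI)
    fix \<omega> assume \<omega>: "\<omega> \<in> space M"
    then obtain C where "\<And>n. N n \<omega> \<le> C" using hits N_card by metis
    moreover obtain k where "C \<le> real k" using real_arch_simple by blast
    ultimately show "\<omega> \<in> (\<Union>k. A k)" using \<omega> by (auto simp: A_def intro: order_trans)
  qed (auto simp: A_def)
  ultimately have "(\<lambda>k. prob (A k)) \<longlonglongrightarrow> 1" using prob_space by simp
  then have "\<forall>\<^sub>F k in sequentially. 1 - prob B / 2 < prob (A k)"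
    by (rule order_tendstoD) (use B(2) in simp)
  then obtain k where k: "1 - prob B / 2 < prob (A k)" by (auto simp: eventually_sequentially)
  have "real (card (P n)) * (prob B / 2) \<le> real k" for n
  proof -
    have "prob B / 2 \<le> prob (A k \<inter> (\<tau> (int i) -` B \<inter> space M))" for i
    proof -
      have "prob B = prob (\<tau> (int i) -` B \<inter> space M)" using prob_action_vimage[OF B(1)] by simp
      also have "\<dots> \<le> prob ((A k \<inter> (\<tau> (int i) -` B \<inter> space M)) \<union> (space M - A k))"
        by (intro finite_measure_mono) auto
      also have "\<dots> \<le> prob (A k \<inter> (\<tau> (int i) -` B \<inter> space M)) + prob (space M - A k)"
        by (intro measure_Un_le) auto
      also have "prob (space M - A k) = 1 - prob (A k)" by (rule prob_compl) simp
      finally show ?thesis using k by simp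
    qed
    then have "real (card (P n)) * (prob B / 2) \<le> (\<Sum>i\<in>P n. prob (A k \<inter> (\<tau> (int i) -` B \<inter> space M)))"
      using sum_bounded_below[of "P n" "prob B / 2"] by simp
    also have "\<dots> = (\<Sum>i\<in>P n. \<integral>\<omega>. indicator (A k \<inter> (\<tau> (int i) -` B \<inter> space M)) \<omega> \<partial>M)"
      by (intro sum.cong refl) (simp add: Int_absorb1 sets.sets_into_space)
    also have "\<dots> = (\<integral>\<omega>. (\<Sum>i\<in>P n. indicator (A k \<inter> (\<tau> (int i) -` B \<inter> space M)) \<omega>) \<partial>M)"
      by (rule Bochner_Integration.integral_sum[symmetric]) (simp add: integrable_indicator_iff emeasure_eq_measure)
    also have "\<dots> \<le> (\<integral>\<omega>. real k \<partial>M)"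
    proof (rule integral_mono)
      show "integrable M (\<lambda>\<omega>. \<Sum>i\<in>P n. indicator (A k \<inter> (\<tau> (int i) -` B \<inter> space M)) \<omega> :: real)"
        by (intro Bochner_Integration.integrable_sum) (simp add: integrable_indicator_iff emeasure_eq_measure)
      fix \<omega> assume "\<omega> \<in> space M"
      have "(\<Sum>i\<in>P n. indicator (A k \<inter> (\<tau> (int i) -` B \<inter> space M)) \<omega>) = indicator (A k) \<omega> * N n \<omega>"
        by (simp add: N_def sum_distrib_left indicator_inter_arith)
      also have "\<dots> \<le> real k" by (auto simp: A_def split: split_indicator)
      finally show "(\<Sum>i\<in>P n. indicator (A k \<inter> (\<tau> (int i) -` B \<inter> space M)) \<omega>) \<le> real k" .
    qed simp
    also have "\<dots> = real k" using prob_space by simp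
    finally show ?thesis .
  qed
  then have "real (card (P n)) \<le> real k / (prob B / 2)" for n
    using B(2) by (simp add: field_simps)
  moreover obtain Q :: nat where "real k / (prob B / 2) \<le> real Q" using real_arch_simple by blast
  ultimately have "card (P n) \<le> Q" for n by (meson of_nat_le_iff order_trans)
  then show thesis by (rule that)
qed

section \<open>Energy estimates for the random potential\<close>

context random_LJ_potential
begin

lemma LJ_potential_at: "\<omega> \<in> space M \<Longrightarrow> LJ_potential \<alpha> b c d \<Psi> \<eta> (J \<omega>)"
  by unfold_locales (use c_pos d_gt_1 \<eta>_pos \<Psi>_nonneg \<Psi>_convex J_class in auto)

lemma well_depth_measurable: "{\<omega> \<in> space M. well_depth r t s e (J \<omega>)} \<in> sets M"
proof -
  have [measurable]: "(\<lambda>\<omega>. J \<omega> q) \<in> borel_measurable M" for q by (rule J_measurable)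
  have "Measurable.pred M (\<lambda>\<omega>. (\<exists>q::rat. of_rat q < t \<and> J \<omega> (of_rat q) < ereal s) \<and>
      (\<forall>q::rat. of_rat q \<le> t - r \<longrightarrow> ereal s \<le> J \<omega> (of_rat q)) \<and>
      (\<forall>q::rat. t \<le> of_rat q \<longrightarrow> ereal (s + e) \<le> J \<omega> (of_rat q)))"
    by measurable
  then have "Measurable.pred M (\<lambda>\<omega>. well_depth r t s e (J \<omega>))"
    by (simp add: well_depth_def Rats_def)
  then show ?thesis by (simp add: pred_def)
qed

text \<open>The rational triples with positive \<open>e\<close> are countably many and their events
  cover the space, so not all of these events are null sets.\<close>

lemma uniform_well_depth:
  obtains t s e where "0 < e" "0 < prob {\<omega> \<in> space M. well_depth \<eta> t s e (J \<omega>)}"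
proof -
  define W where "W = (\<lambda>(t :: real, s :: real, e :: real). {\<omega> \<in> space M. well_depth \<eta> t s e (J \<omega>)})"
  define I where "I = (\<rat> :: real set) \<times> (\<rat> :: real set) \<times> (\<rat> \<inter> {0<..} :: real set)"
  have "countable I"
    unfolding I_def by (intro countable_SIGMA countable_rat countable_Int1)
  have "\<exists>i\<in>I. W i \<notin> null_sets M"
  proof (rule ccontr)
    assume "\<not> ?thesis"
    then have "(\<Union>i\<in>I. W i) \<in> null_sets M"
      using \<open>countable I\<close> by (intro null_sets_UN') auto
    moreover have "(\<Union>i\<in>I. W i) = space M"
    proof (intro equalityI subsetI)
      fix \<omega> assume \<omega>: "\<omega> \<in> space M"
      obtain t s e where "t \<in> \<rat>" "s \<in> \<rat>" "e \<in> \<rat>" "0 < e" "well_depth \<eta> t s e (J \<omega>)"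
        by (rule LJ_potential.well_depth_exists[OF LJ_potential_at[OF \<omega>]])
      then have "(t, s, e) \<in> I" "\<omega> \<in> W (t, s, e)" using \<omega> by (auto simp: I_def W_def)
      then show "\<omega> \<in> (\<Union>i\<in>I. W i)" by blast
    qed (auto simp: W_def)
    ultimately show False using emeasure_space_1 by (auto simp: null_sets_def)
  qed
  then obtain t s e where "(t, s, e) \<in> I" "W (t, s, e) \<notin> null_sets M" by auto
  then have "0 < e" "prob (W (t, s, e)) \<noteq> 0"
    using well_depth_measurable[of \<eta> t s e] by (auto simp: I_def W_def null_sets_def emeasure_eq_measure)
  then show thesis
    by (intro that[of e t s]) (auto simp: W_def zero_less_measure_iff)
qed

text \<open>\<open>real_of_ereal \<infinity>\<close> is 0, so this is the energy of a bond only
  where the potential is finite; estimates from below therefore require membership in the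
  domain.\<close>

abbreviation excess :: "'w \<Rightarrow> real \<Rightarrow> real" where
  "excess \<omega> w \<equiv> real_of_ereal (J \<omega> (w + minimizer (J \<omega>))) - real_of_ereal (J \<omega> (minimizer (J \<omega>)))"

lemma excess_nonneg:
  assumes "\<omega> \<in> space M" "w + minimizer (J \<omega>) \<in> dom_fin (J \<omega>)"
  shows "0 \<le> excess \<omega> w"
proof -
  interpret L: LJ_potential \<alpha> b c d \<Psi> \<eta> "J \<omega>" by (rule LJ_potential_at[OF assms(1)])
  show ?thesis
    using L.minimizer_le[of "w + minimizer (J \<omega>)"] assms(2) L.minimizer_in_dom
    unfolding L.dom_fin_iff L.f_def[symmetric] by simp
qed

text \<open>All summands are nonnegative because the minimum is subtracted; a bounded sum then
  bounds each of them, and the computation can move from extended to real numbers.\<close>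

lemma energy_le_imp:
  assumes \<omega>: "\<omega> \<in> space M" and E: "energy \<tau> J n g \<omega> v \<le> ereal C"
  defines "w \<equiv> bond n v"
  shows "v \<in> affine_chains n" "v 0 = 0" "v 1 = g"
    and "\<And>i. i < n \<Longrightarrow> w i + minimizer (J (\<tau> (int i) \<omega>)) \<in> dom_fin (J (\<tau> (int i) \<omega>))"
    and "(\<Sum>i<n. excess (\<tau> (int i) \<omega>) (w i)) \<le> C"
proof -
  have cond: "v \<in> affine_chains n \<and> v 0 = 0 \<and> v 1 = g"
  proof (rule ccontr)
    assume "\<not> ?thesis"
    then have "energy \<tau> J n g \<omega> v = \<infinity>" unfolding energy_def by (rule if_not_P)
    with E show False by simp
  qed
  then show "v \<in> affine_chains n" "v 0 = 0" "v 1 = g" by auto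
  let ?J = "\<lambda>i. J (\<tau> (int i) \<omega>)"
  let ?T = "\<lambda>i. ?J i (w i + minimizer (?J i)) - ?J i (minimizer (?J i))"
  have sum: "(\<Sum>i<n. ?T i) \<le> ereal C"
    using E unfolding energy_def if_P[OF cond] w_def bond_def .
  have LJ: "LJ_potential \<alpha> b c d \<Psi> \<eta> (?J i)" for i
    by (rule LJ_potential_at[OF action_in_space[OF \<omega>]])
  define m where "m i = LJ_potential.f (?J i) (minimizer (?J i))" for i
  have min: "?J i (minimizer (?J i)) = ereal (m i)" for i
    using LJ_potential.minimizer_in_dom[OF LJ] LJ_potential.dom_fin_iff[OF LJ]
    unfolding m_def by blast
  have nn: "0 \<le> ?T i" for i
    using LJ_potential.minimizer_le[OF LJ, of i "w i + minimizer (?J i)"] min[of i]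
    by (cases "?J i (w i + minimizer (?J i))") auto
  show dom: "w i + minimizer (?J i) \<in> dom_fin (?J i)" if "i < n" for i
  proof -
    have "?T i \<le> (\<Sum>i<n. ?T i)"
      using sum_mono2[of "{..<n}" "{i}" ?T] that nn by simp
    with sum have "?T i \<le> ereal C" by (rule order_trans[rotated])
    then have "?J i (w i + minimizer (?J i)) \<noteq> \<infinity>" by (auto simp: min)
    then show ?thesis by (simp add: dom_fin_def)
  qed
  have "(\<Sum>i<n. ?T i) = (\<Sum>i<n. ereal (excess (\<tau> (int i) \<omega>) (w i)))"
  proof (intro sum.cong refl)
    fix i assume "i \<in> {..<n}"
    then obtain m' where "?J i (w i + minimizer (?J i)) = ereal m'"
      using dom[of i] LJ_potential.dom_fin_iff[OF LJ] by auto
    with min[of i] show "?T i = ereal (excess (\<tau> (int i) \<omega>) (w i))" by simp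
  qed
  with sum show "(\<Sum>i<n. excess (\<tau> (int i) \<omega>) (w i)) \<le> C" by simp
qed

text \<open>The class admits potentials with a second well that is almost as deep as the first one, so
  there is no uniform gap \<open>J z - J \<delta>\<close> for \<open>z \<ge> \<delta> + \<eta>\<close>. It is the boundedness of the energy of
  one and the same sequence for every \<open>\<omega>\<close> that limits the number of long bonds, because the gap
  is uniform on a set of positive probability.\<close>

lemma bounded_long_bonds:
  fixes v :: "nat \<Rightarrow> real \<Rightarrow> real" and g :: "nat \<Rightarrow> real"
  assumes bounded: "\<And>\<omega>. \<omega> \<in> space M \<Longrightarrow> \<exists>C. \<forall>n\<ge>1. energy \<tau> J n (g n) \<omega> (v n) \<le> ereal C"
  defines "w n \<equiv> bond n (v n)"
  obtains Q :: nat where "\<And>n. 1 \<le> n \<Longrightarrow> card {i. i < n \<and> \<eta> \<le> w n i} \<le> Q"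
proof -
  obtain t s e where e: "0 < e" and pos: "0 < prob {\<omega> \<in> space M. well_depth \<eta> t s e (J \<omega>)}"
    by (rule uniform_well_depth)
  define B where "B = {\<omega> \<in> space M. well_depth \<eta> t s e (J \<omega>)}"
  define P where "P n = (if 1 \<le> n then {i. i < n \<and> \<eta> \<le> w n i} else {})" for n :: nat
  have P_fin: "finite (P n)" for n by (simp add: P_def)
  \<comment> \<open>Every long bond that meets \<open>B\<close> costs at least \<open>e\<close>, so
    the energy at this \<omega> limits their number; the bound may depend on \<omega>.\<close>
  have hits: "\<exists>C. \<forall>n. real (card {i \<in> P n. \<tau> (int i) \<omega> \<in> B}) \<le> C" if \<omega>: "\<omega> \<in> space M" for \<omega>
  proof -
    obtain C where C: "\<And>n. 1 \<le> n \<Longrightarrow> energy \<tau> J n (g n) \<omega> (v n) \<le> ereal C"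
      using bounded[OF \<omega>] by auto
    have "real (card {i \<in> P n. \<tau> (int i) \<omega> \<in> B}) \<le> \<bar>C\<bar> / e" for n
    proof (cases "1 \<le> n")
      case True
      note E = energy_le_imp(4,5)[OF \<omega> C[OF True], folded w_def]
      have "real (card {i \<in> P n. \<tau> (int i) \<omega> \<in> B}) * e = (\<Sum>i | i \<in> P n \<and> \<tau> (int i) \<omega> \<in> B. e)" by simp
      also have "\<dots> \<le> (\<Sum>i | i \<in> P n \<and> \<tau> (int i) \<omega> \<in> B. excess (\<tau> (int i) \<omega>) (w n i))"
      proof (rule sum_mono)
        fix i assume i: "i \<in> {i. i \<in> P n \<and> \<tau> (int i) \<omega> \<in> B}"
        interpret L: LJ_potential \<alpha> b c d \<Psi> \<eta> "J (\<tau> (int i) \<omega>)"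
          by (rule LJ_potential_at[OF action_in_space[OF \<omega>]])
        show "e \<le> excess (\<tau> (int i) \<omega>) (w n i)"
          using L.well_depth_gap[of t s e "w n i"] i True unfolding L.f_def[symmetric]
          by (simp add: P_def B_def)
      qed
      also have "\<dots> \<le> (\<Sum>i<n. excess (\<tau> (int i) \<omega>) (w n i))"
        using E(1) excess_nonneg[OF action_in_space[OF \<omega>]]
        by (intro sum_mono2) (auto simp: P_def)
      also have "\<dots> \<le> \<bar>C\<bar>" using E(2) by linarith
      finally show ?thesis using e by (simp add: field_simps)
    next
      case False
      then show ?thesis using e by (simp add: P_def)
    qed
    then show ?thesis by blast
  qed
  show thesis
  proof (rule bounded_hits_imp_bounded_card[OF _ _ P_fin hits])
    show "B \<in> sets M" "0 < prob B" unfolding B_def by (rule well_depth_measurable pos)+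
    fix Q :: nat assume Q: "\<And>n. card (P n) \<le> Q"
    show thesis
    proof (rule that)
      show "card {i. i < n \<and> \<eta> \<le> w n i} \<le> Q" if "1 \<le> n" for n
        using Q[of n] that by (simp add: P_def)
    qed
  qed
qed

text \<open>The quadratic bound is LJ4 itself. The linear one is the growth left of the minimizer
  with \<open>\<theta> = \<eta> / 2\<close>, which gives the constant
  \<open>2 * c / \<eta>\<close>.\<close>

lemma short_bonds_estimate:
  assumes \<omega>: "\<omega> \<in> space M" and E: "energy \<tau> J n g \<omega> v \<le> ereal C"
  defines "w \<equiv> bond n v"
  shows "(\<Sum>i | i < n \<and> \<bar>w i\<bar> < \<eta>. (w i)\<^sup>2) \<le> c * C"
    and "(\<Sum>i | i < n \<and> w i \<le> - \<eta>. \<bar>w i\<bar>) \<le> 2 * c / \<eta> * C"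
proof -
  note E' = energy_le_imp(4,5)[OF \<omega> E, folded w_def]
  have sub: "(\<Sum>i\<in>A. excess (\<tau> (int i) \<omega>) (w i)) \<le> C" if "A \<subseteq> {..<n}" for A
  proof -
    have "(\<Sum>i\<in>A. excess (\<tau> (int i) \<omega>) (w i)) \<le> (\<Sum>i<n. excess (\<tau> (int i) \<omega>) (w i))"
      using E'(1) excess_nonneg[OF action_in_space[OF \<omega>]] that by (intro sum_mono2) auto
    with E'(2) show ?thesis by simp
  qed
  have "(\<Sum>i | i < n \<and> \<bar>w i\<bar> < \<eta>. (w i)\<^sup>2) \<le> (\<Sum>i | i < n \<and> \<bar>w i\<bar> < \<eta>. c * excess (\<tau> (int i) \<omega>) (w i))"
  proof (rule sum_mono)
    fix i assume i: "i \<in> {i. i < n \<and> \<bar>w i\<bar> < \<eta>}"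
    interpret L: LJ_potential \<alpha> b c d \<Psi> \<eta> "J (\<tau> (int i) \<omega>)"
      by (rule LJ_potential_at[OF action_in_space[OF \<omega>]])
    have "(w i)\<^sup>2 / c \<le> excess (\<tau> (int i) \<omega>) (w i)"
      using L.quadratic_growth[OF E'(1)[of i]] i unfolding L.f_def[symmetric] by simp
    then show "(w i)\<^sup>2 \<le> c * excess (\<tau> (int i) \<omega>) (w i)" using c_pos by (simp add: field_simps)
  qed
  also have "\<dots> \<le> c * C"
    unfolding sum_distrib_left[symmetric] using c_pos by (intro mult_left_mono sub) auto
  finally show "(\<Sum>i | i < n \<and> \<bar>w i\<bar> < \<eta>. (w i)\<^sup>2) \<le> c * C" .
  have "(\<Sum>i | i < n \<and> w i \<le> - \<eta>. \<bar>w i\<bar>) \<le>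
      (\<Sum>i | i < n \<and> w i \<le> - \<eta>. 2 * c / \<eta> * excess (\<tau> (int i) \<omega>) (w i))"
  proof (rule sum_mono)
    fix i assume i: "i \<in> {i. i < n \<and> w i \<le> - \<eta>}"
    interpret L: LJ_potential \<alpha> b c d \<Psi> \<eta> "J (\<tau> (int i) \<omega>)"
      by (rule LJ_potential_at[OF action_in_space[OF \<omega>]])
    have "\<eta> / 2 / c * (- w i) \<le> excess (\<tau> (int i) \<omega>) (w i)"
      using L.linear_growth_left[OF E'(1)[of i], of "\<eta> / 2"] i \<eta>_pos
      unfolding L.f_def[symmetric] by simp
    then show "\<bar>w i\<bar> \<le> 2 * c / \<eta> * excess (\<tau> (int i) \<omega>) (w i)"
      using c_pos \<eta>_pos i by (simp add: field_simps)
  qed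
  also have "\<dots> \<le> 2 * c / \<eta> * C"
    unfolding sum_distrib_left[symmetric] using c_pos \<eta>_pos by (intro mult_left_mono sub) auto
  finally show "(\<Sum>i | i < n \<and> w i \<le> - \<eta>. \<bar>w i\<bar>) \<le> 2 * c / \<eta> * C" .
qed

end

theorem theorem3p1:
  fixes M :: "'w measure" and \<tau> :: "int \<Rightarrow> 'w \<Rightarrow> 'w"
    and \<alpha> b c d \<eta> :: real and \<Psi> :: "real \<Rightarrow> ereal"
    and J :: "'w \<Rightarrow> real \<Rightarrow> ereal" and \<omega>\<^sub>0 :: 'w
    and l \<gamma>s :: "nat \<Rightarrow> real" and \<gamma> :: real and v :: "nat \<Rightarrow> real \<Rightarrow> real"
  assumes potential: "random_LJ_potential M \<tau> \<alpha> b c d \<Psi> \<eta> J"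
    and \<omega>\<^sub>0: "\<omega>\<^sub>0 \<in> space M"
    and ell_lim: "l \<longlonglongrightarrow> (LINT \<omega>|M. minimizer (J \<omega>))"
    and ell_gt: "\<forall>n\<ge>1. l n > (LINT \<omega>|M. minimizer (J \<omega>))"
    and ell_gt_avg: "\<forall>n\<ge>1. l n > 1 / real n * (\<Sum>k<n. minimizer (J (\<tau> (int k) \<omega>\<^sub>0)))"
    and \<gamma>s: "\<forall>n\<ge>1. \<gamma>s n =
      (l n - (\<Sum>k<n. lam n * minimizer (J (\<tau> (int k) \<omega>\<^sub>0)))) / sqrt (lam n)"
    and \<gamma>s_lim: "\<gamma>s \<longlonglongrightarrow> \<gamma>"
    and bounded_energy: "\<forall>\<omega>\<in>space M. (SUP n\<in>{1..}. energy \<tau> J n (\<gamma>s n) \<omega> (v n)) < \<infinity>"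
  shows "\<exists>r u. strict_mono r \<and> (\<forall>k. 1 \<le> r k) \<and> u \<in> SBV \<gamma> \<and>
      converges_L1 {0<..<1} (\<lambda>k. v (r k)) u \<and>
      ac_density u \<in> L2_on {0<..<1} \<and>
      finite (jump_set u) \<and>
      (\<forall>x\<in>{0..1}. jump u x \<ge> 0) \<and>
      (\<exists>S. finite S \<and> S \<subseteq> {0..1} \<and>
           locally_weakly_converges_H1 ({0<..<1} - S) (\<lambda>k. v (r k)) u)"
proof -
  interpret random_LJ_potential M \<tau> \<alpha> b c d \<Psi> \<eta> J by (rule potential)
  have bounded: "\<exists>C. \<forall>n\<ge>1. energy \<tau> J n (\<gamma>s n) \<omega> (v n) \<le> ereal C" if "\<omega> \<in> space M" for \<omega>
  proof -
    have "(SUP n\<in>{1..}. energy \<tau> J n (\<gamma>s n) \<omega> (v n)) \<noteq> \<infinity>"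
      using bounded_energy that by auto
    then obtain C :: nat where C: "(SUP n\<in>{1..}. energy \<tau> J n (\<gamma>s n) \<omega> (v n)) < ereal (real C)"
      unfolding less_PInf_Ex_of_nat by blast
    have "energy \<tau> J n (\<gamma>s n) \<omega> (v n) \<le> ereal (real C)" if "1 \<le> n" for n
      using SUP_upper[of n "{1..}" "\<lambda>n. energy \<tau> J n (\<gamma>s n) \<omega> (v n)"] C that
      by (meson atLeast_iff less_imp_le order_trans)
    then show ?thesis by blast
  qed
  \<comment> \<open>The count of long bonds draws on the energy bounds at all realizations; the
    other two bounds come from the one at \<open>\<omega>\<^sub>0\<close>.\<close>
  obtain Q where Q: "\<And>n. 1 \<le> n \<Longrightarrow> card {i. i < n \<and> \<eta> \<le> bond n (v n) i} \<le> Q"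
    by (rule bounded_long_bonds[OF bounded]) auto
  obtain C where C: "\<And>n. 1 \<le> n \<Longrightarrow> energy \<tau> J n (\<gamma>s n) \<omega>\<^sub>0 (v n) \<le> ereal C"
    using bounded[OF \<omega>\<^sub>0] by auto
  interpret chain_sequence v \<gamma>s \<gamma> \<eta> "c * C" "2 * c / \<eta> * C" Q
    by unfold_locales
      (use energy_le_imp(1-3)[OF \<omega>\<^sub>0 C] short_bonds_estimate[OF \<omega>\<^sub>0 C] \<gamma>s_lim \<eta>_pos Q in auto)
  show ?thesis by (rule compactness)
qed

end
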